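(* Up to conformal transformations of $S^2$ and $S^3$, every conformal fibration of $S^3$ by circles is the Hopf fibration. That is, if $\pi\colon S^3\to S^2$ is a conformal submersion all of whose fibers are circles, then there are conformal transformations $f\colon S^3\to S^3$ and $g\colon S^2\to S^2$ such that $g\circ\pi\circ f$ is the Hopf fibration.
   Context: $S^3\subset\mathbb R^4$ and $S^2\cong\mathbb{CP}^1$ carry the conformal structures of their round metrics. A submersion $\pi\colon (P,g)\to(M,h)$ of Riemannian manifolds is conformal if for each $p\in P$ the restriction $d_p\pi\colon(\ker d_p\pi)^\perp\to T_{\pi(p)}M$ is a conformal linear map; this depends only on the conformal classes. A circle in $S^3$ is the intersection of $S^3$ with an affine 2-plane in $\mathbb R^4$, containing more than one point; each fiber $\pi^{-1}(p)$ is required to be such a circle. Conformal transformations are angle-preserving diffeomorphisms (Möbius transformations); they are allowed to reverse orientation. The Hopf fibration is $S^3\subset\mathbb C^2\to\mathbb{CP}^1\cong S^2$, $(z_1,z_2)\mapsto[z_1:z_2]$. *)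

theory Defs
  imports "HOL-Analysis.Analysis"
begin

text \<open>Euclidean four-space is modelled by \<open>complex \<times> complex\<close> and Euclidean three-space by
  \<open>complex \<times> real\<close>, both with the inner product and norm of their product type. Maps between
  spheres are total functions whose values matter only on the sphere.\<close>

abbreviation S3 :: "(complex \<times> complex) set" where
  "S3 \<equiv> sphere 0 1"

abbreviation S2 :: "(complex \<times> real) set" where
  "S2 \<equiv> sphere 0 1"


section \<open>Smooth maps and differentials on unit spheres\<close>

primrec Ck_on :: "nat \<Rightarrow> 'a set \<Rightarrow> ('a::euclidean_space \<Rightarrow> 'b::euclidean_space) \<Rightarrow> bool" where
  "Ck_on 0 U f \<longleftrightarrow> continuous_on U f"
| "Ck_on (Suc k) U f \<longleftrightarrow> (\<forall>x\<in>U. f differentiable (at x)) \<and>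
     (\<forall>v. Ck_on k U (\<lambda>x. frechet_derivative f (at x) v))"

text \<open>Smoothness on an embedded submanifold: local extendability to a smooth map on an open
  subset of the ambient Euclidean space.\<close>

definition smooth_on :: "'a set \<Rightarrow> ('a::euclidean_space \<Rightarrow> 'b::euclidean_space) \<Rightarrow> bool" where
  "smooth_on S f \<longleftrightarrow> (\<forall>p\<in>S. \<exists>U F. open U \<and> p \<in> U \<and> (\<forall>k. Ck_on k U F) \<and>
     (\<forall>x\<in>S \<inter> U. F x = f x))"

definition sphere_tangent :: "'a::euclidean_space \<Rightarrow> 'a set" where
  "sphere_tangent p = {v. v \<bullet> p = 0}"

text \<open>The derivative within the sphere is a linear map on the whole ambient space, chosen
  arbitrarily in the direction normal to the sphere; on tangent vectors it is uniquely determined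
  (lemma \<open>sphere_differential_eq\<close>), and only tangent vectors are ever fed to it below.\<close>

definition sphere_differential ::
    "('a::euclidean_space \<Rightarrow> 'b::euclidean_space) \<Rightarrow> 'a \<Rightarrow> 'a \<Rightarrow> 'b" where
  "sphere_differential f p = frechet_derivative f (at p within sphere 0 1)"

lemma sphere_derivative_curve:
  fixes f :: "'a::euclidean_space \<Rightarrow> 'b::euclidean_space"
  assumes D: "(f has_derivative D) (at p within sphere 0 1)"
    and p: "norm p = 1" and v: "v \<bullet> p = 0" "norm v = 1"
  shows "((\<lambda>t. f (cos t *\<^sub>R p + sin t *\<^sub>R v)) has_derivative (\<lambda>t. D (t *\<^sub>R v))) (at (0::real))"
proof -
  define c where "c = (\<lambda>t::real. cos t *\<^sub>R p + sin t *\<^sub>R v)"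
  have c: "(c has_derivative (\<lambda>t. t *\<^sub>R v)) (at 0)"
    unfolding c_def by (auto intro!: derivative_eq_intros)
  have "norm (c t) = 1" for t
  proof -
    have "(norm (c t))\<^sup>2 = (cos t)\<^sup>2 * (norm p)\<^sup>2 + (sin t)\<^sup>2 * (norm v)\<^sup>2"
      unfolding c_def power2_norm_eq_inner using v(1)
      by (simp add: inner_add_left inner_add_right inner_commute power2_eq_square)
    then show ?thesis using p v(2) by (simp add: power2_eq_1_iff) (smt (verit) norm_ge_zero)
  qed
  then have "range c \<subseteq> sphere 0 1" by auto
  then have "(f has_derivative D) (at (c 0) within range c)"
    using D by (simp add: c_def has_derivative_subset)
  from has_derivative_in_compose[OF c this] show ?thesis
    by (simp add: c_def o_def)
qed

lemma sphere_derivative_unique: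
  fixes f :: "'a::euclidean_space \<Rightarrow> 'b::euclidean_space"
  assumes D: "(f has_derivative D) (at p within sphere 0 1)"
    and D': "(f has_derivative D') (at p within sphere 0 1)"
    and p: "p \<in> sphere 0 1" and v: "v \<in> sphere_tangent p"
  shows "D v = D' v"
proof (cases "v = 0")
  case True
  then show ?thesis
    using D D' by (simp add: has_derivative_linear linear_0)
next
  case False
  define u where "u = v /\<^sub>R norm v"
  have u: "u \<bullet> p = 0" "norm u = 1"
    using v False by (auto simp: u_def sphere_tangent_def)
  have np: "norm p = 1" using p by simp
  have "(\<lambda>t::real. D (t *\<^sub>R u)) = (\<lambda>t. D' (t *\<^sub>R u))"
    using sphere_derivative_curve[OF D np u] sphere_derivative_curve[OF D' np u]
    by (rule has_derivative_unique)
  then have "D (norm v *\<^sub>R u) = D' (norm v *\<^sub>R u)" by meson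
  then show ?thesis using False by (simp add: u_def)
qed

lemma sphere_differential_eq:
  fixes f :: "'a::euclidean_space \<Rightarrow> 'b::euclidean_space"
  assumes "(f has_derivative D) (at p within sphere 0 1)"
    and "p \<in> sphere 0 1" and "v \<in> sphere_tangent p"
  shows "sphere_differential f p v = D v"
proof -
  have "(f has_derivative sphere_differential f p) (at p within sphere 0 1)"
    unfolding sphere_differential_def using assms(1) differentiableI frechet_derivative_works
    by blast
  from sphere_derivative_unique[OF this assms] show ?thesis .
qed


section \<open>Conformality\<close>

definition conformal_linear_on :: "'a set \<Rightarrow> ('a::real_inner \<Rightarrow> 'b::real_inner) \<Rightarrow> bool" where
  "conformal_linear_on V L \<longleftrightarrow> linear L \<and> (\<exists>c>0. \<forall>u\<in>V. \<forall>v\<in>V. L u \<bullet> L v = c * (u \<bullet> v))"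

definition conformal_transformation :: "('a::euclidean_space \<Rightarrow> 'a) \<Rightarrow> bool" where
  "conformal_transformation f \<longleftrightarrow>
     bij_betw f (sphere 0 1) (sphere 0 1) \<and>
     smooth_on (sphere 0 1) f \<and>
     smooth_on (sphere 0 1) (inv_into (sphere 0 1) f) \<and>
     (\<forall>p\<in>sphere 0 1. conformal_linear_on (sphere_tangent p) (sphere_differential f p))"

definition vertical_space ::
    "('a::euclidean_space \<Rightarrow> 'b::euclidean_space) \<Rightarrow> 'a \<Rightarrow> 'a set" where
  "vertical_space \<pi> p = {v \<in> sphere_tangent p. sphere_differential \<pi> p v = 0}"

definition horizontal_space ::
    "('a::euclidean_space \<Rightarrow> 'b::euclidean_space) \<Rightarrow> 'a \<Rightarrow> 'a set" where
  "horizontal_space \<pi> p = {v \<in> sphere_tangent p. \<forall>w\<in>vertical_space \<pi> p. v \<bullet> w = 0}"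

definition submersion :: "('a::euclidean_space \<Rightarrow> 'b::euclidean_space) \<Rightarrow> bool" where
  "submersion \<pi> \<longleftrightarrow>
     \<pi> ` sphere 0 1 \<subseteq> sphere 0 1 \<and>
     smooth_on (sphere 0 1) \<pi> \<and>
     (\<forall>p\<in>sphere 0 1. sphere_differential \<pi> p ` sphere_tangent p = sphere_tangent (\<pi> p))"

definition conformal_submersion :: "('a::euclidean_space \<Rightarrow> 'b::euclidean_space) \<Rightarrow> bool" where
  "conformal_submersion \<pi> \<longleftrightarrow> submersion \<pi> \<and>
     (\<forall>p\<in>sphere 0 1. conformal_linear_on (horizontal_space \<pi> p) (sphere_differential \<pi> p))"


section \<open>Circles in the three-sphere\<close>

definition is_circle :: "(complex \<times> complex) set \<Rightarrow> bool" where
  "is_circle C \<longleftrightarrow>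
     (\<exists>A. affine A \<and> aff_dim A = 2 \<and> C = S3 \<inter> A) \<and> (\<exists>x\<in>C. \<exists>y\<in>C. x \<noteq> y)"


section \<open>The complex projective line and the Hopf fibration\<close>

definition proportional :: "complex \<times> complex \<Rightarrow> complex \<times> complex \<Rightarrow> bool" where
  "proportional z w \<longleftrightarrow> z \<noteq> 0 \<and> w \<noteq> 0 \<and> (\<exists>c. w = (c * fst z, c * snd z))"

lemma proportional_sym: "proportional z w \<Longrightarrow> proportional w z"
proof -
  assume "proportional z w"
  then obtain c where c: "z \<noteq> 0" "w \<noteq> 0" "w = (c * fst z, c * snd z)"
    by (auto simp: proportional_def)
  then have "c \<noteq> 0" by (auto simp: zero_prod_def)
  then have "z = (inverse c * fst w, inverse c * snd w)"
    using c(3) by (simp add: prod_eq_iff field_simps)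
  then show ?thesis using c unfolding proportional_def by blast
qed

lemma proportional_trans: "proportional x y \<Longrightarrow> proportional y z \<Longrightarrow> proportional x z"
  unfolding proportional_def by (metis fst_conv mult.assoc snd_conv)

quotient_type CP1 = "complex \<times> complex" / partial: proportional
  morphisms rep_CP1 homogeneous
proof (rule part_equivpI)
  show "\<exists>x. proportional x x"
    unfolding proportional_def by (intro exI[of _ "(1,1)"]) (auto simp: zero_prod_def intro!: exI[of _ 1])
  show "symp proportional"
    by (rule sympI) (rule proportional_sym)
  show "transp proportional"
    by (rule transpI) (rule proportional_trans)
qed

text \<open>The usual identification of the projective line with the Riemann sphere: \<open>[z1 : z2]\<close> is sent
  to the inverse stereographic projection (from the north pole \<open>(0, 1)\<close>) of \<open>z1 / z2\<close>, and
  \<open>[1 : 0]\<close> to the north pole; see \<open>CP1_to_S2_affine\<close> and \<open>CP1_to_S2_infinity\<close>.\<close>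

lift_definition CP1_to_S2 :: "CP1 \<Rightarrow> complex \<times> real" is
  "\<lambda>(z1, z2). (2 * z1 * cnj z2 / of_real ((norm z1)\<^sup>2 + (norm z2)\<^sup>2),
               ((norm z1)\<^sup>2 - (norm z2)\<^sup>2) / ((norm z1)\<^sup>2 + (norm z2)\<^sup>2))"
proof -
  fix z w :: "complex \<times> complex"
  assume "proportional z w"
  then obtain c where c: "z \<noteq> 0" "w \<noteq> 0" "w = (c * fst z, c * snd z)"
    by (auto simp: proportional_def)
  then have c0: "c \<noteq> 0" by (auto simp: zero_prod_def)
  obtain z1 z2 where z: "z = (z1, z2)" by (cases z)
  define n where "n = (norm z1)\<^sup>2 + (norm z2)\<^sup>2"
  have n: "(norm (c * z1))\<^sup>2 + (norm (c * z2))\<^sup>2 = (norm c)\<^sup>2 * n"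
      "(norm (c * z1))\<^sup>2 - (norm (c * z2))\<^sup>2 = (norm c)\<^sup>2 * ((norm z1)\<^sup>2 - (norm z2)\<^sup>2)"
    by (simp_all add: n_def norm_mult power_mult_distrib algebra_simps)
  have "2 * (c * z1) * cnj (c * z2) = of_real ((norm c)\<^sup>2) * (2 * z1 * cnj z2)"
    by (simp add: complex_norm_square algebra_simps del: of_real_power)
  then show "?thesis z w"
    using c0 unfolding c(3) z by (simp only: fst_conv snd_conv prod.case n n_def[symmetric]) simp
qed

lemma CP1_to_S2_affine:
  "CP1_to_S2 (homogeneous (z, 1)) =
     (2 * z / of_real ((norm z)\<^sup>2 + 1), ((norm z)\<^sup>2 - 1) / ((norm z)\<^sup>2 + 1))"
  by (subst CP1_to_S2.abs_eq) (auto simp: proportional_def zero_prod_def intro!: exI[of _ 1])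

lemma CP1_to_S2_infinity: "CP1_to_S2 (homogeneous (1, 0)) = (0, 1)"
  by (subst CP1_to_S2.abs_eq) (auto simp: proportional_def zero_prod_def intro!: exI[of _ 1])

definition hopf :: "complex \<times> complex \<Rightarrow> complex \<times> real" where
  "hopf z = CP1_to_S2 (homogeneous z)"

end

theory Submission
  imports Defs "HOL-Complex_Analysis.Complex_Analysis"
begin

text \<open>A circle in \<open>S3\<close> is the zero set on \<open>S3\<close> of a complex affine function \<open>p \<mapsto> v \<bullet> p - m\<close> whose
  coefficient vector \<open>(v, m)\<close> is null for the complexified Minkowski form and spacelike for the
  associated Hermitian form; the vector is unique up to scaling and complex conjugation.
  In a stereographic chart \<open>z\<close> of \<open>S2\<close>, conformality of \<open>\<pi>\<close> means that \<open>z \<circ> \<pi>\<close> has a null complex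
  gradient, and together with that gradient every point of a fibre determines the vector of the
  fibre. Normalized to take the value 1 at a point of the fibre over infinity, the vector depends
  holomorphically on \<open>z\<close>, and it grows at most linearly, because the fibre functions in the chart
  around infinity have a simple zero there. By Liouville's theorem the fibre over \<open>z\<close> is given by
  \<open>\<psi>0 + z \<psi>1\<close>. The vectors \<open>\<psi>0\<close> and \<open>\<psi>1\<close> span a totally null plane on which the Hermitian form is
  positive definite; a Lorentz transformation and an affine change of \<open>z\<close> turn them into the
  coordinate functions of \<open>\<complex>\<^sup>2\<close>, whose quotient is the Hopf map.\<close>

section \<open>Smooth maps and Moebius transformations of spheres\<close>

text \<open>The two conjugate null vectors of a circle are its two orientations. The null gradient
  of the chart selects one of them at every point, and connectedness of the fibre keeps the
  selection constant along it. The fibration thus becomes a curve in the null quadric of complex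
  five-space, and holomorphy with linear growth says that this curve is a line; a line inside a
  quadric is a totally null plane. Two difficulties shape the argument. A fibre fixes its vector
  only up to a factor, so a derivative in \<open>z\<close> makes sense only after a normalization.
  Evaluation at a point over infinity is chosen because such a point lies on no fibre over a finite
  \<open>z\<close>: the normalizing value never vanishes, and the price is growth at infinity.
  Secondly, the vector at \<open>x\<close> contains a coefficient \<open>mu x\<close> fixed by
  another point of the fibre, so its differentiability has to come from a second local section.
  Positivity of the Hermitian form comes from the geometry: \<open>\<psi>1\<close> and every
  \<open>P z\<close> are themselves multiples of vectors of fibres.\<close>

lemma euclidean_components_linear:
  fixes L :: "'a::euclidean_space \<Rightarrow> 'b::real_vector"
  assumes "linear L"
  shows "L w = (\<Sum>b\<in>Basis. (w \<bullet> b) *\<^sub>R L b)"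
proof -
  have "L (\<Sum>b\<in>Basis. (w \<bullet> b) *\<^sub>R b) = (\<Sum>b\<in>Basis. (w \<bullet> b) *\<^sub>R L b)"
    by (simp add: linear_sum[OF assms] linear_cmul[OF assms] del: euclidean_representation)
  then show ?thesis by (simp add: euclidean_representation)
qed

section \<open>Calculus of \<open>Ck_on\<close> on open sets\<close>

lemma Ck_on_cong:
  assumes "open U" "\<And>x. x \<in> U \<Longrightarrow> f x = g x" "Ck_on k U f"
  shows "Ck_on k U g"
  using assms(2,3)
proof (induction k arbitrary: f g)
  case 0
  then show ?case by (simp cong: continuous_on_cong)
next
  case (Suc k)
  have d: "(g has_derivative frechet_derivative f (at x)) (at x)" if x: "x \<in> U" for x
  proof (rule has_derivative_transform_within_open[OF _ \<open>open U\<close> x Suc.prems(1)])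
    show "(f has_derivative frechet_derivative f (at x)) (at x)"
      using Suc.prems(2) x by (simp add: frechet_derivative_works[symmetric])
  qed
  have eq: "frechet_derivative f (at x) = frechet_derivative g (at x)" if "x \<in> U" for x
    by (rule frechet_derivative_at[OF d[OF that]])
  have "Ck_on k U (\<lambda>x. frechet_derivative g (at x) v)" for v
    by (rule Suc.IH[of "\<lambda>x. frechet_derivative f (at x) v"]) (use Suc.prems(2) in \<open>simp_all add: eq\<close>)
  with d show ?case
    by (auto simp: differentiable_def)
qed

lemma Ck_on_subset: "Ck_on k U f \<Longrightarrow> V \<subseteq> U \<Longrightarrow> Ck_on k V f"
  by (induction k arbitrary: f) (auto intro: continuous_on_subset)

lemma Ck_on_SucD: "Ck_on (Suc k) U f \<Longrightarrow> Ck_on k U f"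
proof (induction k arbitrary: f)
  case 0
  then show ?case
    by (auto intro!: continuous_at_imp_continuous_on differentiable_imp_continuous_within)
next
  case (Suc k)
  have "Ck_on k U (\<lambda>x. frechet_derivative f (at x) v)" for v
    using Suc by simp
  with Suc.prems show ?case by simp
qed

text \<open>The closure properties below know the derivative by an explicit formula; this rule puts
  that formula in the place of \<open>frechet_derivative\<close>.\<close>

lemma Ck_on_SucI:
  assumes "open U" "\<And>x. x \<in> U \<Longrightarrow> (f has_derivative f' x) (at x)"
    and "\<And>v. Ck_on k U (\<lambda>x. f' x v)"
  shows "Ck_on (Suc k) U f"
proof -
  have "Ck_on k U (\<lambda>x. frechet_derivative f (at x) v)" for v
    by (rule Ck_on_cong[OF assms(1) _ assms(3)[of v]]) (metis assms(2) frechet_derivative_at)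
  with assms(2) show ?thesis by (auto simp: differentiable_def)
qed

lemma Ck_on_SucE:
  assumes "Ck_on (Suc k) U f"
  shows "x \<in> U \<Longrightarrow> (f has_derivative frechet_derivative f (at x)) (at x)"
    and "Ck_on k U (\<lambda>x. frechet_derivative f (at x) v)"
  using assms by (auto simp: frechet_derivative_works[symmetric])

lemma Ck_on_const: "open U \<Longrightarrow> Ck_on k U (\<lambda>x. c)"
proof (induction k arbitrary: c)
  case (Suc k)
  then show ?case by (intro Ck_on_SucI[where f' = "\<lambda>_ _. 0"]) auto
qed simp

lemma Ck_on_linear:
  assumes "open U" "bounded_linear L"
  shows "Ck_on k U L"
proof (cases k)
  case 0
  then show ?thesis using assms linear_continuous_on by auto
next
  case (Suc n)
  have "Ck_on (Suc n) U L"
    by (rule Ck_on_SucI[OF assms(1) bounded_linear_imp_has_derivative[OF assms(2)]])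
      (rule Ck_on_const[OF assms(1)])
  with Suc show ?thesis by simp
qed

lemma Ck_on_add:
  assumes "open U"
  shows "Ck_on k U f \<Longrightarrow> Ck_on k U g \<Longrightarrow> Ck_on k U (\<lambda>x. f x + g x)"
proof (induction k arbitrary: f g)
  case (Suc k)
  show ?case
    by (rule Ck_on_SucI[OF assms has_derivative_add[OF Ck_on_SucE(1) Ck_on_SucE(1)]])
      (use Suc in auto)
qed (auto intro: continuous_intros)

lemma Ck_on_sum:
  assumes "open U"
  shows "(\<And>i. i \<in> I \<Longrightarrow> Ck_on k U (f i)) \<Longrightarrow> Ck_on k U (\<lambda>x. \<Sum>i\<in>I. f i x)"
  by (induction I rule: infinite_finite_induct) (auto intro: assms Ck_on_add Ck_on_const)

lemma Ck_on_bilinear: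
  assumes "open U" "bounded_bilinear pr"
  shows "Ck_on k U f \<Longrightarrow> Ck_on k U g \<Longrightarrow> Ck_on k U (\<lambda>x. pr (f x) (g x))"
proof (induction k arbitrary: f g)
  case 0
  then show ?case using bounded_bilinear.continuous_on[OF assms(2)] by auto
next
  case (Suc k)
  note C = Suc.prems[THEN Ck_on_SucD] Suc.prems[THEN Ck_on_SucE(2)]
  show ?case
    by (rule Ck_on_SucI[OF assms(1) bounded_bilinear.FDERIV[OF assms(2)
          Ck_on_SucE(1)[OF Suc.prems(1)] Ck_on_SucE(1)[OF Suc.prems(2)]]])
      (assumption | intro Ck_on_add[OF assms(1)] Suc.IH C)+
qed

lemmas Ck_on_scaleR = Ck_on_bilinear[OF _ bounded_bilinear_scaleR]
lemmas Ck_on_mult_real = Ck_on_bilinear[OF _ bounded_bilinear_mult[where 'a = real]]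

lemma Ck_on_power_real:
  fixes f :: "'a::euclidean_space \<Rightarrow> real"
  assumes "open U" "Ck_on k U f"
  shows "Ck_on k U (\<lambda>x. f x ^ n)"
  by (induction n) (auto intro: assms Ck_on_const Ck_on_mult_real)

lemma Ck_on_inverse:
  fixes f :: "'a::euclidean_space \<Rightarrow> real"
  assumes "open U" and nz: "\<And>x. x \<in> U \<Longrightarrow> f x \<noteq> 0"
  shows "Ck_on k U f \<Longrightarrow> Ck_on k U (\<lambda>x. inverse (f x))"
proof (induction k)
  case 0
  then show ?case using nz by (auto intro: continuous_intros)
next
  case (Suc k)
  have IH: "Ck_on k U (\<lambda>x. inverse (f x))" using Suc Ck_on_SucD by blast
  have "((\<lambda>x. inverse (f x)) has_derivative
      (\<lambda>v. (- 1 * inverse (f x) ^ 2) * frechet_derivative f (at x) v)) (at x)" if "x \<in> U" for x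
    using Deriv.has_derivative_inverse[OF nz[OF that] Ck_on_SucE(1)[OF Suc.prems that]]
    by (simp add: power2_eq_square mult_ac)
  moreover have "Ck_on k U (\<lambda>x. (- 1 * inverse (f x) ^ 2) * frechet_derivative f (at x) v)" for v
    using IH Suc.prems
    by (intro Ck_on_mult_real Ck_on_power_real Ck_on_const assms) auto
  ultimately show ?case by (intro Ck_on_SucI[OF assms(1)]) blast+
qed

text \<open>The derivative is a polynomial in \<open>inverse (norm x)\<close> and linear functions
  of \<open>x\<close>, so the induction closes on itself. This makes the radial projection
  \<open>sgn\<close> smooth away from 0.\<close>

lemma Ck_on_inverse_norm: "Ck_on k (- {0}) (\<lambda>x::'a::euclidean_space. inverse (norm x))"
proof (induction k)
  case 0
  then show ?case by (auto intro!: continuous_intros)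
next
  case (Suc k)
  have op: "open (- {0::'a})" by auto
  have "((\<lambda>x::'a. inverse (norm x)) has_derivative
      (\<lambda>v. - 1 * inverse (norm x) ^ 3 * (x \<bullet> v))) (at x)" if "x \<in> - {0}" for x
  proof -
    have "(norm has_derivative (\<lambda>v. v \<bullet> sgn x)) (at x)"
      using has_derivative_norm that by simp
    from Deriv.has_derivative_inverse[OF _ this] that show ?thesis
      by (simp add: sgn_div_norm power3_eq_cube inner_commute mult_ac)
  qed
  moreover have "Ck_on k (- {0::'a}) (\<lambda>x. - 1 * inverse (norm x) ^ 3 * (x \<bullet> v))" for v
    using Suc.IH
    by (intro Ck_on_mult_real Ck_on_power_real Ck_on_const op)
      (auto intro: op Ck_on_linear bounded_linear_intros)
  ultimately show ?case by (intro Ck_on_SucI[OF op]) blast+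
qed

lemma Ck_on_compose:
  fixes f :: "'a::euclidean_space \<Rightarrow> 'b::euclidean_space"
    and g :: "'b \<Rightarrow> 'c::euclidean_space"
  assumes "open U" "open V" and fU: "\<And>x. x \<in> U \<Longrightarrow> f x \<in> V"
  shows "Ck_on k U f \<Longrightarrow> Ck_on k V g \<Longrightarrow> Ck_on k U (\<lambda>x. g (f x))"
proof (induction k arbitrary: g)
  case 0
  then show ?case using fU continuous_on_compose2[of V g U f] by auto
next
  case (Suc k)
  let ?F = "\<lambda>x. frechet_derivative f (at x)" and ?G = "\<lambda>y. frechet_derivative g (at y)"
  \<comment> \<open>The direction fed to the derivative of \<open>g\<close> varies with
    \<open>x\<close>, while \<open>Ck_on\<close> speaks of fixed directions. Expanding in the basis
    leaves the fixed directions \<open>b\<close>, to which the induction hypothesis applies.\<close>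
  have "((\<lambda>x. g (f x)) has_derivative (\<lambda>v. \<Sum>b\<in>Basis. (?F x v \<bullet> b) *\<^sub>R ?G (f x) b)) (at x)"
    if x: "x \<in> U" for x
  proof -
    have g: "(g has_derivative ?G (f x)) (at (f x))"
      using Ck_on_SucE(1)[OF Suc.prems(2)] fU[OF x] by blast
    show ?thesis
      by (rule has_derivative_eq_rhs[OF has_derivative_compose[OF Ck_on_SucE(1)[OF Suc.prems(1) x] g]])
        (rule ext, rule euclidean_components_linear[OF has_derivative_linear[OF g]])
  qed
  moreover have "Ck_on k U (\<lambda>x. \<Sum>b\<in>Basis. (?F x v \<bullet> b) *\<^sub>R ?G (f x) b)" for v
  proof (intro Ck_on_sum Ck_on_scaleR assms)
    fix b :: 'b assume "b \<in> Basis"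
    show "Ck_on k U (\<lambda>x. ?F x v \<bullet> b)"
      by (rule Ck_on_bilinear[OF assms(1) bounded_bilinear_inner Ck_on_SucE(2)[OF Suc.prems(1)]
            Ck_on_const[OF assms(1)]])
    show "Ck_on k U (\<lambda>x. ?G (f x) b)"
      by (rule Suc.IH[OF Ck_on_SucD[OF Suc.prems(1)] Ck_on_SucE(2)[OF Suc.prems(2)]])
  qed
  ultimately show ?case by (intro Ck_on_SucI[OF assms(1)]) blast+
qed

text \<open>If \<open>norm (A x + b)\<^sup>2 - (c \<bullet> x + d)\<^sup>2\<close> is a positive multiple of \<open>norm x\<^sup>2 - 1\<close>, this is the action
  of a Lorentz transformation on the sphere, seen as the projectivized light cone.\<close>

definition moebius :: "('a \<Rightarrow> 'a) \<Rightarrow> 'a \<Rightarrow> 'a \<Rightarrow> real \<Rightarrow> 'a \<Rightarrow> 'a::euclidean_space" where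
  "moebius A b c d x = (A x + b) /\<^sub>R (c \<bullet> x + d)"

lemma moebius_smooth:
  assumes A: "linear A" and pos: "\<And>x. norm x = 1 \<Longrightarrow> 0 < c \<bullet> x + d"
    and eq: "\<And>x. norm x = 1 \<Longrightarrow> f x = moebius A b c d x"
  shows "smooth_on (sphere 0 1) f"
  unfolding smooth_on_def
proof (intro ballI exI conjI allI)
  let ?U = "{x. 0 < c \<bullet> x + d}"
  show op: "open ?U" by (intro open_Collect_less continuous_intros)
  show "Ck_on k ?U (moebius A b c d)" for k
  proof -
    have "Ck_on k ?U (\<lambda>x. inverse (c \<bullet> x + d) *\<^sub>R (A x + b))"
      by (intro Ck_on_scaleR Ck_on_inverse Ck_on_add Ck_on_const Ck_on_linear op
          bounded_linear_inner_right linear_conv_bounded_linear[THEN iffD1, OF A]) simp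
    then show ?thesis by (simp add: moebius_def[abs_def])
  qed
qed (use pos eq in auto)

text \<open>On tangent vectors the differential of the quotient is \<open>A\<close> with the
  component along the image point removed, divided by the denominator; \<open>form\<close> then
  shows that inner products are scaled by \<open>k / (c \<bullet> p + d)\<^sup>2\<close>. The
  inverse is supplied in the same shape, which settles its smoothness.\<close>

lemma moebius_conformal:
  fixes A A' :: "'a::euclidean_space \<Rightarrow> 'a"
  assumes lin: "linear A" "linear A'"
    and pos: "\<And>x. norm x = 1 \<Longrightarrow> 0 < c \<bullet> x + d"
    and pos': "\<And>x. norm x = 1 \<Longrightarrow> 0 < c' \<bullet> x + d'"
    and form: "\<And>x. (A x + b) \<bullet> (A x + b) - (c \<bullet> x + d)\<^sup>2 = k * (x \<bullet> x - 1)"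
    and form': "\<And>x. (A' x + b') \<bullet> (A' x + b') - (c' \<bullet> x + d')\<^sup>2 = k' * (x \<bullet> x - 1)"
    and k: "k > 0"
    and inv: "\<And>x. norm x = 1 \<Longrightarrow> moebius A' b' c' d' (moebius A b c d x) = x"
    and inv': "\<And>x. norm x = 1 \<Longrightarrow> moebius A b c d (moebius A' b' c' d' x) = x"
  shows "conformal_transformation (moebius A b c d)"
proof -
  let ?f = "moebius A b c d" and ?g = "moebius A' b' c' d'" and ?S = "sphere 0 (1::real) :: 'a set"
  have unit: "norm (moebius A b c d x) = 1"
    if "norm x = 1" and pos: "\<And>x. norm x = 1 \<Longrightarrow> 0 < c \<bullet> x + d"
      and form: "\<And>x. (A x + b) \<bullet> (A x + b) - (c \<bullet> x + d)\<^sup>2 = k * (x \<bullet> x - 1)"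
    for A b c d k and x :: 'a
  proof -
    have "norm (A x + b) = c \<bullet> x + d"
      using form[of x] pos[OF that(1)] that(1)
      by (simp add: dot_square_norm power2_eq_iff_nonneg)
    then show ?thesis using pos[OF that(1)] by (simp add: moebius_def)
  qed
  have fS: "?f x \<in> ?S" if "x \<in> ?S" for x
    using unit[OF _ pos form] that by simp
  have gS: "?g x \<in> ?S" if "x \<in> ?S" for x
    using unit[OF _ pos' form'] that by simp
  have bij: "bij_betw ?f ?S ?S"
    using fS gS inv inv' by (intro bij_betwI[where g = ?g]) auto
  have inv_eq: "inv_into ?S ?f x = ?g x" if "norm x = 1" for x
    using inv' gS that bij by (metis bij_betw_inv_into_left mem_sphere_0)
  have conf: "conformal_linear_on (sphere_tangent p) (sphere_differential ?f p)"
    if p: "p \<in> ?S" for p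
  proof -
    let ?D = "c \<bullet> p + d" and ?y = "?f p"
    define F where "F = (\<lambda>v. (A v - (c \<bullet> v) *\<^sub>R ?y) /\<^sub>R ?D)"
    have D: "?D > 0" using pos p by simp
    have dA: "(A has_derivative A) (at p within ?S)"
      by (simp add: lin bounded_linear_imp_has_derivative linear_linear)
    have der: "(?f has_derivative F) (at p within ?S)"
      unfolding moebius_def[abs_def] F_def using D
      by (auto intro!: derivative_eq_intros dA simp: fun_eq_iff field_simps scaleR_diff_right)
    have linsd: "linear (sphere_differential ?f p)"
      using der unfolding sphere_differential_def
      by (metis differentiableI frechet_derivative_works has_derivative_linear)
    \<comment> \<open>Polarization: this combination of values of \<open>form\<close> leaves only
      its bilinear part.\<close>
    have quad: "A u \<bullet> A v = (c \<bullet> u) * (c \<bullet> v) + k * (u \<bullet> v)" for u v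
      using form[of "u + v"] form[of u] form[of v] form[of 0]
      by (simp add: linear_add[OF lin(1)] linear_0[OF lin(1)] inner_simps inner_commute
          power2_eq_square algebra_simps)
    \<comment> \<open>The odd part of \<open>form\<close> isolates the terms linear in
      \<open>u\<close>.\<close>
    have first: "A u \<bullet> b = d * (c \<bullet> u)" for u
      using form[of u] form[of "- u"]
      by (simp add: linear_neg[OF lin(1)] inner_simps inner_commute power2_eq_square algebra_simps)
    \<comment> \<open>Hence the term subtracted in \<open>F\<close> is exactly the component of
      \<open>A u\<close> along the unit vector \<open>?y\<close>.\<close>
    have Ay: "A u \<bullet> ?y = c \<bullet> u" if "u \<in> sphere_tangent p" for u
    proof -
      have "A u \<bullet> (A p + b) = (c \<bullet> u) * ?D"
        using quad[of u p] first[of u] that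
        by (simp add: inner_add_right sphere_tangent_def algebra_simps)
      then show ?thesis using D by (simp add: moebius_def)
    qed
    have yy: "?y \<bullet> ?y = 1" using fS[OF p] by (simp add: dot_square_norm)
    have "F u \<bullet> F v = (k / ?D\<^sup>2) * (u \<bullet> v)"
      if u: "u \<in> sphere_tangent p" and v: "v \<in> sphere_tangent p" for u v
    proof -
      have "(A u - (c \<bullet> u) *\<^sub>R ?y) \<bullet> (A v - (c \<bullet> v) *\<^sub>R ?y) = k * (u \<bullet> v)"
        using quad[of u v] Ay[OF u] Ay[OF v] yy
        by (simp add: inner_simps inner_commute algebra_simps)
      then show ?thesis
        unfolding F_def inner_scaleR_left inner_scaleR_right
        by (simp add: divide_inverse power2_eq_square)
    qed
    moreover have "k / ?D\<^sup>2 > 0" using k D by simp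
    moreover have "sphere_differential ?f p v = F v" if "v \<in> sphere_tangent p" for v
      using sphere_differential_eq[OF der p that] .
    ultimately show ?thesis unfolding conformal_linear_on_def using linsd by metis
  qed
  show ?thesis
    unfolding conformal_transformation_def
    using bij conf moebius_smooth[OF lin(1) pos refl] moebius_smooth[OF lin(2) pos' inv_eq] by blast
qed

section \<open>Circles and complex affine functions\<close>

text \<open>\<open>N\<close> points along the projection of \<open>x\<close> to the direction plane
  of the circle and \<open>T\<close> is perpendicular to it in that plane; so
  \<open>x - r *\<^sub>R N\<close> is the centre and \<open>r\<close> the radius.\<close>

lemma circle_param:
  assumes "is_circle C" "x \<in> C"
  obtains T N r where "norm T = 1" "norm N = 1" "T \<bullet> N = 0" "x \<bullet> T = 0" "x \<bullet> N = r" "r > 0"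
    "C = range (\<lambda>\<theta>. x + (r * sin \<theta>) *\<^sub>R T + (r * (cos \<theta> - 1)) *\<^sub>R N)"
proof -
  obtain A where A: "affine A" "aff_dim A = 2" "C = S3 \<inter> A"
    using assms by (auto simp: is_circle_def)
  obtain y where y: "y \<in> C" "y \<noteq> x"
    using assms(1) by (auto simp: is_circle_def)
  define V where "V = (\<lambda>a. a - x) ` A"
  have xA: "x \<in> A" and x1: "x \<bullet> x = 1" using assms(2) A(3) by (auto simp: dot_square_norm)
  have V: "subspace V" using affine_diffs_subspace_subtract[OF A(1) xA] by (simp add: V_def)
  have "V = (+) (- x) ` A" by (auto simp: V_def)
  then have "dim V = 2"
    using aff_dim_eq_dim[of x A] A(2) hull_subset[of A affine] xA by auto
  then obtain B where B: "pairwise orthogonal B" "\<And>x. x \<in> B \<Longrightarrow> norm x = 1" "card B = 2" "span B = V"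
    using orthonormal_basis_subspace[OF V] by metis
  then obtain a b where ab: "B = {a, b}" "a \<noteq> b" by (auto simp: card_2_iff)
  have n: "a \<bullet> a = 1" "b \<bullet> b = 1" "a \<bullet> b = 0" "b \<bullet> a = 0"
    using B ab by (auto simp: dot_square_norm pairwise_def orthogonal_def)
  have Viff: "v \<in> V \<longleftrightarrow> (\<exists>s t. v = s *\<^sub>R a + t *\<^sub>R b)" for v
    unfolding B(4)[symmetric] ab(1) span_insert span_singleton
    by (auto simp: algebra_simps)
  have Ciff: "v \<in> C \<longleftrightarrow> norm v = 1 \<and> v - x \<in> V" for v
    using A(3) by (force simp: V_def)
  define r where "r = sqrt ((x \<bullet> a)\<^sup>2 + (x \<bullet> b)\<^sup>2)"
  have r2: "r * r = (x \<bullet> a) * (x \<bullet> a) + (x \<bullet> b) * (x \<bullet> b)"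
    by (simp add: r_def power2_eq_square)
  \<comment> \<open>If the projection of \<open>x\<close> vanished, the plane would be tangent to
    the sphere at \<open>x\<close> and meet it only there, against the second point
    \<open>y\<close>.\<close>
  have r: "r > 0"
  proof (rule ccontr)
    assume "\<not> r > 0"
    then have "(x \<bullet> a)\<^sup>2 + (x \<bullet> b)\<^sup>2 \<le> 0" by (simp add: r_def)
    then have z: "x \<bullet> a = 0" "x \<bullet> b = 0" by (simp_all add: sum_power2_le_zero_iff)
    obtain s t where st: "y - x = s *\<^sub>R a + t *\<^sub>R b" using y Ciff Viff by blast
    then have yy: "y = x + s *\<^sub>R a + t *\<^sub>R b" by (simp add: algebra_simps)
    have "y \<bullet> y = 1" using y Ciff by (simp add: dot_square_norm)
    then have "s\<^sup>2 + t\<^sup>2 = 0"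
      using n z x1 by (simp add: yy inner_simps inner_commute power2_eq_square)
    then have "s = 0 \<and> t = 0" by (simp add: sum_power2_eq_zero_iff)
    then show False using yy y(2) by simp
  qed
  define N where "N = ((x \<bullet> a) *\<^sub>R a + (x \<bullet> b) *\<^sub>R b) /\<^sub>R r"
  define T where "T = ((x \<bullet> b) *\<^sub>R a - (x \<bullet> a) *\<^sub>R b) /\<^sub>R r"
  have rT: "r *\<^sub>R T = (x \<bullet> b) *\<^sub>R a - (x \<bullet> a) *\<^sub>R b"
    and rN: "r *\<^sub>R N = (x \<bullet> a) *\<^sub>R a + (x \<bullet> b) *\<^sub>R b"
    using r by (simp_all add: T_def N_def)
  have unit: "(v /\<^sub>R r) \<bullet> (v /\<^sub>R r) = 1" if "v \<bullet> v = r * r" for v :: "complex \<times> complex"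
    unfolding inner_scaleR_left inner_scaleR_right that using r by (simp add: field_simps)
  have NN: "N \<bullet> N = 1"
    unfolding N_def using n by (intro unit) (simp add: r2 inner_simps)
  have TT: "T \<bullet> T = 1"
    unfolding T_def using n by (intro unit) (simp add: r2 inner_simps)
  have TN: "T \<bullet> N = 0" "N \<bullet> T = 0" using n by (simp_all add: T_def N_def inner_simps)
  have xT: "x \<bullet> T = 0" "T \<bullet> x = 0" by (simp_all add: T_def inner_simps inner_commute)
  have xN: "x \<bullet> N = r"
    using r r2 by (simp add: N_def inner_simps field_simps)
  have NV: "N \<in> V" "T \<in> V"
    using V B(4) ab(1) unfolding N_def T_def
    by (auto intro!: subspace_scale subspace_add subspace_diff simp: span_base)
  have span: "\<exists>s t. v = s *\<^sub>R T + t *\<^sub>R N" if v: "v \<in> V" for v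
  proof -
    obtain s t where st: "v = s *\<^sub>R a + t *\<^sub>R b" using v Viff by blast
    have a: "a = ((x \<bullet> b) / r) *\<^sub>R T + ((x \<bullet> a) / r) *\<^sub>R N"
    proof -
      have "r *\<^sub>R (r *\<^sub>R a) = (r * r) *\<^sub>R a" by simp
      also have "\<dots> = (x \<bullet> b) *\<^sub>R (r *\<^sub>R T) + (x \<bullet> a) *\<^sub>R (r *\<^sub>R N)"
        unfolding rT rN r2 by (simp add: algebra_simps)
      also have "\<dots> = r *\<^sub>R (r *\<^sub>R (((x \<bullet> b) / r) *\<^sub>R T + ((x \<bullet> a) / r) *\<^sub>R N))"
        using r by (simp add: algebra_simps)
      finally show ?thesis using r by simp
    qed
    have b: "b = (- (x \<bullet> a) / r) *\<^sub>R T + ((x \<bullet> b) / r) *\<^sub>R N"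
    proof -
      have "r *\<^sub>R (r *\<^sub>R b) = (r * r) *\<^sub>R b" by simp
      also have "\<dots> = (- (x \<bullet> a)) *\<^sub>R (r *\<^sub>R T) + (x \<bullet> b) *\<^sub>R (r *\<^sub>R N)"
        unfolding rT rN r2 by (simp add: algebra_simps)
      also have "\<dots> = r *\<^sub>R (r *\<^sub>R ((- (x \<bullet> a) / r) *\<^sub>R T + ((x \<bullet> b) / r) *\<^sub>R N))"
        using r by (simp add: algebra_simps)
      finally show ?thesis using r by simp
    qed
    have "v = (s * ((x \<bullet> b) / r) - t * ((x \<bullet> a) / r)) *\<^sub>R T
        + (s * ((x \<bullet> a) / r) + t * ((x \<bullet> b) / r)) *\<^sub>R N"
      unfolding st by (subst a, subst b) (simp add: algebra_simps)
    then show ?thesis by blast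
  qed
  let ?\<gamma> = "\<lambda>\<theta>. x + (r * sin \<theta>) *\<^sub>R T + (r * (cos \<theta> - 1)) *\<^sub>R N"
  have norm1: "norm (x + s *\<^sub>R T + t *\<^sub>R N) = 1 \<longleftrightarrow> s\<^sup>2 + (t + r)\<^sup>2 = r\<^sup>2" for s t
  proof -
    have "(x + s *\<^sub>R T + t *\<^sub>R N) \<bullet> (x + s *\<^sub>R T + t *\<^sub>R N) = 1 + (s\<^sup>2 + (t + r)\<^sup>2 - r\<^sup>2)"
      using NN TT TN xT xN x1
      by (simp add: inner_add_left inner_add_right inner_commute[of N x] power2_eq_square algebra_simps)
    then show ?thesis by (simp add: norm_eq_1)
  qed
  have "C = range ?\<gamma>"
  proof (intro subset_antisym subsetI)
    fix v assume v: "v \<in> C"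
    then obtain s t where st: "v - x = s *\<^sub>R T + t *\<^sub>R N" using Ciff span by blast
    then have vv: "v = x + s *\<^sub>R T + t *\<^sub>R N" by (simp add: algebra_simps)
    then have "s\<^sup>2 + (t + r)\<^sup>2 = r\<^sup>2" using v Ciff norm1 by blast
    then have "((t + r) / r)\<^sup>2 + (s / r)\<^sup>2 = 1"
      using r by (simp add: power_divide add_divide_distrib[symmetric] add.commute)
    then obtain \<theta> where "(t + r) / r = cos \<theta>" "s / r = sin \<theta>"
      using sincos_total_2pi by metis
    then have "s = r * sin \<theta>" "t = r * (cos \<theta> - 1)"
      using r by (simp_all add: field_simps)
    then show "v \<in> range ?\<gamma>" using vv by auto
  next
    fix v assume "v \<in> range ?\<gamma>"
    then obtain \<theta> where v: "v = ?\<gamma> \<theta>" by blast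
    have "(r * sin \<theta>)\<^sup>2 + (r * (cos \<theta> - 1) + r)\<^sup>2 = r\<^sup>2 * ((sin \<theta>)\<^sup>2 + (cos \<theta>)\<^sup>2)"
      by algebra
    then have "norm v = 1" unfolding v norm1 by simp
    moreover have "v - x \<in> V"
      unfolding v using V NV by (simp add: subspace_add subspace_scale)
    ultimately show "v \<in> C" using Ciff by blast
  qed
  then show ?thesis
    using that[of T N r] NN TT TN xT xN r by (simp add: norm_eq_1)
qed

section \<open>Complex affine functions and the Minkowski form\<close>

definition affine_fn :: "('a::real_vector \<Rightarrow> 'b::real_vector) \<Rightarrow> bool" where
  "affine_fn f \<longleftrightarrow> linear (\<lambda>p. f p - f 0)"

lemma affine_fn_diff: "affine_fn f \<Longrightarrow> f (x + v) - f x = f v - f 0"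
  unfolding affine_fn_def by (drule linear_add[of _ x v]) (simp add: algebra_simps)

lemma affine_fn_components:
  fixes f :: "'a::euclidean_space \<Rightarrow> 'b::real_vector"
  assumes "affine_fn f"
  shows "f p = f 0 + (\<Sum>b\<in>Basis. (p \<bullet> b) *\<^sub>R (f b - f 0))"
  using euclidean_components_linear[OF assms[unfolded affine_fn_def], of p]
  by (simp add: algebra_simps)

text \<open>Dimension count: a further kernel vector would give a basis of four vectors, three of
  them in the kernel, and the real multiples of the one remaining value cannot fill the complex
  plane.\<close>

lemma kernel_span_pair:
  fixes \<alpha> :: "complex \<times> complex \<Rightarrow> complex"
  assumes "linear \<alpha>" "surj \<alpha>" "\<alpha> T = 0" "\<alpha> N = 0"
    and "norm T = 1" "norm N = 1" "T \<bullet> N = 0" and "\<alpha> v = 0"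
  obtains s t where "v = s *\<^sub>R T + t *\<^sub>R N"
proof -
  have "T \<noteq> N" using assms by (auto simp: norm_eq_1)
  have TN: "independent {T, N}"
    using assms by (intro pairwise_orthogonal_independent)
      (auto simp: pairwise_def orthogonal_def inner_commute)
  have "v \<in> span {T, N}"
  proof (rule ccontr)
    assume v: "v \<notin> span {T, N}"
    then have ind: "independent {v, T, N}" using TN independent_insertI by blast
    obtain B where B: "{v, T, N} \<subseteq> B" "independent B" "UNIV \<subseteq> span B"
      by (rule maximal_independent_subset_extend[OF subset_UNIV ind])
    then have span: "span B = UNIV" by blast
    have "v \<noteq> T" "v \<noteq> N" using v by (auto simp: span_base)
    then have "card {v, T, N} = 3" using \<open>T \<noteq> N\<close> by simp
    moreover have "card B = 4"
      using B(2) span dim_eq_card[of B UNIV] by simp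
    ultimately have "card (B - {v, T, N}) = 1"
      using B(1) by (simp add: card_Diff_subset)
    then obtain w where w: "B - {v, T, N} = {w}" by (rule card_1_singletonE)
    have "\<alpha> ` B \<subseteq> {0, \<alpha> w}"
    proof
      fix y assume "y \<in> \<alpha> ` B"
      then obtain z where z: "z \<in> B" "y = \<alpha> z" by blast
      then have "z \<in> {v, T, N} \<or> z = w" using w by blast
      then show "y \<in> {0, \<alpha> w}" using z assms(3,4,8) by auto
    qed
    then have "span (\<alpha> ` B) \<subseteq> span {0, \<alpha> w}" by (rule span_mono)
    moreover have "span (\<alpha> ` B) = UNIV"
      using linear_span_image[OF assms(1), of B] span assms(2) by simp
    ultimately have "UNIV \<subseteq> span {\<alpha> w}" by simp
    then have "dim (UNIV :: complex set) \<le> card {\<alpha> w}" by (intro dim_le_card) simp_all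
    then show False by simp
  qed
  then obtain k l where "v - k *\<^sub>R T = l *\<^sub>R N"
    by (auto simp: span_insert span_singleton)
  then show ?thesis using that[of k l] by (simp add: algebra_simps)
qed

text \<open>\<open>\<delta>\<close> factors through \<open>\<alpha>\<close> as a real linear map of
  the plane, and such a map has the form \<open>a * \<zeta> + b * cnj \<zeta>\<close>, with its two
  Wirtinger derivatives as coefficients.\<close>

lemma real_linear_factor:
  fixes \<alpha> \<delta> :: "complex \<times> complex \<Rightarrow> complex"
  assumes "linear \<alpha>" "surj \<alpha>" "linear \<delta>" "\<And>v. \<alpha> v = 0 \<Longrightarrow> \<delta> v = 0"
  obtains a b where "\<And>v. \<delta> v = a * \<alpha> v + b * cnj (\<alpha> v)"
proof -
  obtain u1 u2 where u: "\<alpha> u1 = 1" "\<alpha> u2 = \<i>" using assms(2) by (metis surjD)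
  have *: "\<delta> v = Re (\<alpha> v) *\<^sub>R \<delta> u1 + Im (\<alpha> v) *\<^sub>R \<delta> u2" for v
  proof -
    have "\<alpha> (v - Re (\<alpha> v) *\<^sub>R u1 - Im (\<alpha> v) *\<^sub>R u2) = 0"
      by (simp add: linear_diff[OF assms(1)] linear_cmul[OF assms(1)] u complex_eq_iff)
    then have "\<delta> (v - Re (\<alpha> v) *\<^sub>R u1 - Im (\<alpha> v) *\<^sub>R u2) = 0" by (rule assms(4))
    then show ?thesis
      by (simp add: linear_diff[OF assms(3)] linear_cmul[OF assms(3)] diff_eq_eq add.commute)
  qed
  have "\<delta> v = (\<delta> u1 - \<i> * \<delta> u2) / 2 * \<alpha> v + (\<delta> u1 + \<i> * \<delta> u2) / 2 * cnj (\<alpha> v)" for v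
    unfolding *[of v] by (simp add: complex_eq_iff field_simps)
  then show ?thesis using that by blast
qed

text \<open>The affine function \<open>p \<mapsto> v \<bullet> p - m\<close> stands for the vector \<open>(v, m)\<close>, and \<open>minkowski\<close> is the
  complex bilinear form \<open>v \<bullet> v' - m m'\<close>.\<close>

definition minkowski :: "('a::euclidean_space \<Rightarrow> complex) \<Rightarrow> ('a \<Rightarrow> complex) \<Rightarrow> complex" where
  "minkowski f g = (\<Sum>b\<in>Basis. (f b - f 0) * (g b - g 0)) - f 0 * g 0"

lemma minkowski_commute: "minkowski f g = minkowski g f"
  by (simp add: minkowski_def mult.commute)

lemma minkowski_add_left: "minkowski (\<lambda>p. f p + g p) h = minkowski f h + minkowski g h"
  by (simp add: minkowski_def algebra_simps sum.distrib sum_subtractf)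

lemma minkowski_scale_left: "minkowski (\<lambda>p. c * f p) h = c * minkowski f h"
  by (simp add: minkowski_def algebra_simps sum_distrib_left sum_subtractf sum.distrib)

lemma minkowski_add_right: "minkowski h (\<lambda>p. f p + g p) = minkowski h f + minkowski h g"
  by (simp add: minkowski_commute[of h] minkowski_add_left)

lemma minkowski_scale_right: "minkowski h (\<lambda>p. c * f p) = c * minkowski h f"
  by (simp add: minkowski_commute[of h] minkowski_scale_left)

lemma minkowski_cnj: "minkowski (\<lambda>p. cnj (f p)) (\<lambda>p. cnj (g p)) = cnj (minkowski f g)"
  by (simp add: minkowski_def)

lemma connected_subset_disjoint_closed:
  fixes A B :: "real set"
  assumes "closed A" "closed B" "A \<union> B = UNIV" "A \<inter> B = {}" "a \<in> A"
  shows "A = UNIV"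
  using connected_closed[of "UNIV :: real set"] assms by (metis Int_UNIV_right Un_upper1 connected_UNIV
      inf.commute inf_top.right_neutral empty_iff sup_bot.right_neutral subset_UNIV)

lemma affine_fn_cnj: "affine_fn f \<Longrightarrow> affine_fn (\<lambda>p. cnj (f p))"
  unfolding affine_fn_def
  by (drule linear_compose[OF _ bounded_linear.linear[OF bounded_linear_cnj]]) (simp add: o_def)

lemma radial_derivative_zero:
  assumes D: "(f has_derivative D) (at x)" and f: "\<And>t::real. t > 0 \<Longrightarrow> f (t *\<^sub>R x) = f x"
  shows "D x = 0"
proof -
  have *: "((\<lambda>t::real. t *\<^sub>R x) has_derivative (\<lambda>h. h *\<^sub>R x)) (at 1)"
    by (auto intro!: derivative_eq_intros)
  have "((\<lambda>t. f (t *\<^sub>R x)) has_derivative (\<lambda>h. D (h *\<^sub>R x))) (at 1)"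
    using has_derivative_compose[OF *] D by simp
  moreover have "((\<lambda>t. f (t *\<^sub>R x)) has_derivative (\<lambda>h. 0)) (at 1)"
    by (rule has_derivative_transform_within_open[of "\<lambda>_. f x" _ _ _ "{0<..}"])
      (use f in auto)
  ultimately have "(\<lambda>h. D (h *\<^sub>R x)) = (\<lambda>h::real. 0)"
    by (rule has_derivative_unique)
  from fun_cong[OF this, of 1] show ?thesis by simp
qed

section \<open>Complex functions with null gradient and circular fibres\<close>

text \<open>The extension from the sphere to a cone is constant on rays, so its derivative vanishes in
  the radial direction and ordinary derivatives can be used.\<close>

locale circle_map =
  fixes W :: "complex \<times> complex \<Rightarrow> complex" and U :: "(complex \<times> complex) set"
  assumes open_U: "open U"
    and scale: "\<And>x t. x \<in> U \<Longrightarrow> t > 0 \<Longrightarrow> t *\<^sub>R x \<in> U \<and> W (t *\<^sub>R x) = W x"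
    and smooth: "\<And>k. Ck_on k U W"
    and surj: "\<And>x. x \<in> U \<Longrightarrow> norm x = 1 \<Longrightarrow> surj (frechet_derivative W (at x))"
    and null: "\<And>x. x \<in> U \<Longrightarrow> norm x = 1 \<Longrightarrow> (\<Sum>b\<in>Basis. (frechet_derivative W (at x) b)\<^sup>2) = 0"
    and circle: "\<And>x. x \<in> U \<Longrightarrow> norm x = 1 \<Longrightarrow> is_circle {p \<in> S3. p \<in> U \<and> W p = W x}"
begin

definition "DW x = frechet_derivative W (at x)"

definition "fib x = {p \<in> S3. p \<in> U \<and> W p = W x}"

lemma fib_self: "x \<in> U \<Longrightarrow> norm x = 1 \<Longrightarrow> x \<in> fib x"
  by (simp add: fib_def)

lemma fib_eq: "y \<in> fib x \<Longrightarrow> fib y = fib x" "y \<in> fib x \<Longrightarrow> y \<in> U" "y \<in> fib x \<Longrightarrow> norm y = 1"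
    "y \<in> fib x \<Longrightarrow> W y = W x"
  by (auto simp: fib_def)

lemma DW_deriv: "x \<in> U \<Longrightarrow> (W has_derivative DW x) (at x)"
  unfolding DW_def by (rule Ck_on_SucE(1)[OF smooth])

lemma DW_linear: "x \<in> U \<Longrightarrow> linear (DW x)"
  using DW_deriv has_derivative_linear by blast

lemma DW_comp: "x \<in> U \<Longrightarrow> DW x v = (\<Sum>b\<in>Basis. (v \<bullet> b) *\<^sub>R DW x b)"
  by (rule euclidean_components_linear[OF DW_linear])

lemma DW_Ck: "Ck_on k U (\<lambda>x. DW x v)"
  unfolding DW_def by (rule Ck_on_SucE(2)[OF smooth])

lemma DW_cont: "continuous_on U (\<lambda>x. DW x v)"
  using DW_Ck[of 0] by simp

lemma DW_differentiable: "x \<in> U \<Longrightarrow> (\<lambda>x. DW x v) differentiable (at x)"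
  using DW_Ck[of "Suc 0" v] by simp

lemma DW_radial: "x \<in> U \<Longrightarrow> DW x x = 0"
  using radial_derivative_zero[OF DW_deriv] scale by blast

definition frame where
  "frame x T N r \<longleftrightarrow> norm T = 1 \<and> norm N = 1 \<and> T \<bullet> N = 0 \<and> x \<bullet> T = 0 \<and> x \<bullet> N = r \<and> r > 0 \<and>
     fib x = range (\<lambda>\<theta>. x + (r * sin \<theta>) *\<^sub>R T + (r * (cos \<theta> - 1)) *\<^sub>R N)"

lemma frame_exists:
  assumes "x \<in> U" "norm x = 1"
  obtains T N r where "frame x T N r"
proof -
  have "x \<in> {p \<in> S3. p \<in> U \<and> W p = W x}" using assms by simp
  then show ?thesis
    by (rule circle_param[OF circle[OF assms]])
      (rule that, unfold frame_def fib_def, intro conjI; assumption)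
qed

lemma frame_points:
  assumes "frame x T N r"
  shows "x + (r * sin \<theta>) *\<^sub>R T + (r * (cos \<theta> - 1)) *\<^sub>R N \<in> fib x"
    and "x - (2 * r) *\<^sub>R N \<in> fib x" and "x + r *\<^sub>R T - r *\<^sub>R N \<in> fib x"
proof -
  show *: "x + (r * sin \<theta>) *\<^sub>R T + (r * (cos \<theta> - 1)) *\<^sub>R N \<in> fib x" for \<theta>
    using assms by (auto simp: frame_def)
  show "x - (2 * r) *\<^sub>R N \<in> fib x" using *[of pi] by (simp add: mult.commute)
  show "x + r *\<^sub>R T - r *\<^sub>R N \<in> fib x" using *[of "pi / 2"] by simp
qed

lemma frame_tangent:
  assumes "x \<in> U" "frame x T N r"
  shows "DW x T = 0"
proof -
  let ?\<gamma> = "\<lambda>\<theta>::real. x + (r * sin \<theta>) *\<^sub>R T + (r * (cos \<theta> - 1)) *\<^sub>R N"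
  have *: "(?\<gamma> has_derivative (\<lambda>h. h *\<^sub>R (r *\<^sub>R T))) (at 0)"
    by (auto intro!: derivative_eq_intros)
  have "((\<lambda>\<theta>. W (?\<gamma> \<theta>)) has_derivative (\<lambda>h. DW x (h *\<^sub>R (r *\<^sub>R T)))) (at 0)"
    using has_derivative_compose[OF *] DW_deriv[OF assms(1)] by simp
  moreover have "(\<lambda>\<theta>. W (?\<gamma> \<theta>)) = (\<lambda>\<theta>. W x)"
    using frame_points(1)[OF assms(2)] by (auto simp: fib_def)
  ultimately have "((\<lambda>\<theta>. W x) has_derivative (\<lambda>h. DW x (h *\<^sub>R (r *\<^sub>R T)))) (at (0::real))"
    by simp
  then have "(\<lambda>h. DW x (h *\<^sub>R (r *\<^sub>R T))) = (\<lambda>h::real. 0)"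
    using has_derivative_const has_derivative_unique by blast
  from fun_cong[OF this, of "1 / r"] assms(2) show ?thesis by (simp add: frame_def)
qed

text \<open>\<open>mu x\<close> is determined by any point of the fibre other than \<open>x\<close>; \<open>psi x\<close> is the affine function that
  cuts out the fibre of \<open>x\<close> on the sphere, and \<open>psi_lin x\<close> is its linear part.\<close>

definition mu where "mu x = (SOME m. \<forall>y\<in>fib x. DW x y = m * of_real (1 - x \<bullet> y))"

definition psi where "psi x p = DW x p - mu x * of_real (1 - x \<bullet> p)"

text \<open>The affine functions that vanish at \<open>x\<close> and have the tangential derivative
  \<open>DW x\<close> there are \<open>DW x p - m * (1 - x \<bullet> p)\<close>. Along the circle
  both terms are multiples of \<open>cos \<theta> - 1\<close>, so a single \<open>m\<close> makes
  the function vanish on the whole fibre.\<close>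

lemma mu_frame:
  assumes x: "x \<in> U" "norm x = 1" and f: "frame x T N r"
  shows "mu x = - DW x N / of_real r"
proof -
  note L = DW_linear[OF x(1)] and f' = f[unfolded frame_def]
  have r: "r > 0" and xN: "x \<bullet> N = r" and xT: "x \<bullet> T = 0" using f' by blast+
  have xx: "x \<bullet> x = 1" using x by (simp add: norm_eq_1)
  have "\<forall>y\<in>fib x. DW x y = (- DW x N / of_real r) * of_real (1 - x \<bullet> y)"
  proof
    fix y assume "y \<in> fib x"
    then obtain \<theta> where y: "y = x + (r * sin \<theta>) *\<^sub>R T + (r * (cos \<theta> - 1)) *\<^sub>R N"
      using f' by blast
    have "DW x y = of_real (r * (cos \<theta> - 1)) * DW x N"
      using DW_radial[OF x(1)] frame_tangent[OF x(1) f]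
      by (simp add: y linear_add[OF L] linear_cmul[OF L] scaleR_conv_of_real)
    moreover have "1 - x \<bullet> y = - (r * (r * (cos \<theta> - 1)))"
      using xN xT xx by (simp add: y inner_add_right algebra_simps)
    ultimately show "DW x y = (- DW x N / of_real r) * of_real (1 - x \<bullet> y)"
      using r by simp
  qed
  then have "\<forall>y\<in>fib x. DW x y = mu x * of_real (1 - x \<bullet> y)"
    unfolding mu_def by (rule someI)
  \<comment> \<open>The point opposite to \<open>x\<close> on the circle determines
    \<open>mu x\<close>, because \<open>1 - x \<bullet> y\<close> is \<open>2 * r * r\<close>
    there.\<close>
  then have e1: "DW x (x - (2 * r) *\<^sub>R N) = mu x * of_real (1 - x \<bullet> (x - (2 * r) *\<^sub>R N))"
    using frame_points(2)[OF f] by blast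
  have e2: "DW x (x - (2 * r) *\<^sub>R N) = - (of_real (2 * r)) * DW x N"
    by (simp add: linear_diff[OF L] linear_cmul[OF L] DW_radial[OF x(1)] scaleR_conv_of_real)
  have e3: "1 - x \<bullet> (x - (2 * r) *\<^sub>R N) = 2 * r * r"
    using xx xN by (simp add: inner_diff_right)
  have e: "- (of_real (2 * r)) * DW x N = mu x * of_real (2 * r * r)"
    using e1 unfolding e2 e3 .
  have "of_real (2 * r) * (mu x * of_real r) = mu x * of_real (2 * r * r)"
    by (simp only: of_real_mult mult_ac)
  also have "\<dots> = of_real (2 * r) * (- DW x N)"
    unfolding e[symmetric] by (simp only: mult_minus_left mult_minus_right)
  finally have "of_real (2 * r) * (mu x * of_real r) = of_real (2 * r) * (- DW x N)" .
  moreover have "complex_of_real (2 * r) \<noteq> 0" "complex_of_real r \<noteq> 0" using r by auto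
  ultimately have "mu x * of_real r = - DW x N" by (meson mult_left_cancel)
  then show ?thesis using \<open>complex_of_real r \<noteq> 0\<close> by (metis nonzero_eq_divide_eq)
qed

definition psi_lin where "psi_lin x v = psi x v - psi x 0"

lemma psi_lin_eq: "x \<in> U \<Longrightarrow> psi_lin x v = DW x v + mu x * of_real (x \<bullet> v)"
  by (simp add: psi_lin_def psi_def linear_0[OF DW_linear] algebra_simps)

lemma psi_0: "x \<in> U \<Longrightarrow> psi x 0 = - mu x"
  by (simp add: psi_def linear_0[OF DW_linear])

lemma psi_lin_linear:
  assumes x: "x \<in> U" shows "linear (psi_lin x)"
  using DW_linear[OF x] unfolding psi_lin_eq[OF x, abs_def]
  by (intro linearI) (simp_all add: linear_add linear_cmul inner_add_right algebra_simps
      scaleR_conv_of_real)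

lemma psi_affine: "x \<in> U \<Longrightarrow> affine_fn (psi x)"
  using psi_lin_linear by (simp add: affine_fn_def psi_lin_def[abs_def])

text \<open>On vectors orthogonal to \<open>x\<close> the map agrees with \<open>DW x\<close>, and
  removing the radial component of a vector does not change its value under
  \<open>DW x\<close>.\<close>

lemma psi_lin_surj:
  assumes x: "x \<in> U" "norm x = 1" shows "surj (psi_lin x)"
proof (rule surjI)
  fix \<zeta>
  define u where "u = inv (DW x) \<zeta>"
  have u: "DW x u = \<zeta>" using surj[OF x] by (simp add: u_def DW_def surj_f_inv_f)
  show "psi_lin x (inv (DW x) \<zeta> - (x \<bullet> inv (DW x) \<zeta>) *\<^sub>R x) = \<zeta>"
    unfolding u_def[symmetric] using u x DW_radial[OF x(1)]
    by (simp add: psi_lin_eq linear_diff[OF DW_linear] linear_cmul[OF DW_linear] inner_diff_right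
        dot_square_norm)
qed

lemma psi_lin_frame:
  assumes x: "x \<in> U" "norm x = 1" and f: "frame x T N r"
  shows "psi_lin x T = 0" "psi_lin x N = 0"
  using frame_tangent[OF x(1) f] mu_frame[OF x f] f by (auto simp: psi_lin_eq x frame_def)

lemma psi_self: "x \<in> U \<Longrightarrow> norm x = 1 \<Longrightarrow> psi x x = 0"
  by (simp add: psi_def DW_radial dot_square_norm)

lemma psi_lin_diff: "x \<in> U \<Longrightarrow> psi x (y + v) = psi x y + psi_lin x v"
  using affine_fn_diff[OF psi_affine, of x y v] by (simp add: psi_lin_def algebra_simps)

text \<open>The kernel of \<open>psi_lin x\<close> is spanned by \<open>T\<close> and
  \<open>N\<close>, so \<open>psi x\<close> vanishes exactly on the affine plane of the
  circle.\<close>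

lemma psi_zero_iff:
  assumes x: "x \<in> U" "norm x = 1" and y: "norm y = 1"
  shows "psi x y = 0 \<longleftrightarrow> y \<in> fib x"
proof -
  obtain T N r where f: "frame x T N r" by (rule frame_exists[OF x])
  note f' = f[unfolded frame_def] and L = psi_lin_linear[OF x(1)] and a = psi_lin_frame[OF x f]
  have psiy: "psi x y = psi_lin x (y - x)" using psi_lin_diff[OF x(1), of x "y - x"] psi_self[OF x] by simp
  show ?thesis
  proof
    assume "y \<in> fib x"
    then obtain \<theta> where "y = x + (r * sin \<theta>) *\<^sub>R T + (r * (cos \<theta> - 1)) *\<^sub>R N"
      using f' by blast
    then have "y - x = (r * sin \<theta>) *\<^sub>R T + (r * (cos \<theta> - 1)) *\<^sub>R N" by simp
    then show "psi x y = 0"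
      unfolding psiy by (simp only: linear_add[OF L] linear_cmul[OF L] a) simp
  next
    assume "psi x y = 0"
    then have "psi_lin x (y - x) = 0" using psiy by simp
    then obtain s t where st: "y - x = s *\<^sub>R T + t *\<^sub>R N"
      by (rule kernel_span_pair[OF L psi_lin_surj[OF x] a, rotated 3]) (use f' in blast)+
    then have yy: "y = x + s *\<^sub>R T + t *\<^sub>R N" by (simp add: algebra_simps)
    have r: "r > 0" and g: "x \<bullet> N = r" "x \<bullet> T = 0" "T \<bullet> N = 0" "T \<bullet> T = 1" "N \<bullet> N = 1" "x \<bullet> x = 1"
      using f' x(2) by (simp_all add: norm_eq_1)
    have "1 = y \<bullet> y" using y by (simp add: norm_eq_1)
    also have "\<dots> = 1 + (s\<^sup>2 + (t + r)\<^sup>2 - r\<^sup>2)"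
      unfolding yy using g
      by (simp add: inner_add_left inner_add_right inner_commute[of N x] inner_commute[of T x]
          inner_commute[of N T] power2_eq_square algebra_simps)
    finally have "((t + r) / r)\<^sup>2 + (s / r)\<^sup>2 = 1"
      using r by (simp add: power_divide add_divide_distrib[symmetric] add.commute)
    then obtain \<theta> where "(t + r) / r = cos \<theta>" "s / r = sin \<theta>"
      using sincos_total_2pi by metis
    then have "s = r * sin \<theta>" "t = r * (cos \<theta> - 1)"
      using r by (simp_all add: field_simps)
    then show "y \<in> fib x" using frame_points(1)[OF f, of \<theta>] yy by simp
  qed
qed

text \<open>The linear part of \<open>f\<close> vanishes on the directions of the plane of the
  circle, which form the kernel of \<open>psi_lin x\<close>; it therefore factors through
  \<open>psi_lin x\<close> as a real linear map of the complex plane.\<close>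

lemma psi_hull:
  assumes x: "x \<in> U" "norm x = 1" and f: "affine_fn f" "\<And>y. y \<in> fib x \<Longrightarrow> f y = 0"
  obtains a b where "\<And>p. f p = a * psi x p + b * cnj (psi x p)"
proof -
  obtain T N r where fr: "frame x T N r" by (rule frame_exists[OF x])
  define \<delta> where "\<delta> = (\<lambda>v. f v - f 0)"
  have L: "linear \<delta>" using f(1) by (simp add: affine_fn_def \<delta>_def)
  have fd: "f (y + v) = f y + \<delta> v" for y v
    using affine_fn_diff[OF f(1), of y v] by (simp add: \<delta>_def algebra_simps)
  have r: "r > 0" using fr by (simp add: frame_def)
  have fx: "f x = 0" using f(2) fib_self x by blast
  \<comment> \<open>The opposite point and then the quarter point of the circle show that the linear
    part of \<open>f\<close> kills \<open>N\<close> and \<open>T\<close>.\<close>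
  have "f (x + (- (2 * r)) *\<^sub>R N) = 0" using f(2) frame_points(2)[OF fr] by simp
  then have "\<delta> N = 0" using r unfolding fd fx linear_cmul[OF L] by simp
  have "f (x + (r *\<^sub>R T + (- r) *\<^sub>R N)) = 0"
    using f(2) frame_points(3)[OF fr] by (simp add: algebra_simps)
  then have "\<delta> T = 0"
    using r \<open>\<delta> N = 0\<close> unfolding fd fx linear_cmul[OF L] linear_add[OF L] by simp
  have "\<delta> v = 0" if v: "psi_lin x v = 0" for v
  proof -
    obtain s t where "v = s *\<^sub>R T + t *\<^sub>R N"
      by (rule kernel_span_pair[OF psi_lin_linear[OF x(1)] psi_lin_surj[OF x] psi_lin_frame[OF x fr] _ _ _ v])
        (use fr in \<open>unfold frame_def, blast\<close>)+
    then show ?thesis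
      using \<open>\<delta> N = 0\<close> \<open>\<delta> T = 0\<close> by (simp add: linear_add[OF L] linear_cmul[OF L])
  qed
  then obtain a b where ab: "\<And>v. \<delta> v = a * psi_lin x v + b * cnj (psi_lin x v)"
    using real_linear_factor[OF psi_lin_linear[OF x(1)] psi_lin_surj[OF x] L] by blast
  have "f p = a * psi x p + b * cnj (psi x p)" for p
    using fd[of x "p - x"] fx ab[of "p - x"] psi_lin_diff[OF x(1), of x "p - x"] psi_self[OF x] by simp
  then show ?thesis using that by blast
qed

text \<open>The vector of \<open>psi x\<close> is the gradient of \<open>W\<close> plus
  \<open>mu x\<close> times the null vector \<open>(x, 1)\<close> of the point \<open>x\<close>, and
  pairing with \<open>(x, 1)\<close> is evaluation at \<open>x\<close>.\<close>

lemma minkowski_psi_left: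
  assumes x: "x \<in> U" "norm x = 1" and f: "affine_fn f"
  shows "minkowski (psi x) f = (\<Sum>b\<in>Basis. DW x b * (f b - f 0)) + mu x * f x"
proof -
  have A: "(\<Sum>b\<in>Basis. of_real (x \<bullet> b) * (f b - f 0)) = f x - f 0"
    using affine_fn_components[OF f, of x] by (simp add: scaleR_conv_of_real algebra_simps)
  have B: "minkowski (psi x) f = (\<Sum>b\<in>Basis. DW x b * (f b - f 0))
      + mu x * (\<Sum>b\<in>Basis. of_real (x \<bullet> b) * (f b - f 0)) + mu x * f 0"
  proof -
    have "minkowski (psi x) f = (\<Sum>b\<in>Basis. psi_lin x b * (f b - f 0)) + mu x * f 0"
      by (simp only: minkowski_def psi_lin_def psi_0[OF x(1)]) simp
    also have "(\<Sum>b\<in>Basis. psi_lin x b * (f b - f 0)) = (\<Sum>b\<in>Basis. DW x b * (f b - f 0))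
        + mu x * (\<Sum>b\<in>Basis. of_real (x \<bullet> b) * (f b - f 0))"
      by (simp only: psi_lin_eq[OF x(1)] distrib_right sum.distrib sum_distrib_left mult.assoc)
    finally show ?thesis .
  qed
  show ?thesis unfolding B A by (simp add: right_diff_distrib)
qed

text \<open>Since \<open>psi x\<close> vanishes at \<open>x\<close> and the gradient of
  \<open>W\<close> is orthogonal to \<open>x\<close>, all terms with \<open>mu x\<close> drop out:
  both products are those of the gradient, which is null and nonzero.\<close>

lemma minkowski_psi:
  assumes x: "x \<in> U" "norm x = 1"
  shows "minkowski (psi x) (psi x) = 0"
    and "minkowski (psi x) (\<lambda>p. cnj (psi x p)) = of_real (\<Sum>b\<in>Basis. (norm (DW x b))\<^sup>2)"
    and "(\<Sum>b\<in>Basis. (norm (DW x b))\<^sup>2) > 0"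
proof -
  have c: "affine_fn (\<lambda>p. cnj (psi x p))" by (rule affine_fn_cnj[OF psi_affine[OF x(1)]])
  have rad: "(\<Sum>b\<in>Basis. DW x b * of_real (x \<bullet> b)) = 0"
    using DW_comp[OF x(1), of x] DW_radial[OF x(1)] by (simp add: scaleR_conv_of_real mult.commute)
  have "minkowski (psi x) (psi x) = (\<Sum>b\<in>Basis. (DW x b)\<^sup>2) + mu x * (\<Sum>b\<in>Basis. DW x b * of_real (x \<bullet> b))"
    unfolding minkowski_psi_left[OF x psi_affine[OF x(1)]] psi_self[OF x] psi_lin_def[symmetric] psi_lin_eq[OF x(1)]
    by (simp add: power2_eq_square distrib_left sum.distrib sum_distrib_left mult.left_commute)
  then show "minkowski (psi x) (psi x) = 0" using rad null[OF x] by (simp add: DW_def)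
  have "minkowski (psi x) (\<lambda>p. cnj (psi x p)) = (\<Sum>b\<in>Basis. DW x b * cnj (DW x b))
      + cnj (mu x) * (\<Sum>b\<in>Basis. DW x b * of_real (x \<bullet> b))"
    unfolding minkowski_psi_left[OF x c] psi_self[OF x] complex_cnj_diff[symmetric] psi_lin_def[symmetric] psi_lin_eq[OF x(1)]
    by (simp add: power2_eq_square distrib_left sum.distrib sum_distrib_left mult.left_commute)
  then show "minkowski (psi x) (\<lambda>p. cnj (psi x p)) = of_real (\<Sum>b\<in>Basis. (norm (DW x b))\<^sup>2)"
    using rad by (simp add: complex_norm_square flip: of_real_power)
  have "\<exists>b\<in>Basis. DW x b \<noteq> 0"
  proof (rule ccontr)
    assume "\<not> ?thesis"
    then have "DW x v = 0" for v using DW_comp[OF x(1), of v] by simp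
    moreover obtain v where "DW x v = 1" using surj[OF x] unfolding DW_def by (metis surjD)
    ultimately show False by simp
  qed
  then obtain b where b: "b \<in> Basis" "DW x b \<noteq> 0" by blast
  show "(\<Sum>b\<in>Basis. (norm (DW x b))\<^sup>2) > 0"
    by (rule sum_pos2[OF _ b(1)]) (use b in auto)
qed


text \<open>\<open>psi y\<close> contains the chosen number \<open>mu y\<close>, but pairing with a
  function that vanishes at \<open>y\<close> does not see it. What remains is visibly continuous in
  \<open>y\<close>, as the connectedness argument along the fibre requires.\<close>

lemma minkowski_psi_psi:
  assumes x: "x \<in> U" "norm x = 1" and y: "y \<in> fib x"
  shows "minkowski (psi y) (psi x) = (\<Sum>b\<in>Basis. DW y b * psi_lin x b)"
    and "minkowski (psi y) (\<lambda>p. cnj (psi x p)) = (\<Sum>b\<in>Basis. DW y b * cnj (psi_lin x b))"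
proof -
  note y' = fib_eq(2,3)[OF y]
  have z: "psi x y = 0" using psi_zero_iff[OF x y'(2)] y by blast
  show "minkowski (psi y) (psi x) = (\<Sum>b\<in>Basis. DW y b * psi_lin x b)"
    unfolding minkowski_psi_left[OF y' psi_affine[OF x(1)]] z psi_lin_def by simp
  show "minkowski (psi y) (\<lambda>p. cnj (psi x p)) = (\<Sum>b\<in>Basis. DW y b * cnj (psi_lin x b))"
    unfolding minkowski_psi_left[OF y' affine_fn_cnj[OF psi_affine[OF x(1)]]] z psi_lin_def by simp
qed

text \<open>By \<open>psi_hull\<close> and nullity, \<open>psi y\<close> is a multiple of \<open>psi x\<close> or of its conjugate. Both alternatives
  are closed conditions on \<open>y\<close>, so one of them holds along the whole (connected) circle.\<close>

lemma psi_fibre: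
  assumes x: "x \<in> U" "norm x = 1" and y: "y \<in> fib x"
  obtains k where "k \<noteq> 0" "\<And>p. psi y p = k * psi x p"
proof -
  \<comment> \<open>\<open>E\<close> and \<open>E'\<close> are the products of \<open>psi y\<close>
    with \<open>psi x\<close> and with its conjugate; up to the factor \<open>h\<close> they read
    off the conjugate coefficient \<open>b\<close> and the coefficient \<open>a\<close>.\<close>
  define E where "E = (\<lambda>y. \<Sum>b\<in>Basis. DW y b * psi_lin x b)"
  define E' where "E' = (\<lambda>y. \<Sum>b\<in>Basis. DW y b * cnj (psi_lin x b))"
  obtain h where h: "minkowski (psi x) (\<lambda>p. cnj (psi x p)) = h" "h \<noteq> 0" "minkowski (psi x) (psi x) = 0"
    using minkowski_psi[OF x] by (metis less_irrefl of_real_eq_0_iff)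
  have rel: "\<exists>a b. (\<forall>p. psi y p = a * psi x p + b * cnj (psi x p)) \<and>
      a * b = 0 \<and> (a \<noteq> 0 \<or> b \<noteq> 0) \<and> E y = b * h \<and> E' y = a * h" if y: "y \<in> fib x" for y
  proof -
    note y' = fib_eq(2,3)[OF y]
    have "psi y q = 0" if "q \<in> fib x" for q
      using psi_zero_iff[OF y' fib_eq(3)[OF that]] that fib_eq(1)[OF y] by blast
    then obtain a b where ab: "\<And>p. psi y p = a * psi x p + b * cnj (psi x p)"
      using psi_hull[OF x psi_affine[OF y'(1)]] by blast
    then have eq: "psi y = (\<lambda>p. a * psi x p + b * cnj (psi x p))" by blast
    have h': "minkowski (\<lambda>p. cnj (psi x p)) (psi x) = h" using h(1) by (simp add: minkowski_commute)
    have h'': "minkowski (\<lambda>p. cnj (psi x p)) (\<lambda>p. cnj (psi x p)) = 0" using h(3) by (simp add: minkowski_cnj)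
    have "E y = b * h"
      unfolding E_def minkowski_psi_psi(1)[OF x y, symmetric] eq
      by (simp add: minkowski_add_left minkowski_scale_left h(3) h')
    moreover have "E' y = a * h"
      unfolding E'_def minkowski_psi_psi(2)[OF x y, symmetric] eq
      by (simp add: minkowski_add_left minkowski_scale_left h(1) h'')
    moreover have "2 * (a * b * h) = 0"
      using minkowski_psi(1)[OF y'] unfolding eq
      by (simp add: minkowski_add_left minkowski_scale_left minkowski_add_right minkowski_scale_right h h' h'')
    moreover have "a \<noteq> 0 \<or> b \<noteq> 0"
    proof (rule ccontr)
      assume "\<not> ?thesis"
      then have "psi y = (\<lambda>p. 0 * psi y p)" using eq by simp
      then have "minkowski (psi y) (\<lambda>p. cnj (psi y p)) = 0" by (metis minkowski_scale_left mult_zero_left)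
      then show False using minkowski_psi(2,3)[OF y'] by (metis less_irrefl of_real_eq_0_iff)
    qed
    ultimately show ?thesis using ab h(2) by auto
  qed
  obtain T N r where fr: "frame x T N r" by (rule frame_exists[OF x])
  define \<gamma> where "\<gamma> = (\<lambda>\<theta>. x + (r * sin \<theta>) *\<^sub>R T + (r * (cos \<theta> - 1)) *\<^sub>R N)"
  have \<gamma>: "\<gamma> \<theta> \<in> fib x" for \<theta> using frame_points(1)[OF fr] by (simp add: \<gamma>_def)
  have cont: "continuous_on UNIV (\<lambda>\<theta>. DW (\<gamma> \<theta>) b)" for b
  proof (rule continuous_on_compose2[OF DW_cont])
    show "continuous_on UNIV \<gamma>" unfolding \<gamma>_def by (intro continuous_intros)
    show "\<gamma> ` UNIV \<subseteq> U" using fib_eq(2)[OF \<gamma>] by blast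
  qed
  have "closed {\<theta>. E (\<gamma> \<theta>) = 0}" "closed {\<theta>. E' (\<gamma> \<theta>) = 0}"
    unfolding E_def E'_def by (intro closed_Collect_eq continuous_intros cont)+
  moreover have "{\<theta>. E (\<gamma> \<theta>) = 0} \<union> {\<theta>. E' (\<gamma> \<theta>) = 0} = UNIV"
  proof -
    have "E (\<gamma> \<theta>) = 0 \<or> E' (\<gamma> \<theta>) = 0" for \<theta>
      using rel[OF \<gamma>, of \<theta>] by auto
    then show ?thesis by blast
  qed
  moreover have "{\<theta>. E (\<gamma> \<theta>) = 0} \<inter> {\<theta>. E' (\<gamma> \<theta>) = 0} = {}"
  proof -
    have "\<not> (E (\<gamma> \<theta>) = 0 \<and> E' (\<gamma> \<theta>) = 0)" for \<theta>
      using rel[OF \<gamma>, of \<theta>] h(2) by auto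
    then show ?thesis by blast
  qed
  \<comment> \<open>At \<open>x\<close> itself the conjugate coefficient vanishes, and this selects
    the alternative that holds on the whole circle.\<close>
  moreover have "0 \<in> {\<theta>. E (\<gamma> \<theta>) = 0}"
  proof -
    have "\<gamma> 0 = x" by (simp add: \<gamma>_def)
    then show ?thesis using minkowski_psi_psi(1)[OF x fib_self[OF x]] h(3) by (simp add: E_def)
  qed
  ultimately have all: "E (\<gamma> \<theta>) = 0" for \<theta>
    using connected_subset_disjoint_closed by blast
  obtain \<theta> where "y = \<gamma> \<theta>" using y fr by (auto simp: frame_def \<gamma>_def)
  then have "E y = 0" using all by simp
  then show ?thesis using rel[OF y] h(2) that by auto
qed

text \<open>The inverse function theorem is applied to \<open>W\<close> on a plane through
  \<open>x\<close> that \<open>DW x\<close> maps isomorphically. Projecting the local inverse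
  radially to the sphere does not disturb \<open>W\<close>, which is constant on rays.\<close>

lemma section_exists:
  assumes x: "x \<in> U" "norm x = 1"
  obtains s s' where "s (W x) = x" "(s has_derivative s') (at (W x))"
    "\<And>\<zeta>. DW x (s' \<zeta>) = \<zeta>" "\<And>\<zeta>. x \<bullet> s' \<zeta> = 0"
    "\<forall>\<^sub>F z in nhds (W x). s z \<in> U \<and> norm (s z) = 1 \<and> W (s z) = z"
proof -
  obtain u1 u2 where u: "DW x u1 = 1" "DW x u2 = \<i>"
    using surj[OF x] unfolding DW_def by (metis surjD)
  \<comment> \<open>A right inverse of \<open>DW x\<close>, so that \<open>\<phi>\<close> has the
    identity as derivative at 0.\<close>
  define \<Sigma> where "\<Sigma> = (\<lambda>h. Re h *\<^sub>R u1 + Im h *\<^sub>R u2)"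
  have \<Sigma>: "bounded_linear \<Sigma>" unfolding \<Sigma>_def by (intro bounded_linear_intros bounded_linear_Re bounded_linear_Im)
  have \<Sigma>0: "\<Sigma> 0 = 0" by (simp add: \<Sigma>_def)
  define V where "V = {h. x + \<Sigma> h \<in> U}"
  define \<phi> where "\<phi> = (\<lambda>h. W (x + \<Sigma> h))"
  define \<phi>' where "\<phi>' = (\<lambda>h. Blinfun (\<lambda>k. DW (x + \<Sigma> h) (\<Sigma> k)))"
  have bl: "blinfun_apply (\<phi>' h) = (\<lambda>k. DW (x + \<Sigma> h) (\<Sigma> k))" if "h \<in> V" for h
    unfolding \<phi>'_def
    by (rule bounded_linear_Blinfun_apply)
      (use that bounded_linear_compose[OF _ \<Sigma>] DW_deriv has_derivative_bounded_linear V_def in blast)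
  have contS: "continuous_on A \<Sigma>" for A using \<Sigma> linear_continuous_on by blast
  have contx: "continuous_on A (\<lambda>h. x + \<Sigma> h)" for A by (intro continuous_intros contS)
  have op: "open V"
    unfolding V_def using open_vimage[OF open_U contx] by (simp add: vimage_def)
  have der: "(\<phi> has_derivative blinfun_apply (\<phi>' h)) (at h)" if h: "h \<in> V" for h
  proof -
    have "((\<lambda>h. x + \<Sigma> h) has_derivative \<Sigma>) (at h)"
      using bounded_linear_imp_has_derivative[OF \<Sigma>] by (auto intro!: derivative_eq_intros)
    from has_derivative_compose[OF this DW_deriv] h show ?thesis
      unfolding bl[OF h] \<phi>_def V_def by simp
  qed
  have cont: "continuous_on V \<phi>'"
  proof (rule continuous_on_blinfun_componentwise)
    fix i :: complex
    have "continuous_on V (\<lambda>h. DW (x + \<Sigma> h) (\<Sigma> i))"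
      by (rule continuous_on_compose2[OF DW_cont]) (use contx in \<open>auto simp: V_def\<close>)
    then show "continuous_on V (\<lambda>h. blinfun_apply (\<phi>' h) i)"
      by (simp add: bl cong: continuous_on_cong)
  qed
  have V0: "0 \<in> V" using x by (simp add: V_def \<Sigma>0)
  have right: "DW x (\<Sigma> k) = k" for k
    by (simp add: \<Sigma>_def linear_add[OF DW_linear] linear_cmul[OF DW_linear] x u complex_eq_iff)
  have "id_blinfun o\<^sub>L \<phi>' 0 = id_blinfun"
    by (rule blinfun_eqI) (simp add: bl[OF V0] \<Sigma>0 right)
  from inverse_function_theorem[OF op der cont V0 this]
  obtain U' V' g g' where g: "open U'" "U' \<subseteq> V" "0 \<in> U'" "open V'" "\<phi> 0 \<in> V'" "homeomorphism U' V' \<phi> g"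
    "\<And>y. y \<in> V' \<Longrightarrow> (g has_derivative (g' y)) (at y)" by metis
  have \<phi>0: "\<phi> 0 = W x" by (simp add: \<phi>_def \<Sigma>0)
  have g0: "g (W x) = 0" using g(3,6) \<phi>0 by (metis homeomorphism_apply1)
  define s where "s = (\<lambda>z. sgn (x + \<Sigma> (g z)))"
  have sx: "s (W x) = x" using x by (simp add: s_def g0 \<Sigma>0 sgn_div_norm)
  have x0: "x \<noteq> 0" using x(2) by auto
  have gd: "(g has_derivative g' (W x)) (at (W x))" using g(5,7) \<phi>0 by simp
  have dd: "((\<lambda>z. x + \<Sigma> (g z)) has_derivative (\<lambda>h. \<Sigma> (g' (W x) h))) (at (W x))"
    using has_derivative_add[OF has_derivative_const bounded_linear.has_derivative[OF \<Sigma> gd]]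
    by simp
  have ev: "\<forall>\<^sub>F z in nhds (W x). s z \<in> U \<and> norm (s z) = 1 \<and> W (s z) = z"
  proof -
    have d: "((\<lambda>z. x + \<Sigma> (g z)) \<longlongrightarrow> x) (at (W x))"
      using has_derivative_continuous[OF dd] g0 \<Sigma>0 by (simp add: continuous_at)
    have "\<forall>\<^sub>F z in at (W x). x + \<Sigma> (g z) \<noteq> 0"
      using tendsto_imp_eventually_ne[OF d x0] .
    then have "\<forall>\<^sub>F z in nhds (W x). x + \<Sigma> (g z) \<noteq> 0"
      using x0 g0 \<Sigma>0 by (auto simp: eventually_at_filter elim!: eventually_mono)
    moreover have "\<forall>\<^sub>F z in nhds (W x). z \<in> V'"
      using g(4,5) \<phi>0 by (simp add: eventually_nhds_in_open)
    ultimately show ?thesis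
    proof eventually_elim
      case (elim z)
      have "g z \<in> U'" "\<phi> (g z) = z"
        using g(6) elim(2) by (auto simp: homeomorphism_def)
      then have "x + \<Sigma> (g z) \<in> U" "W (x + \<Sigma> (g z)) = z"
        using g(2) by (auto simp: V_def \<phi>_def)
      then show ?case
        using scale[of "x + \<Sigma> (g z)" "inverse (norm (x + \<Sigma> (g z)))"] elim(1)
        by (simp add: s_def sgn_div_norm norm_sgn)
    qed
  qed
  have "(sgn :: complex \<times> complex \<Rightarrow> _) differentiable (at (x + \<Sigma> (g (W x))))"
    unfolding sgn_div_norm g0 \<Sigma>0 using x0
    by (intro derivative_intros) auto
  then have "s differentiable (at (W x))"
    unfolding s_def by (rule differentiable_compose) (use dd in \<open>auto simp: differentiable_def\<close>)
  then obtain s' where s': "(s has_derivative s') (at (W x))" by (auto simp: differentiable_def)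
  have "((\<lambda>z. W (s z)) has_derivative (\<lambda>h. DW x (s' h))) (at (W x))"
    using has_derivative_compose[OF s', of W "DW x"] DW_deriv[OF x(1)] sx by simp
  moreover have "((\<lambda>z. W (s z)) has_derivative (\<lambda>h. h)) (at (W x))"
    by (rule has_derivative_transform_eventually[OF has_derivative_ident])
      (use ev sx in \<open>auto simp: eventually_at_filter elim!: eventually_mono\<close>)
  ultimately have a: "(\<lambda>h. DW x (s' h)) = (\<lambda>h. h)" by (rule has_derivative_unique)
  have "((\<lambda>z. s z \<bullet> s z) has_derivative (\<lambda>h. 2 * (x \<bullet> s' h))) (at (W x))"
    using has_derivative_inner[OF s' s'] by (simp add: sx inner_commute)
  moreover have "((\<lambda>z. s z \<bullet> s z) has_derivative (\<lambda>h. 0)) (at (W x))"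
    by (rule has_derivative_transform_eventually[OF has_derivative_const[of 1]])
      (use ev sx x in \<open>auto simp: eventually_at_filter dot_square_norm elim!: eventually_mono\<close>)
  ultimately have b: "(\<lambda>h. 2 * (x \<bullet> s' h)) = (\<lambda>h. 0)" by (rule has_derivative_unique)
  show ?thesis
    using that[OF sx s' _ _ ev] fun_cong[OF a] fun_cong[OF b] by simp
qed

end

lemma has_derivative_transform_nhds:
  assumes "(f has_derivative f') (at x)" "\<forall>\<^sub>F z in nhds x. f z = g z"
  shows "(g has_derivative f') (at x)"
  by (rule has_derivative_transform_eventually[OF assms(1)])
    (use assms(2) eventually_nhds_x_imp_x[OF assms(2)] in
      \<open>auto simp: eventually_at_filter elim!: eventually_mono\<close>)

lemma isCont_eventually_nonzero:
  fixes f :: "'a::t2_space \<Rightarrow> 'b::{t1_space, zero}"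
  assumes "isCont f x" "f x \<noteq> 0"
  shows "\<forall>\<^sub>F z in nhds x. f z \<noteq> 0"
  using assms by (intro tendsto_imp_eventually_ne) (simp_all add: isCont_def tendsto_at_iff_tendsto_nhds)

lemma affine_fn_add: "affine_fn f \<Longrightarrow> affine_fn g \<Longrightarrow> affine_fn (\<lambda>p. f p + g p)"
  unfolding affine_fn_def
  by (drule (1) linear_compose_add) (simp add: algebra_simps)

lemma affine_fn_cmult:
  fixes f :: "'a::real_vector \<Rightarrow> complex"
  shows "affine_fn f \<Longrightarrow> affine_fn (\<lambda>p. c * f p)"
  unfolding affine_fn_def
  by (drule linear_compose[OF _ bounded_linear.linear[OF bounded_linear_mult_right[of c]]])
    (simp add: o_def right_diff_distrib)

lemma affine_fn_componentsI:
  fixes f :: "'a::euclidean_space \<Rightarrow> 'b::real_vector"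
  assumes "\<And>p. f p = f 0 + (\<Sum>b\<in>Basis. (p \<bullet> b) *\<^sub>R c b)"
  shows "affine_fn f"
proof -
  have "linear (\<lambda>p. \<Sum>b\<in>Basis. (p \<bullet> b) *\<^sub>R c b)"
    by (rule linearI) (simp_all add: inner_add_left scaleR_add_left sum.distrib scaleR_sum_right)
  moreover have "(\<lambda>p. f p - f 0) = (\<lambda>p. \<Sum>b\<in>Basis. (p \<bullet> b) *\<^sub>R c b)"
    by (subst assms) simp
  ultimately show ?thesis by (simp add: affine_fn_def)
qed

text \<open>An affine function is recovered from its values at 0 and at the basis vectors by a fixed
  linear formula, which survives differentiation in the parameter.\<close>

lemma affine_fn_derivative:
  fixes \<Psi> :: "'c::euclidean_space \<Rightarrow> 'a::euclidean_space \<Rightarrow> 'b::euclidean_space"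
  assumes aff: "\<forall>\<^sub>F z in nhds z0. affine_fn (\<Psi> z)"
    and der: "\<And>p. ((\<lambda>z. \<Psi> z p) has_derivative (\<lambda>\<zeta>. \<Psi>' \<zeta> p)) (at z0)"
  shows "affine_fn (\<Psi>' \<zeta>)"
proof (rule affine_fn_componentsI)
  fix p
  have "((\<lambda>z. \<Psi> z 0 + (\<Sum>b\<in>Basis. (p \<bullet> b) *\<^sub>R (\<Psi> z b - \<Psi> z 0))) has_derivative
      (\<lambda>\<zeta>. \<Psi>' \<zeta> 0 + (\<Sum>b\<in>Basis. (p \<bullet> b) *\<^sub>R (\<Psi>' \<zeta> b - \<Psi>' \<zeta> 0)))) (at z0)"
    by (intro has_derivative_add has_derivative_sum has_derivative_scaleR_right has_derivative_diff der)
  moreover have "((\<lambda>z. \<Psi> z 0 + (\<Sum>b\<in>Basis. (p \<bullet> b) *\<^sub>R (\<Psi> z b - \<Psi> z 0))) has_derivative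
      (\<lambda>\<zeta>. \<Psi>' \<zeta> p)) (at z0)"
  proof (rule has_derivative_transform_nhds[OF der[of p]])
    show "\<forall>\<^sub>F z in nhds z0. \<Psi> z p = \<Psi> z 0 + (\<Sum>b\<in>Basis. (p \<bullet> b) *\<^sub>R (\<Psi> z b - \<Psi> z 0))"
      using aff by eventually_elim (rule affine_fn_components)
  qed
  ultimately have "(\<lambda>\<zeta>. \<Psi>' \<zeta> 0 + (\<Sum>b\<in>Basis. (p \<bullet> b) *\<^sub>R (\<Psi>' \<zeta> b - \<Psi>' \<zeta> 0))) = (\<lambda>\<zeta>. \<Psi>' \<zeta> p)"
    by (rule has_derivative_unique)
  from fun_cong[OF this, of \<zeta>] show
    "\<Psi>' \<zeta> p = \<Psi>' \<zeta> 0 + (\<Sum>b\<in>Basis. (p \<bullet> b) *\<^sub>R (\<Psi>' \<zeta> b - \<Psi>' \<zeta> 0))" by simp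
qed

context circle_map
begin

text \<open>Differentiating \<open>\<Psi> (W q) q = 0\<close> along a section \<open>q\<close> of \<open>W\<close> through a point \<open>y\<close> of the fibre gives the
  last claim, since \<open>\<Psi> (W x)\<close> has a multiple of \<open>W\<close>'s own derivative as its differential at \<open>y\<close>.\<close>

lemma local_family:
  assumes x: "x \<in> U" "norm x = 1"
  obtains \<Psi> \<Psi>' where
    "\<forall>\<^sub>F z in nhds (W x). \<exists>y\<in>U. norm y = 1 \<and> W y = z \<and> \<Psi> z = psi y"
    "\<Psi> (W x) = psi x"
    "\<And>p. ((\<lambda>z. \<Psi> z p) has_derivative (\<lambda>\<zeta>. \<Psi>' \<zeta> p)) (at (W x))"
    "\<And>y. y \<in> fib x \<Longrightarrow> \<exists>k. k \<noteq> 0 \<and> (\<forall>\<zeta>. \<Psi>' \<zeta> y = k * \<zeta>)"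
proof -
  obtain s s' where s: "s (W x) = x" "(s has_derivative s') (at (W x))"
    "\<And>\<zeta>. DW x (s' \<zeta>) = \<zeta>" "\<And>\<zeta>. x \<bullet> s' \<zeta> = 0"
    "\<forall>\<^sub>F z in nhds (W x). s z \<in> U \<and> norm (s z) = 1 \<and> W (s z) = z"
    by (rule section_exists[OF x]) (rule that)
  obtain T N r where fr: "frame x T N r" by (rule frame_exists[OF x])
  define y0 where "y0 = x - (2 * r) *\<^sub>R N"
  have y0: "y0 \<in> fib x" unfolding y0_def by (rule frame_points(2)[OF fr])
  have r: "x \<bullet> N = r" "r > 0" using fr by (simp_all add: frame_def)
  have xy0: "1 - x \<bullet> y0 \<noteq> 0"
    using r x(2) by (simp add: y0_def inner_diff_right dot_square_norm)
  obtain t t' where t: "t (W x) = y0" "(t has_derivative t') (at (W x))"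
    "\<And>\<zeta>. DW y0 (t' \<zeta>) = \<zeta>" "\<And>\<zeta>. y0 \<bullet> t' \<zeta> = 0"
    "\<forall>\<^sub>F z in nhds (W x). t z \<in> U \<and> norm (t z) = 1 \<and> W (t z) = z"
    by (rule section_exists[OF fib_eq(2,3)[OF y0], unfolded fib_eq(4)[OF y0]]) (rule that)
  define \<Psi> where "\<Psi> = (\<lambda>z. psi (s z))"
  \<comment> \<open>\<open>mu\<close> is obtained by choice and has no visible regularity. Near
    \<open>W x\<close> it is recovered by solving \<open>psi (s z) (t z) = 0\<close>, where the
    second section \<open>t\<close> runs through the opposite point \<open>y0\<close> and the
    denominator stays nonzero; the result is a differentiable formula for
    \<open>\<Psi>\<close>.\<close>
  define \<Phi> where "\<Phi> = (\<lambda>z p. DW (s z) p - (1 - s z \<bullet> p) *\<^sub>R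
    (inverse (1 - s z \<bullet> t z) *\<^sub>R (\<Sum>b\<in>Basis. (t z \<bullet> b) *\<^sub>R DW (s z) b)))"
  have sd: "s differentiable (at (W x))" and td: "t differentiable (at (W x))"
    using s t by (auto simp: differentiable_def)
  have DWd: "(\<lambda>z. DW (s z) v) differentiable (at (W x))" for v
    by (rule differentiable_compose[OF _ sd]) (simp add: s(1) DW_differentiable[OF x(1)])
  have \<Phi>d: "(\<lambda>z. \<Phi> z p) differentiable (at (W x))" for p
    unfolding \<Phi>_def using xy0
    by (intro differentiable_diff differentiable_scaleR differentiable_inverse differentiable_sum
        differentiable_inner DWd sd td differentiable_const ballI) (simp_all add: s(1) t(1))
  have "isCont (\<lambda>z. 1 - s z \<bullet> t z) (W x)"
    using has_derivative_continuous[OF s(2)] has_derivative_continuous[OF t(2)]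
    by (intro continuous_intros)
  then have "\<forall>\<^sub>F z in nhds (W x). 1 - s z \<bullet> t z \<noteq> 0"
    by (rule isCont_eventually_nonzero) (use xy0 in \<open>simp add: s(1) t(1)\<close>)
  then have eq: "\<forall>\<^sub>F z in nhds (W x). \<forall>p. \<Phi> z p = \<Psi> z p"
    using s(5) t(5)
  proof eventually_elim
    case (elim z)
    then have "t z \<in> fib (s z)" by (auto simp: fib_def)
    then have "psi (s z) (t z) = 0" using psi_zero_iff elim by blast
    then have "DW (s z) (t z) = mu (s z) * of_real (1 - s z \<bullet> t z)" by (simp add: psi_def)
    then have "inverse (1 - s z \<bullet> t z) *\<^sub>R DW (s z) (t z) = mu (s z)"
      using elim(1) by (simp add: scaleR_conv_of_real)
    then show ?case
      using DW_comp[of "s z" "t z"] elim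
      by (simp add: \<Phi>_def \<Psi>_def psi_def scaleR_conv_of_real mult.commute)
  qed
  have "(\<lambda>z. \<Psi> z p) differentiable (at (W x))" for p
  proof -
    have "((\<lambda>z. \<Psi> z p) has_derivative frechet_derivative (\<lambda>z. \<Phi> z p) (at (W x))) (at (W x))"
      by (rule has_derivative_transform_nhds[OF \<Phi>d[of p, unfolded frechet_derivative_works]])
        (use eq in eventually_elim, blast)
    then show ?thesis by (auto simp: differentiable_def)
  qed
  define \<Psi>' where "\<Psi>' = (\<lambda>\<zeta> p. frechet_derivative (\<lambda>z. \<Psi> z p) (at (W x)) \<zeta>)"
  have der: "((\<lambda>z. \<Psi> z p) has_derivative (\<lambda>\<zeta>. \<Psi>' \<zeta> p)) (at (W x))" for p
    using \<open>(\<lambda>z. \<Psi> z p) differentiable (at (W x))\<close> unfolding \<Psi>'_def frechet_derivative_works .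
  have aff: "\<forall>\<^sub>F z in nhds (W x). affine_fn (\<Psi> z)"
    using s(5) by eventually_elim (simp add: \<Psi>_def psi_affine)
  have "\<exists>k. k \<noteq> 0 \<and> (\<forall>\<zeta>. \<Psi>' \<zeta> y = k * \<zeta>)" if y: "y \<in> fib x" for y
  proof -
    note y' = fib_eq(2,3)[OF y] and Wy = fib_eq(4)[OF y]
    obtain q q' where q: "q (W x) = y" "(q has_derivative q') (at (W x))"
      "\<And>\<zeta>. DW y (q' \<zeta>) = \<zeta>" "\<And>\<zeta>. y \<bullet> q' \<zeta> = 0"
      "\<forall>\<^sub>F z in nhds (W x). q z \<in> U \<and> norm (q z) = 1 \<and> W (q z) = z"
      by (rule section_exists[OF y', unfolded Wy]) (rule that)
    obtain k where k: "k \<noteq> 0" "\<And>p. psi y p = k * psi x p"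
      by (rule psi_fibre[OF x y]) (rule that)
    have ex: "\<Psi> (W x) = psi x" by (simp add: \<Psi>_def s(1))
    have zero: "\<forall>\<^sub>F z in nhds (W x). \<Psi> z 0 + (\<Sum>b\<in>Basis. (q z \<bullet> b) *\<^sub>R (\<Psi> z b - \<Psi> z 0)) = 0"
      using s(5) q(5)
    proof eventually_elim
      case (elim z)
      then have "q z \<in> fib (s z)" by (auto simp: fib_def)
      then have "psi (s z) (q z) = 0" using psi_zero_iff elim by blast
      then show ?case using affine_fn_components[OF psi_affine, of "s z" "q z"] elim by (simp add: \<Psi>_def)
    qed
    have "((\<lambda>z. \<Psi> z 0 + (\<Sum>b\<in>Basis. (q z \<bullet> b) *\<^sub>R (\<Psi> z b - \<Psi> z 0))) has_derivative
      (\<lambda>\<zeta>. \<Psi>' \<zeta> 0 + (\<Sum>b\<in>Basis. (q (W x) \<bullet> b) *\<^sub>R (\<Psi>' \<zeta> b - \<Psi>' \<zeta> 0)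
        + (q' \<zeta> \<bullet> b) *\<^sub>R (\<Psi> (W x) b - \<Psi> (W x) 0)))) (at (W x))"
      by (intro has_derivative_add has_derivative_sum has_derivative_scaleR has_derivative_diff der
          has_derivative_inner_left q)
    moreover have "((\<lambda>z. \<Psi> z 0 + (\<Sum>b\<in>Basis. (q z \<bullet> b) *\<^sub>R (\<Psi> z b - \<Psi> z 0))) has_derivative
      (\<lambda>\<zeta>. 0)) (at (W x))"
      by (rule has_derivative_transform_nhds[OF has_derivative_const[of 0]])
        (use zero in eventually_elim, simp)
    ultimately have "(\<lambda>\<zeta>. \<Psi>' \<zeta> 0 + (\<Sum>b\<in>Basis. (q (W x) \<bullet> b) *\<^sub>R (\<Psi>' \<zeta> b - \<Psi>' \<zeta> 0)
        + (q' \<zeta> \<bullet> b) *\<^sub>R (\<Psi> (W x) b - \<Psi> (W x) 0))) = (\<lambda>\<zeta>. 0)" by (rule has_derivative_unique)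
    from fun_cong[OF this] have a1: "\<Psi>' \<zeta> y + psi_lin x (q' \<zeta>) = 0" for \<zeta>
      using affine_fn_components[OF affine_fn_derivative[OF aff der], of \<zeta> y]
        euclidean_components_linear[OF psi_lin_linear[OF x(1)], of "q' \<zeta>"]
      by (simp add: sum.distrib q(1) ex psi_lin_def add_ac)
    \<comment> \<open>\<open>q' \<zeta>\<close> is orthogonal to \<open>y\<close>, where
      \<open>psi_lin y\<close> agrees with \<open>DW y\<close>, and \<open>DW y\<close> inverts
      \<open>q'\<close> because \<open>q\<close> is a section.\<close>
    have a2: "k * psi_lin x (q' \<zeta>) = \<zeta>" for \<zeta>
      using psi_lin_eq[OF y'(1), of "q' \<zeta>"] q(3,4) by (simp add: psi_lin_def k(2) right_diff_distrib)
    have "\<Psi>' \<zeta> y = (- 1 / k) * \<zeta>" for \<zeta>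
    proof -
      have "psi_lin x (q' \<zeta>) = \<zeta> / k" using a2[of \<zeta>] k(1) by (auto simp: field_simps)
      then show ?thesis using a1[of \<zeta>] by (simp add: add_eq_0_iff2)
    qed
    then show ?thesis using k(1) by (intro exI[of _ "- 1 / k"]) simp
  qed
  moreover have "\<forall>\<^sub>F z in nhds (W x). \<exists>y\<in>U. norm y = 1 \<and> W y = z \<and> \<Psi> z = psi y"
    using s(5) by eventually_elim (auto simp: \<Psi>_def)
  ultimately show ?thesis using that[of \<Psi> \<Psi>'] der by (simp add: \<Psi>_def s(1))
qed

text \<open>The antiholomorphic part \<open>D\<close> of the derivative vanishes on the fibre, hence is a combination of
  \<open>psi x\<close> and its conjugate; the null condition kills the second coefficient and the normalization
  at \<open>n\<close> the first.\<close>

lemma normalized_holomorphic: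
  assumes x: "x \<in> U" "norm x = 1" and o: "psi x n \<noteq> 0"
    and P: "\<forall>\<^sub>F z in nhds (W x). \<forall>y\<in>U. norm y = 1 \<longrightarrow> W y = z \<longrightarrow> (\<forall>p. P z p = psi y p / psi y n)"
  shows "(\<lambda>z. P z p) field_differentiable (at (W x))"
proof -
  obtain \<Psi> \<Psi>' where \<Psi>: "\<forall>\<^sub>F z in nhds (W x). \<exists>y\<in>U. norm y = 1 \<and> W y = z \<and> \<Psi> z = psi y"
    "\<Psi> (W x) = psi x"
    "\<And>p. ((\<lambda>z. \<Psi> z p) has_derivative (\<lambda>\<zeta>. \<Psi>' \<zeta> p)) (at (W x))"
    "\<And>y. y \<in> fib x \<Longrightarrow> \<exists>k. k \<noteq> 0 \<and> (\<forall>\<zeta>. \<Psi>' \<zeta> y = k * \<zeta>)"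
    by (rule local_family[OF x]) (rule that)
  define c where "c = psi x n"
  have c: "c \<noteq> 0" using o by (simp add: c_def)
  have PW: "P (W x) = (\<lambda>p. psi x p / c)"
    using eventually_nhds_x_imp_x[OF P] x by (auto simp: c_def)
  have eq: "\<forall>\<^sub>F z in nhds (W x). P z = (\<lambda>p. \<Psi> z p / \<Psi> z n)"
    using P \<Psi>(1) by eventually_elim auto
  define P' where "P' = (\<lambda>\<zeta> p. (\<Psi>' \<zeta> p * c - psi x p * \<Psi>' \<zeta> n) / (c * c))"
  have der: "((\<lambda>z. P z p) has_derivative (\<lambda>\<zeta>. P' \<zeta> p)) (at (W x))" for p
  proof -
    have "((\<lambda>z. \<Psi> z p / \<Psi> z n) has_derivative (\<lambda>\<zeta>. P' \<zeta> p)) (at (W x))"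
      using has_derivative_divide'[OF \<Psi>(3) \<Psi>(3), of n p] c
      unfolding P'_def \<Psi>(2) c_def by simp
    then show ?thesis
      by (rule has_derivative_transform_nhds) (use eq in eventually_elim, simp)
  qed
  have aff: "\<forall>\<^sub>F z in nhds (W x). affine_fn (P z)"
    using P \<Psi>(1)
  proof eventually_elim
    case (elim z)
    then obtain y where y: "y \<in> U" "norm y = 1" "\<And>p. P z p = psi y p / psi y n" by blast
    have eq: "P z = (\<lambda>p. inverse (psi y n) * psi y p)"
      by (rule ext) (simp add: y divide_inverse mult.commute)
    show ?case unfolding eq by (rule affine_fn_cmult[OF psi_affine[OF y(1)]])
  qed
  have mk0: "\<forall>\<^sub>F z in nhds (W x). minkowski (P z) (P z) = 0"
    using P \<Psi>(1)
  proof eventually_elim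
    case (elim z)
    then obtain y where y: "y \<in> U" "norm y = 1" "\<And>p. P z p = psi y p / psi y n" by blast
    have eq: "P z = (\<lambda>p. inverse (psi y n) * psi y p)"
      by (rule ext) (simp add: y divide_inverse mult.commute)
    show ?case unfolding eq minkowski_scale_left minkowski_scale_right using minkowski_psi(1)[OF y(1,2)] by simp
  qed
  \<comment> \<open>The derivative of a family of null vectors is orthogonal to the vector
    itself.\<close>
  have mkP': "minkowski (P' \<zeta>) (psi x) = 0" for \<zeta>
  proof -
    have "((\<lambda>z. minkowski (P z) (P z)) has_derivative (\<lambda>\<zeta>. 2 * minkowski (P' \<zeta>) (P (W x)))) (at (W x))"
    proof -
      have "((\<lambda>z. minkowski (P z) (P z)) has_derivative (\<lambda>\<zeta>. (\<Sum>b\<in>Basis. 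
          (P (W x) b - P (W x) 0) * (P' \<zeta> b - P' \<zeta> 0) + (P' \<zeta> b - P' \<zeta> 0) * (P (W x) b - P (W x) 0))
          - (P (W x) 0 * P' \<zeta> 0 + P' \<zeta> 0 * P (W x) 0))) (at (W x))"
        unfolding minkowski_def
        by (intro has_derivative_diff has_derivative_sum has_derivative_mult der)
      then show ?thesis
        by (rule has_derivative_eq_rhs)
          (simp add: minkowski_def fun_eq_iff algebra_simps sum_distrib_left)
    qed
    moreover have "((\<lambda>z. minkowski (P z) (P z)) has_derivative (\<lambda>\<zeta>. 0)) (at (W x))"
      by (rule has_derivative_transform_nhds[OF has_derivative_const[of 0]])
        (use mk0 in eventually_elim, simp)
    ultimately have "(\<lambda>\<zeta>. 2 * minkowski (P' \<zeta>) (P (W x))) = (\<lambda>\<zeta>. 0)" by (rule has_derivative_unique)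
    from fun_cong[OF this, of \<zeta>] have "minkowski (P' \<zeta>) (\<lambda>p. inverse c * psi x p) = 0"
      by (simp add: PW divide_inverse mult.commute)
    then show ?thesis using c by (simp add: minkowski_scale_right)
  qed
  \<comment> \<open>This is \<open>- 2 * \<i>\<close> times the derivative with respect to the
    conjugate variable.\<close>
  define D where "D = (\<lambda>p. P' \<i> p + (- \<i>) * P' 1 p)"
  have affD: "affine_fn D"
    unfolding D_def by (intro affine_fn_add affine_fn_cmult affine_fn_derivative[OF aff der])
  have "D y = 0" if y: "y \<in> fib x" for y
  proof -
    have "psi x y = 0" using psi_zero_iff[OF x fib_eq(3)[OF y]] y by blast
    moreover obtain k where "\<And>\<zeta>. \<Psi>' \<zeta> y = k * \<zeta>" using \<Psi>(4)[OF y] by blast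
    ultimately show ?thesis by (simp add: D_def P'_def)
  qed
  then obtain a b where ab: "\<And>p. D p = a * psi x p + b * cnj (psi x p)"
    using psi_hull[OF x affD] by blast
  have "minkowski D (psi x) = 0" unfolding D_def minkowski_add_left minkowski_scale_left mkP' by simp
  moreover have "minkowski D (psi x) = b * minkowski (\<lambda>p. cnj (psi x p)) (psi x)"
    unfolding ab[abs_def] by (simp add: minkowski_add_left minkowski_scale_left minkowski_psi(1)[OF x])
  moreover have "minkowski (\<lambda>p. cnj (psi x p)) (psi x) \<noteq> 0"
    using minkowski_psi(2,3)[OF x] by (metis less_irrefl minkowski_commute of_real_eq_0_iff)
  ultimately have b: "b = 0" by simp
  \<comment> \<open>The quotient defining \<open>P\<close> is normalized at \<open>n\<close>, so its
    derivative vanishes there, while \<open>psi x n\<close> does not.\<close>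
  have "D n = 0" by (simp add: D_def P'_def c_def mult.commute)
  then have "a = 0" using ab[of n] b c by (simp add: c_def)
  then have CR: "P' \<i> p = \<i> * P' 1 p" using ab[of p] b by (simp add: D_def)
  have comp: "P' \<zeta> p = Re \<zeta> *\<^sub>R P' 1 p + Im \<zeta> *\<^sub>R P' \<i> p" for \<zeta>
  proof -
    have L: "linear (\<lambda>\<zeta>. P' \<zeta> p)" using der has_derivative_linear by blast
    have "P' (Re \<zeta> *\<^sub>R 1 + Im \<zeta> *\<^sub>R \<i>) p = Re \<zeta> *\<^sub>R P' 1 p + Im \<zeta> *\<^sub>R P' \<i> p"
      using linear_add[OF L] linear_cmul[OF L] by simp
    moreover have "Re \<zeta> *\<^sub>R 1 + Im \<zeta> *\<^sub>R \<i> = \<zeta>" by (simp add: complex_eq_iff)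
    ultimately show ?thesis by simp
  qed
  have "(\<lambda>\<zeta>. P' \<zeta> p) = (*) (P' 1 p)"
  proof
    fix \<zeta>
    show "P' \<zeta> p = P' 1 p * \<zeta>"
      unfolding comp[of \<zeta>] CR by (simp add: complex_eq_iff algebra_simps)
  qed
  then have "((\<lambda>z. P z p) has_field_derivative P' 1 p) (at (W x))"
    using der[of p] by (simp add: has_field_derivative_def)
  then show ?thesis by (auto simp: field_differentiable_def)
qed

end

section \<open>Moebius transformations adapted to the Hopf fibration\<close>

lemma inner_complex_Re: "x \<bullet> y = Re (cnj x * y)" for x y :: complex
  by (simp add: inner_complex_def)

text \<open>The real and imaginary parts of \<open>\<phi>0\<close> and \<open>\<phi>1\<close> are
  four orthonormal spacelike vectors of five-dimensional Minkowski space. Completed by a timelike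
  unit vector \<open>(n, d)\<close> they form a Lorentz matrix with blocks \<open>A\<close>,
  \<open>n\<close>, \<open>m\<close>, \<open>d\<close>, whose action on the sphere is
  \<open>f\<close>; the inverse matrix has blocks \<open>L\<close>, \<open>- m\<close>,
  \<open>- n\<close>, \<open>d\<close>.\<close>

lemma orthonormal_frame_mobius:
  fixes \<phi>0 \<phi>1 :: "complex \<times> complex \<Rightarrow> complex"
  assumes aff: "affine_fn \<phi>0" "affine_fn \<phi>1"
    and iso: "minkowski \<phi>0 \<phi>0 = 0" "minkowski \<phi>1 \<phi>1 = 0" "minkowski \<phi>0 \<phi>1 = 0"
    and herm: "minkowski \<phi>0 (\<lambda>p. cnj (\<phi>0 p)) = 2" "minkowski \<phi>1 (\<lambda>p. cnj (\<phi>1 p)) = 2"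
      "minkowski \<phi>0 (\<lambda>p. cnj (\<phi>1 p)) = 0"
  obtains f where "conformal_transformation f"
    "\<And>X. norm X = 1 \<Longrightarrow> norm (f X) = 1 \<and> (\<exists>t>0. \<phi>0 (f X) = of_real t * fst X \<and> \<phi>1 (f X) = of_real t * snd X)"
proof -
  define H where "H = (\<lambda>p. (\<phi>0 p, \<phi>1 p))"
  define m where "m = - H 0"
  define L where "L = (\<lambda>p. H p + m)"
  have L: "linear L"
    using aff unfolding affine_fn_def L_def m_def H_def
    by (auto simp: linear_iff)
  \<comment> \<open>A null vector of Hermitian square 2 has real and imaginary parts of square 1;
    hence the constant 2 in the hypotheses.\<close>
  have gram: "(\<Sum>b\<in>Basis. (X \<bullet> L b) * (Y \<bullet> L b)) - (X \<bullet> m) * (Y \<bullet> m) = X \<bullet> Y" for X Y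
  proof -
    define \<theta> where "\<theta> = (\<lambda>X p. complex_of_real (X \<bullet> H p))"
    have \<theta>: "\<theta> X = (\<lambda>p. 1/2 * (cnj (fst X) * \<phi>0 p + cnj (snd X) * \<phi>1 p)
        + 1/2 * (fst X * cnj (\<phi>0 p) + snd X * cnj (\<phi>1 p)))" for X
    proof
      fix p
      have re: "complex_of_real (u \<bullet> v) = 1/2 * (cnj u * v) + 1/2 * (u * cnj v)" for u v :: complex
        by (simp add: complex_eq_iff inner_complex_def field_simps)
      show "\<theta> X p = 1/2 * (cnj (fst X) * \<phi>0 p + cnj (snd X) * \<phi>1 p)
        + 1/2 * (fst X * cnj (\<phi>0 p) + snd X * cnj (\<phi>1 p))"
        unfolding \<theta>_def H_def inner_prod_def of_real_add re by (simp add: algebra_simps)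
    qed
    have h1: "minkowski (\<lambda>p. cnj (\<phi>0 p)) (\<lambda>p. cnj (\<phi>0 p)) = 0" "minkowski (\<lambda>p. cnj (\<phi>1 p)) (\<lambda>p. cnj (\<phi>1 p)) = 0"
      "minkowski (\<lambda>p. cnj (\<phi>0 p)) (\<lambda>p. cnj (\<phi>1 p)) = 0"
      by (simp_all only: minkowski_cnj iso complex_cnj_zero)
    have h2: "minkowski (\<lambda>p. cnj (\<phi>0 p)) \<phi>1 = 0"
      using minkowski_cnj[of \<phi>0 "\<lambda>p. cnj (\<phi>1 p)"] herm(3) by simp
    note h3 = iso(3)[unfolded minkowski_commute[of \<phi>0 \<phi>1]] h2[unfolded minkowski_commute[of _ \<phi>1]]
      h1(3)[unfolded minkowski_commute[of "\<lambda>p. cnj (\<phi>0 p)" "\<lambda>p. cnj (\<phi>1 p)"]]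
      herm(1)[unfolded minkowski_commute[of \<phi>0 "\<lambda>p. cnj (\<phi>0 p)"]]
      herm(2)[unfolded minkowski_commute[of \<phi>1 "\<lambda>p. cnj (\<phi>1 p)"]]
      herm(3)[unfolded minkowski_commute[of \<phi>0 "\<lambda>p. cnj (\<phi>1 p)"]]
    note h = h1 h2 h3
    have "minkowski (\<theta> X) (\<theta> Y) = of_real (X \<bullet> Y)"
      unfolding \<theta> minkowski_add_left minkowski_scale_left minkowski_add_right minkowski_scale_right h iso herm
      by (simp add: inner_prod_def inner_complex_def complex_eq_iff field_simps)
    moreover have "minkowski (\<theta> X) (\<theta> Y) = of_real ((\<Sum>b\<in>Basis. (X \<bullet> L b) * (Y \<bullet> L b)) - (X \<bullet> m) * (Y \<bullet> m))"
      by (simp add: minkowski_def \<theta>_def L_def m_def inner_diff_right inner_minus_right)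
    ultimately show ?thesis by (metis of_real_eq_iff)
  qed
  define A where "A = adjoint L"
  have A: "linear A" unfolding A_def by (rule adjoint_linear[OF L])
  have adj: "A X \<bullet> p = X \<bullet> L p" for X p
    using adjoint_works[OF L, of p X] by (simp add: A_def inner_commute)
  have K: "A X \<bullet> A Y = X \<bullet> Y + (X \<bullet> m) * (Y \<bullet> m)" for X Y
  proof -
    have "A X \<bullet> A Y = (\<Sum>b\<in>Basis. (A X \<bullet> b) * (A Y \<bullet> b))" by (rule euclidean_inner)
    also have "\<dots> = (\<Sum>b\<in>Basis. (X \<bullet> L b) * (Y \<bullet> L b))" by (simp only: adj)
    finally show ?thesis using gram[of X Y] by simp
  qed
  have LA: "L (A X) = X + (X \<bullet> m) *\<^sub>R m" for X
  proof (rule vector_eq_rdot[THEN iffD1], rule allI)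
    fix Y
    show "L (A X) \<bullet> Y = (X + (X \<bullet> m) *\<^sub>R m) \<bullet> Y"
      using K[of Y X] adj[of Y "A X"] by (simp add: inner_add_right inner_commute mult.commute)
  qed
  \<comment> \<open>\<open>(n, d)\<close> is orthogonal to the four spacelike vectors, with
    \<open>n \<bullet> n - d * d = - 1\<close>.\<close>
  define d where "d = sqrt (1 + m \<bullet> m)"
  have d2: "d * d = 1 + m \<bullet> m" unfolding d_def by (simp add: abs_of_nonneg)
  have d: "d > 0" unfolding d_def by (simp add: add_pos_nonneg)
  define n where "n = A m /\<^sub>R d"
  have An: "A m = d *\<^sub>R n" using d by (simp add: n_def)
  have "d *\<^sub>R L n = d *\<^sub>R (d *\<^sub>R m)"
    using LA[of m] d2 by (simp add: An linear_cmul[OF L] scaleR_add_left)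
  then have Ln: "L n = d *\<^sub>R m" using d scaleR_left_imp_eq[of d] by blast
  have AXn: "A X \<bullet> n = d * (X \<bullet> m)" for X using adj[of X n] Ln by simp
  have nn: "n \<bullet> n = m \<bullet> m"
    using AXn[of m] d by (simp add: An)
  have mL: "m \<bullet> L p = d * (n \<bullet> p)" for p using adj[of m p] by (simp add: An)
  \<comment> \<open>Only the composition \<open>L\<close> after \<open>A\<close> is known so far.
    \<open>R\<close> is \<open>A\<close> after the inverse of the rank-one perturbation in
    \<open>LA\<close>, hence a right inverse of \<open>L\<close>; in finite dimension it is also a
    left inverse, which yields the other composition.\<close>
  have AL: "A (L p) = p + (n \<bullet> p) *\<^sub>R n" for p
  proof -
    define R where "R = (\<lambda>X. A (X - ((m \<bullet> X) / (d * d)) *\<^sub>R m))"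
    have R: "linear R"
      unfolding R_def
      by (rule linearI) (simp_all add: linear_add[OF A] linear_diff[OF A] linear_cmul[OF A]
          inner_add_right add_divide_distrib algebra_simps)
    have "L (R X) = X" for X
    proof -
      have "L (R X) = X + (m \<bullet> X) *\<^sub>R m - ((m \<bullet> X) / (d * d)) *\<^sub>R ((d * d) *\<^sub>R m)"
        by (simp add: R_def linear_diff[OF A] linear_cmul[OF A] linear_diff[OF L] linear_cmul[OF L]
            LA d2 inner_commute scaleR_add_left)
      then show ?thesis using d by simp
    qed
    then have "L \<circ> R = id" by auto
    then have "R \<circ> L = id" using linear_inverse_left[OF L R] by blast
    then have "R (L p) = p" by (metis comp_apply id_apply)
    moreover have "R (L p) = A (L p) - (n \<bullet> p) *\<^sub>R n"
      using d by (simp add: R_def linear_diff[OF A] linear_cmul[OF A] mL An)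
    ultimately show ?thesis by (simp add: algebra_simps)
  qed
  have pos0: "0 < v \<bullet> x + d" if "v \<bullet> v = m \<bullet> m" "norm x = 1" for v x :: "complex \<times> complex"
  proof -
    have "\<bar>v \<bullet> x\<bar> \<le> norm v" using Cauchy_Schwarz_ineq2[of v x] that(2) by simp
    also have "\<dots> < d" unfolding d_def norm_eq_sqrt_inner that(1) by simp
    finally show ?thesis by linarith
  qed
  define f where "f = moebius A n m d"
  have pos: "0 < m \<bullet> x + d" if "norm x = 1" for x using pos0 that by blast
  have pos': "0 < (- n) \<bullet> x + d" if "norm x = 1" for x
    using pos0[of "- n"] that nn by simp
  have form: "(A x + n) \<bullet> (A x + n) - (m \<bullet> x + d)\<^sup>2 = 1 * (x \<bullet> x - 1)" for x
    using K[of x x] AXn[of x] nn d2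
    by (simp add: inner_add_left inner_add_right inner_commute power2_eq_square algebra_simps)
  have LL: "L x \<bullet> L x = x \<bullet> x + (n \<bullet> x) * (n \<bullet> x)" for x
    using adj[of "L x" x] by (simp add: AL inner_add_left)
  have form': "(L x + (- m)) \<bullet> (L x + (- m)) - ((- n) \<bullet> x + d)\<^sup>2 = 1 * (x \<bullet> x - 1)" for x
    using LL[of x] mL[of x] d2
    by (simp add: inner_diff_left inner_diff_right inner_commute[of "L x" m] power2_eq_square algebra_simps)
  have Hf: "L (f X) - m = X /\<^sub>R (m \<bullet> X + d)" if "norm X = 1" for X
  proof -
    have D: "m \<bullet> X + d > 0" using pos that by blast
    have "L (f X) = (X + (m \<bullet> X + d) *\<^sub>R m) /\<^sub>R (m \<bullet> X + d)"
      by (simp add: f_def moebius_def linear_cmul[OF L] linear_add[OF L] LA Ln inner_commute scaleR_add_left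
          add.assoc)
    then show ?thesis using D by (simp add: scaleR_add_right)
  qed
  have nf: "(- n) \<bullet> f X + d = inverse (m \<bullet> X + d)" if "norm X = 1" for X
  proof -
    have D: "m \<bullet> X + d > 0" using pos that by blast
    have "n \<bullet> f X = (d * (m \<bullet> X) + m \<bullet> m) / (m \<bullet> X + d)"
      using AXn[of X] nn by (simp add: f_def moebius_def inner_add_right inner_commute divide_inverse mult.commute)
    moreover have "d * (m \<bullet> X + d) - (d * (m \<bullet> X) + m \<bullet> m) = 1"
      using d2 by (simp add: algebra_simps)
    ultimately show ?thesis using D by (simp add: field_simps)
  qed
  have inv: "moebius L (- m) (- n) d (f X) = X" if "norm X = 1" for X
  proof -
    have "moebius L (- m) (- n) d (f X) = (L (f X) - m) /\<^sub>R ((- n) \<bullet> f X + d)" by (simp add: moebius_def)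
    also have "\<dots> = X" unfolding Hf[OF that] nf[OF that] using pos[OF that] by simp
    finally show ?thesis .
  qed
  have inv': "f (moebius L (- m) (- n) d p) = p" if "norm p = 1" for p
  proof -
    let ?D = "d - n \<bullet> p"
    have D: "?D > 0" using pos'[OF that] by simp
    define q where "q = (L p - m) /\<^sub>R ?D"
    have "A q + n = (A (L p) - A m + ?D *\<^sub>R n) /\<^sub>R ?D"
      using D by (simp add: q_def linear_cmul[OF A] linear_diff[OF A] scaleR_add_right)
    also have "A (L p) - A m + ?D *\<^sub>R n = p" by (simp add: AL An algebra_simps)
    finally have 1: "A q + n = p /\<^sub>R ?D" .
    have "m \<bullet> q = (m \<bullet> L p - m \<bullet> m) / ?D"
      by (simp add: q_def inner_diff_right divide_inverse mult.commute)
    moreover have "d = d * ?D / ?D" using D by simp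
    ultimately have "m \<bullet> q + d = (m \<bullet> L p - m \<bullet> m + d * ?D) / ?D"
      by (metis add_divide_distrib)
    also have "m \<bullet> L p - m \<bullet> m + d * ?D = 1" using mL[of p] d2 by (simp add: algebra_simps)
    finally have 2: "m \<bullet> q + d = 1 / ?D" .
    have "moebius L (- m) (- n) d p = q" by (simp add: moebius_def q_def)
    then show ?thesis using D by (simp add: f_def moebius_def 1 2)
  qed
  have conf: "conformal_transformation f"
    unfolding f_def
    by (rule moebius_conformal[OF A L pos pos' form form' _ inv[unfolded f_def] inv'[unfolded f_def]]) simp_all
  show ?thesis
  proof (rule that[OF conf])
    fix X :: "complex \<times> complex"
    assume X: "norm X = 1"
    have D: "m \<bullet> X + d > 0" using pos X by blast
    have "f X \<in> S3"
      using conf X unfolding conformal_transformation_def bij_betw_def by auto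
    moreover have "H (f X) = X /\<^sub>R (m \<bullet> X + d)" using Hf[OF X] by (simp add: L_def)
    then have "\<phi>0 (f X) = of_real (inverse (m \<bullet> X + d)) * fst X \<and> \<phi>1 (f X) = of_real (inverse (m \<bullet> X + d)) * snd X"
      by (simp add: H_def prod_eq_iff scaleR_conv_of_real)
    ultimately show "norm (f X) = 1 \<and> (\<exists>t>0. \<phi>0 (f X) = of_real t * fst X \<and> \<phi>1 (f X) = of_real t * snd X)"
      using D by (intro conjI exI[of _ "inverse (m \<bullet> X + d)"]) simp_all
  qed
qed

lemma hopf_eq:
  assumes "(z1, z2) \<noteq> 0"
  shows "hopf (z1, z2) = (2 * z1 * cnj z2 / of_real ((norm z1)\<^sup>2 + (norm z2)\<^sup>2),
    ((norm z1)\<^sup>2 - (norm z2)\<^sup>2) / ((norm z1)\<^sup>2 + (norm z2)\<^sup>2))"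
  unfolding hopf_def
  by (subst CP1_to_S2.abs_eq) (use assms in \<open>auto simp: proportional_def intro!: exI[of _ 1]\<close>)

lemma hopf_scale:
  assumes "(z1, z2) \<noteq> 0" "c \<noteq> 0"
  shows "hopf (c * z1, c * z2) = hopf (z1, z2)"
proof -
  have "proportional (z1, z2) (c * z1, c * z2)"
    using assms by (auto simp: proportional_def zero_prod_def)
  then show ?thesis using Quotient_rel_abs[OF Quotient_CP1] by (simp add: hopf_def)
qed

lemma hopf_section:
  assumes "norm (\<zeta>, t) = 1" "t \<noteq> (1::real)"
  shows "hopf (\<zeta>, of_real (1 - t)) = (\<zeta>, t)"
proof -
  have 1: "(norm \<zeta>)\<^sup>2 = (1 - t) * (1 + t)"
    using assms(1) by (simp add: norm_Pair real_sqrt_eq_1_iff power2_eq_square algebra_simps)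
  have 2: "(norm (complex_of_real (1 - t)))\<^sup>2 = (1 - t) * (1 - t)"
    unfolding norm_of_real by (simp add: power2_eq_square)
  have 3: "(1 - t) * (1 + t) + (1 - t) * (1 - t) = 2 * (1 - t)" "(1 - t) * (1 + t) - (1 - t) * (1 - t) = 2 * (1 - t) * t"
    by (simp_all add: algebra_simps)
  have nz: "1 - t \<noteq> 0" using assms(2) by simp
  then have "(\<zeta>, complex_of_real (1 - t)) \<noteq> 0" by (simp add: zero_prod_def del: of_real_diff)
  from hopf_eq[OF this] show ?thesis
    unfolding 1 2 3 using nz by (simp add: divide_simps)
qed

lemma hopf_surj:
  assumes "norm q = 1" obtains v where "v \<noteq> 0" "hopf v = q"
proof -
  obtain \<zeta> t where q: "q = (\<zeta>, t)" by (cases q)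
  show ?thesis
  proof (cases "t = 1")
    case True
    then have "\<zeta> = 0" using assms by (simp add: q norm_Pair real_sqrt_eq_1_iff)
    then have "hopf (1, 0) = q" using True q CP1_to_S2_infinity by (simp add: hopf_def)
    then show ?thesis using that[of "(1, 0)"] by (simp add: zero_prod_def)
  next
    case False
    then show ?thesis
      using hopf_section[of \<zeta> t] assms q that[of "(\<zeta>, of_real (1 - t))"]
      by (simp add: zero_prod_def del: of_real_diff)
  qed
qed

text \<open>The extension to the Riemann sphere of \<open>z \<mapsto> a z + b\<close>.\<close>

definition affine_S2 :: "complex \<Rightarrow> complex \<Rightarrow> complex \<times> real \<Rightarrow> complex \<times> real" where
  "affine_S2 a b = moebius (\<lambda>x. (a * fst x - of_real (snd x) * b,
        ((norm a)\<^sup>2 - (norm b)\<^sup>2 + 1) / 2 * snd x + Re (a * cnj b * fst x)))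
      (b, ((norm a)\<^sup>2 + (norm b)\<^sup>2 - 1) / 2)
      (cnj a * b, ((norm a)\<^sup>2 - (norm b)\<^sup>2 - 1) / 2) (((norm a)\<^sup>2 + (norm b)\<^sup>2 + 1) / 2)"

text \<open>Up to the factor \<open>n\<close> the Hopf image has homogeneous coordinates
  \<open>2 * z1 * cnj z2\<close>, \<open>(norm z1)\<^sup>2 - (norm z2)\<^sup>2\<close> and
  \<open>(norm z1)\<^sup>2 + (norm z2)\<^sup>2\<close>. Replacing \<open>z1\<close> by
  \<open>a * z1 + b * z2\<close> acts linearly on them, and the entries of \<open>affine_S2\<close>
  are the coefficients of this action.\<close>

lemma affine_S2_hopf:
  assumes v: "(z1, z2) \<noteq> 0" and a: "a \<noteq> 0"
  shows "affine_S2 a b (hopf (z1, z2)) = hopf (a * z1 + b * z2, z2)"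
proof -
  have v': "(a * z1 + b * z2, z2) \<noteq> 0" using assms by (auto simp: zero_prod_def)
  define n where "n = (norm z1)\<^sup>2 + (norm z2)\<^sup>2"
  define n' where "n' = (norm (a * z1 + b * z2))\<^sup>2 + (norm z2)\<^sup>2"
  have n: "n > 0" using v unfolding n_def zero_prod_def
    by (auto simp: sum_power2_gt_zero_iff)
  have n': "n' > 0" using v' unfolding n'_def zero_prod_def
    by (auto simp: sum_power2_gt_zero_iff)
  define x1 where "x1 = 2 * z1 * cnj z2 / of_real n"
  define x2 where "x2 = ((norm z1)\<^sup>2 - (norm z2)\<^sup>2) / n"
  have nx1: "of_real n * x1 = 2 * z1 * cnj z2" and nx2: "n * x2 = (norm z1)\<^sup>2 - (norm z2)\<^sup>2"
    using n by (simp_all add: x1_def x2_def)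
  have hx: "hopf (z1, z2) = (x1, x2)" using hopf_eq[OF v] by (simp add: x1_def x2_def n_def)
  let ?S = "(norm (a * z1 + b * z2))\<^sup>2"
  have S: "?S = (norm a)\<^sup>2 * (norm z1)\<^sup>2 + (norm b)\<^sup>2 * (norm z2)\<^sup>2 + Re (a * cnj b * (2 * z1 * cnj z2))"
    unfolding cmod_power2 by (simp add: power2_eq_square algebra_simps)
  have Re: "n * Re (a * cnj b * x1) = Re (a * cnj b * (2 * z1 * cnj z2))"
    unfolding nx1[symmetric] by (simp add: algebra_simps)
  have Q: "n * (Re (a * cnj b * x1) + ((norm a)\<^sup>2 - (norm b)\<^sup>2 - 1) / 2 * x2 + ((norm a)\<^sup>2 + (norm b)\<^sup>2 + 1) / 2) = n'"
  proof -
    have "n * (Re (a * cnj b * x1) + ((norm a)\<^sup>2 - (norm b)\<^sup>2 - 1) / 2 * x2 + ((norm a)\<^sup>2 + (norm b)\<^sup>2 + 1) / 2)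
      = n * Re (a * cnj b * x1) + ((norm a)\<^sup>2 - (norm b)\<^sup>2 - 1) / 2 * (n * x2) + n * (((norm a)\<^sup>2 + (norm b)\<^sup>2 + 1) / 2)"
      by (simp add: algebra_simps)
    also have "\<dots> = n'" unfolding Re nx2 unfolding n'_def S n_def by (simp add: field_simps)
    finally show ?thesis .
  qed
  have P: "n * (((norm a)\<^sup>2 - (norm b)\<^sup>2 + 1) / 2 * x2 + Re (a * cnj b * x1) + ((norm a)\<^sup>2 + (norm b)\<^sup>2 - 1) / 2) = ?S - (norm z2)\<^sup>2"
  proof -
    have "n * (((norm a)\<^sup>2 - (norm b)\<^sup>2 + 1) / 2 * x2 + Re (a * cnj b * x1) + ((norm a)\<^sup>2 + (norm b)\<^sup>2 - 1) / 2)
      = n * Re (a * cnj b * x1) + ((norm a)\<^sup>2 - (norm b)\<^sup>2 + 1) / 2 * (n * x2) + n * (((norm a)\<^sup>2 + (norm b)\<^sup>2 - 1) / 2)"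
      by (simp add: algebra_simps)
    also have "\<dots> = ?S - (norm z2)\<^sup>2" unfolding Re nx2 unfolding S n_def by (simp add: field_simps)
    finally show ?thesis .
  qed
  have N: "of_real n * (a * x1 - of_real x2 * b + b) = 2 * (a * z1 + b * z2) * cnj z2"
  proof -
    have "of_real n * (a * x1 - of_real x2 * b + b) = a * (of_real n * x1) + of_real (n - n * x2) * b"
      by (simp add: algebra_simps)
    also have "n - n * x2 = 2 * (norm z2)\<^sup>2" unfolding nx2 unfolding n_def by simp
    also have "complex_of_real (2 * (norm z2)\<^sup>2) = 2 * (z2 * cnj z2)"
      by (simp only: complex_norm_square of_real_mult of_real_numeral)
    finally show ?thesis unfolding nx1 by (simp add: algebra_simps)
  qed
  let ?q = "Re (a * cnj b * x1) + ((norm a)\<^sup>2 - (norm b)\<^sup>2 - 1) / 2 * x2 + ((norm a)\<^sup>2 + (norm b)\<^sup>2 + 1) / 2"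
  let ?p = "((norm a)\<^sup>2 - (norm b)\<^sup>2 + 1) / 2 * x2 + Re (a * cnj b * x1) + ((norm a)\<^sup>2 + (norm b)\<^sup>2 - 1) / 2"
  have q: "?q = n' / n" using Q n by (metis less_irrefl nonzero_mult_div_cancel_left)
  have p: "?p = (?S - (norm z2)\<^sup>2) / n" using P n by (metis less_irrefl nonzero_mult_div_cancel_left)
  have w: "a * x1 - of_real x2 * b + b = 2 * (a * z1 + b * z2) * cnj z2 / of_real n"
    using N n by (metis less_irrefl nonzero_mult_div_cancel_left of_real_eq_0_iff)
  have "affine_S2 a b (x1, x2) = (a * x1 - of_real x2 * b + b, ?p) /\<^sub>R ?q"
    by (simp add: affine_S2_def moebius_def inner_complex_Re)
  also have "\<dots> = (2 * (a * z1 + b * z2) * cnj z2 / of_real n', (?S - (norm z2)\<^sup>2) / n')"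
    unfolding q p w using n n' by (simp add: scaleR_conv_of_real)
  also have "\<dots> = hopf (a * z1 + b * z2, z2)"
    unfolding hopf_eq[OF v'] n'_def ..
  finally show ?thesis unfolding hx .
qed

text \<open>The light cone form is preserved up to the factor \<open>(norm a)\<^sup>2\<close>. The
  inverse belongs to the same family, with parameters \<open>1 / a\<close> and
  \<open>- b / a\<close>; this is read off from \<open>affine_S2_hopf\<close>, as
  \<open>hopf\<close> reaches every point of the sphere.\<close>

lemma affine_S2_conformal:
  assumes a: "a \<noteq> 0"
  shows "conformal_transformation (affine_S2 a b)"
proof -
  let ?A = "\<lambda>a b x. (a * fst x - of_real (snd x) * b,
        ((norm a)\<^sup>2 - (norm b)\<^sup>2 + 1) / 2 * snd x + Re (a * cnj b * fst x)) :: complex \<times> real"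
  let ?b = "\<lambda>a b::complex. (b, ((norm a)\<^sup>2 + (norm b)\<^sup>2 - 1) / 2)"
  let ?c = "\<lambda>a b::complex. (cnj a * b, ((norm a)\<^sup>2 - (norm b)\<^sup>2 - 1) / 2)"
  let ?d = "\<lambda>a b::complex. ((norm a)\<^sup>2 + (norm b)\<^sup>2 + 1) / 2"
  have lin: "linear (?A a b)" for a b
    by (rule linearI) (auto simp: field_simps scaleR_conv_of_real)
  have form: "(?A a b x + ?b a b) \<bullet> (?A a b x + ?b a b) - (?c a b \<bullet> x + ?d a b)\<^sup>2 = (norm a)\<^sup>2 * (x \<bullet> x - 1)" for a b x
  proof -
    obtain \<zeta> t where x: "x = (\<zeta>, t)" by (cases x)
    define R where "R = Re (a * cnj b * \<zeta>)"
    \<comment> \<open>With this \<open>S\<close> the last coordinate and the denominator are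
      \<open>S - (1 - t) / 2\<close> and \<open>S + (1 - t) / 2\<close>, whose squares differ by
      \<open>2 * S * (1 - t)\<close>.\<close>
    define S where "S = ((norm a)\<^sup>2 * (1 + t) + (norm b)\<^sup>2 * (1 - t)) / 2 + R"
    have 1: "?A a b x + ?b a b = (a * \<zeta> + of_real (1 - t) * b, S - (1 - t) / 2)"
      by (simp add: x S_def R_def field_simps)
    have 2: "?c a b \<bullet> x + ?d a b = S + (1 - t) / 2"
      by (simp add: x S_def R_def field_simps inner_complex_Re)
    have 3: "(norm (a * \<zeta> + of_real (1 - t) * b))\<^sup>2 = (norm a)\<^sup>2 * (norm \<zeta>)\<^sup>2 + (1 - t)\<^sup>2 * (norm b)\<^sup>2 + 2 * (1 - t) * R"
      unfolding R_def cmod_power2 by (simp add: power2_eq_square algebra_simps)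
    have "(?A a b x + ?b a b) \<bullet> (?A a b x + ?b a b) - (?c a b \<bullet> x + ?d a b)\<^sup>2 
      = (norm (a * \<zeta> + of_real (1 - t) * b))\<^sup>2 + (S - (1 - t) / 2)\<^sup>2 - (S + (1 - t) / 2)\<^sup>2"
      unfolding 1 2 inner_Pair power2_norm_eq_inner[of "a * \<zeta> + of_real (1 - t) * b"]
      by (simp add: power2_eq_square)
    also have "\<dots> = (norm a)\<^sup>2 * ((norm \<zeta>)\<^sup>2 + t * t - 1)"
      unfolding 3 S_def by (simp add: power2_eq_square field_simps)
    finally show ?thesis by (simp add: x power2_norm_eq_inner)
  qed
  have pos: "0 < ?c a b \<bullet> x + ?d a b" if "norm x = 1" and a: "a \<noteq> 0" for a b x
  proof -
    obtain \<zeta> t where x: "x = (\<zeta>, t)" by (cases x)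
    have n: "(norm \<zeta>)\<^sup>2 + t\<^sup>2 = 1" using that(1) by (simp add: x norm_Pair real_sqrt_eq_1_iff)
    define S where "S = ((norm a)\<^sup>2 * (1 + t) + (norm b)\<^sup>2 * (1 - t)) / 2 + Re (a * cnj b * \<zeta>)"
    have 2: "?c a b \<bullet> x + ?d a b = S + (1 - t) / 2"
      by (simp add: x S_def field_simps inner_complex_Re)
    have "(norm (a * \<zeta> + of_real (1 - t) * b))\<^sup>2 = (norm a)\<^sup>2 * (norm \<zeta>)\<^sup>2 + (1 - t)\<^sup>2 * (norm b)\<^sup>2 + 2 * (1 - t) * Re (a * cnj b * \<zeta>)"
      unfolding cmod_power2 by (simp add: power2_eq_square algebra_simps)
    also have "(norm \<zeta>)\<^sup>2 = (1 - t) * (1 + t)" using n by (simp add: power2_eq_square algebra_simps)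
    finally have 3: "(norm (a * \<zeta> + of_real (1 - t) * b))\<^sup>2 = 2 * S * (1 - t)"
      unfolding S_def by (simp add: power2_eq_square field_simps)
    have "t\<^sup>2 \<le> 1" using n by (smt (verit) zero_le_power2)
    then have t1: "t \<le> 1" by (simp add: abs_square_le_1 abs_le_iff)
    \<comment> \<open>Away from the north pole \<open>3\<close> forces \<open>S \<ge> 0\<close>. At
      the pole both sides of \<open>3\<close> vanish, and the denominator is
      \<open>(norm a)\<^sup>2\<close>.\<close>
    show ?thesis
    proof (cases "t = 1")
      case True
      then have "\<zeta> = 0" using n by simp
      then show ?thesis unfolding 2 S_def using True a by simp
    next
      case False
      then have t: "1 - t > 0" using t1 by simp
      have "2 * S * (1 - t) \<ge> 0" using 3 by (metis zero_le_power2)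
      then have "S \<ge> 0" using t by (simp add: zero_le_mult_iff)
      then show ?thesis unfolding 2 using t by (intro add_nonneg_pos) simp_all
    qed
  qed
  have inv: "affine_S2 a' b' (affine_S2 a b x) = x"
    if x: "norm x = 1" and a: "a \<noteq> 0" "a' = 1 / a" "b' = - b / a" for a b a' b' x
  proof -
    obtain v where v: "v \<noteq> 0" "hopf v = x" by (rule hopf_surj[OF x])
    obtain z1 z2 where z: "v = (z1, z2)" by (cases v)
    have v': "(a * z1 + b * z2, z2) \<noteq> 0" using v z a by (auto simp: zero_prod_def)
    have "affine_S2 a b x = hopf (a * z1 + b * z2, z2)"
      using affine_S2_hopf[of z1 z2 a b] v z a by simp
    then have "affine_S2 a' b' (affine_S2 a b x) = hopf (a' * (a * z1 + b * z2) + b' * z2, z2)"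
      using affine_S2_hopf[OF v', of a' b'] a by simp
    also have "a' * (a * z1 + b * z2) + b' * z2 = z1" unfolding a(2,3) using a(1) by (simp add: field_simps)
    finally show ?thesis using v z by simp
  qed
  let ?a = "1 / a" and ?bb = "- b / a"
  have ia: "?a \<noteq> 0" "a = 1 / ?a" "b = - ?bb / ?a" using a by simp_all
  show ?thesis
    unfolding affine_S2_def
    by (rule moebius_conformal[OF lin lin pos[OF _ a] pos[OF _ ia(1)] form form _
          inv[OF _ a refl refl, unfolded affine_S2_def] inv[OF _ ia, unfolded affine_S2_def]])
      (use a in simp_all)
qed

section \<open>Stereographic charts of a conformal fibration\<close>

lemma Ck_on_local:
  assumes "\<And>x. x \<in> U \<Longrightarrow> \<exists>V. open V \<and> x \<in> V \<and> Ck_on k V f"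
  shows "Ck_on k U f"
  using assms
proof (induction k arbitrary: f)
  case 0
  have "isCont f x" if x: "x \<in> U" for x
  proof -
    obtain V where "open V" "x \<in> V" "continuous_on V f" using 0[OF x] by auto
    then show ?thesis by (simp add: continuous_on_eq_continuous_at)
  qed
  then show ?case by (simp add: continuous_at_imp_continuous_on)
next
  case (Suc k)
  have "f differentiable (at x)" if x: "x \<in> U" for x
    using Suc.prems[OF x] by auto
  moreover have "Ck_on k U (\<lambda>x. frechet_derivative f (at x) v)" for v
  proof (rule Suc.IH)
    fix x assume x: "x \<in> U"
    obtain V where "open V" "x \<in> V" "Ck_on (Suc k) V f" using Suc.prems[OF x] by blast
    then show "\<exists>V. open V \<and> x \<in> V \<and> Ck_on k V (\<lambda>x. frechet_derivative f (at x) v)" by auto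
  qed
  ultimately show ?case by simp
qed

definition stereo :: "complex \<times> real \<Rightarrow> complex" where
  "stereo q = inverse (1 - snd q) *\<^sub>R fst q"

definition dstereo :: "complex \<times> real \<Rightarrow> complex \<times> real \<Rightarrow> complex" where
  "dstereo q v = inverse (1 - snd q) *\<^sub>R fst v + (snd v / (1 - snd q)\<^sup>2) *\<^sub>R fst q"

lemma stereo_deriv:
  assumes "snd q \<noteq> 1"
  shows "(stereo has_derivative dstereo q) (at q)"
  unfolding stereo_def[abs_def] dstereo_def[abs_def] using assms
  by (auto intro!: derivative_eq_intros simp: power2_eq_square divide_inverse mult_ac)

lemma stereo_Ck: "open U \<Longrightarrow> (\<And>q. q \<in> U \<Longrightarrow> snd q \<noteq> 1) \<Longrightarrow> Ck_on k U stereo"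
  unfolding stereo_def[abs_def]
proof (intro Ck_on_scaleR Ck_on_inverse)
  assume U: "open U"
  have "Ck_on k U (\<lambda>q::complex \<times> real. 1 + (- 1) * snd q)"
    by (intro Ck_on_add Ck_on_mult_real Ck_on_const Ck_on_linear bounded_linear_snd U)
  then show "Ck_on k U (\<lambda>q::complex \<times> real. 1 - snd q)" by simp
  show "Ck_on k U (fst :: complex \<times> real \<Rightarrow> complex)"
    by (intro Ck_on_linear bounded_linear_fst U)
qed auto

lemma dstereo_conformal:
  assumes q: "norm q = 1" "snd q \<noteq> 1" and u: "u \<bullet> q = 0" and v: "v \<bullet> q = 0"
  shows "dstereo q u \<bullet> dstereo q v = inverse ((1 - snd q)\<^sup>2) * (u \<bullet> v)"
proof -
  obtain \<zeta> t where qq: "q = (\<zeta>, t)" by (cases q)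
  obtain \<eta> \<tau> where uu: "u = (\<eta>, \<tau>)" by (cases u)
  obtain \<eta>' \<tau>' where vv: "v = (\<eta>', \<tau>')" by (cases v)
  define s where "s = 1 - t"
  have s: "s \<noteq> 0" and t: "t = 1 - s" using q by (simp_all add: qq s_def)
  have zz: "\<zeta> \<bullet> \<zeta> = s * (2 - s)"
    using q(1) by (simp add: qq norm_eq_1 t algebra_simps)
  have e: "\<eta> \<bullet> \<zeta> = - (\<tau> * t)" "\<zeta> \<bullet> \<eta>' = - (\<tau>' * t)"
    using u v by (simp_all add: uu vv qq inner_commute)
  have "(s *\<^sub>R \<eta> + \<tau> *\<^sub>R \<zeta>) \<bullet> (s *\<^sub>R \<eta>' + \<tau>' *\<^sub>R \<zeta>)
      = s * s * (\<eta> \<bullet> \<eta>') + s * \<tau>' * (\<eta> \<bullet> \<zeta>) + s * \<tau> * (\<zeta> \<bullet> \<eta>') + \<tau> * \<tau>' * (\<zeta> \<bullet> \<zeta>)"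
    by (simp add: inner_add_left inner_add_right algebra_simps)
  also have "\<dots> = s * s * (\<eta> \<bullet> \<eta>' + \<tau> * \<tau>')"
    unfolding e zz t by (simp add: algebra_simps)
  finally have main: "(s *\<^sub>R \<eta> + \<tau> *\<^sub>R \<zeta>) \<bullet> (s *\<^sub>R \<eta>' + \<tau>' *\<^sub>R \<zeta>) = s * s * (u \<bullet> v)"
    by (simp add: uu vv)
  have d: "dstereo q u = inverse (s * s) *\<^sub>R (s *\<^sub>R \<eta> + \<tau> *\<^sub>R \<zeta>)" "dstereo q v = inverse (s * s) *\<^sub>R (s *\<^sub>R \<eta>' + \<tau>' *\<^sub>R \<zeta>)"
    using s by (simp_all add: dstereo_def qq uu vv s_def[symmetric] scaleR_add_right power2_eq_square divide_inverse mult_ac)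
  show ?thesis
    unfolding d inner_scaleR_left inner_scaleR_right main using s
    by (simp add: qq s_def[symmetric] power2_eq_square field_simps)
qed

lemma dstereo_surj:
  assumes q: "norm q = 1" "snd q \<noteq> 1"
  obtains v where "v \<bullet> q = 0" "dstereo q v = w"
proof -
  obtain \<zeta> t where qq: "q = (\<zeta>, t)" by (cases q)
  define s where "s = 1 - t"
  have s: "s \<noteq> 0" and t: "t = 1 - s" using q by (simp_all add: qq s_def)
  have zz: "\<zeta> \<bullet> \<zeta> = s * (2 - s)"
    using q(1) by (simp add: qq norm_eq_1 t algebra_simps)
  \<comment> \<open>Pairing the equation \<open>dstereo q v = w\<close> with \<open>\<zeta>\<close>,
    for tangent \<open>v\<close>, forces the second component to be
    \<open>s * (w \<bullet> \<zeta>)\<close>; the first then follows.\<close>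
  define v where "v = (s *\<^sub>R w - (w \<bullet> \<zeta>) *\<^sub>R \<zeta>, s * (w \<bullet> \<zeta>))"
  have "v \<bullet> q = 0" by (simp add: v_def qq inner_diff_left zz t algebra_simps)
  moreover have "dstereo q v = w"
    using s by (simp add: dstereo_def v_def qq s_def[symmetric] scaleR_diff_right power2_eq_square divide_inverse)
  ultimately show ?thesis by (rule that)
qed

lemma hopf_stereo:
  assumes "norm q = 1" "snd q \<noteq> 1"
  shows "hopf (stereo q, 1) = q"
proof -
  obtain \<zeta> t where qq: "q = (\<zeta>, t)" by (cases q)
  have t: "complex_of_real (1 - t) \<noteq> 0" using assms by (simp add: qq del: of_real_diff)
  have "hopf (of_real (1 - t) * stereo q, of_real (1 - t) * 1) = hopf (stereo q, 1)"
    by (rule hopf_scale[OF _ t]) (simp add: zero_prod_def)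
  moreover have "of_real (1 - t) * stereo q = \<zeta>"
    using t by (simp add: stereo_def qq scaleR_conv_of_real del: of_real_diff)
  ultimately show ?thesis using hopf_section[of \<zeta> t] assms by (simp add: qq del: of_real_diff)
qed

text \<open>The isometry \<open>\<sigma>\<close> selects the point of \<open>S2\<close> that is sent to infinity.\<close>

definition chart_dom where
  "chart_dom \<sigma> \<pi> = {x::complex \<times> complex. x \<noteq> 0 \<and> snd (\<sigma> (\<pi> (sgn x))::complex \<times> real) \<noteq> 1}"

definition chart where
  "chart \<sigma> \<pi> x = stereo (\<sigma> (\<pi> (sgn (x::complex \<times> complex))))"

lemma sgn_unit: "norm x = 1 \<Longrightarrow> sgn x = (x::'a::real_normed_vector)"
  by (simp add: sgn_div_norm)

lemma chart_local:
  fixes \<pi> :: "complex \<times> complex \<Rightarrow> complex \<times> real"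
  assumes "smooth_on S3 \<pi>" and \<sigma>: "bounded_linear \<sigma>" and x: "x \<in> chart_dom \<sigma> \<pi>"
  shows "\<exists>V. open V \<and> x \<in> V \<and> V \<subseteq> chart_dom \<sigma> \<pi> \<and> Ck_on k V (chart \<sigma> \<pi>)"
proof -
  have x0: "x \<noteq> 0" "snd (\<sigma> (\<pi> (sgn x))) \<noteq> 1" using x by (auto simp: chart_dom_def)
  have "sgn x \<in> S3" using x0 by (simp add: norm_sgn)
  then obtain B F where F: "open B" "sgn x \<in> B" "\<And>k. Ck_on k B F" "\<And>p. p \<in> S3 \<inter> B \<Longrightarrow> F p = \<pi> p"
    using assms(1) unfolding smooth_on_def by metis
  define V1 where "V1 = {y::complex \<times> complex. y \<noteq> 0 \<and> sgn y \<in> B}"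
  define V where "V = {y \<in> V1. snd (\<sigma> (F (sgn y))) \<noteq> 1}"
  have csgn: "Ck_on k V (\<lambda>y. inverse (norm y) *\<^sub>R y)" if "open V" "V \<subseteq> - {0}" for k and V :: "(complex \<times> complex) set"
    by (intro Ck_on_scaleR that Ck_on_subset[OF Ck_on_inverse_norm that(2)]
        Ck_on_linear[OF that(1), where L = "\<lambda>y. y"] bounded_linear_ident)
  have V1: "open V1"
  proof -
    have "continuous_on (- {0}) (sgn :: complex \<times> complex \<Rightarrow> _)"
      by (auto intro!: continuous_intros)
    moreover have "open (- {0 :: complex \<times> complex})" by auto
    ultimately have "open ((- {0}) \<inter> sgn -` B)"
      using F(1) continuous_open_preimage by blast
    moreover have "(- {0}) \<inter> sgn -` B = V1" by (auto simp: V1_def)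
    ultimately show ?thesis by simp
  qed
  have sgnV1: "Ck_on k V1 sgn" for k
  proof -
    have "Ck_on k V1 (\<lambda>y. inverse (norm y) *\<^sub>R y)"
      by (rule csgn[OF V1]) (auto simp: V1_def)
    then show ?thesis by (simp add: sgn_div_norm[abs_def])
  qed
  have FV1: "Ck_on k V1 (\<lambda>y. F (sgn y))" for k
    by (rule Ck_on_compose[OF V1 F(1) _ sgnV1 F(3)]) (simp add: V1_def)
  have \<sigma>V1: "Ck_on k V1 (\<lambda>y. \<sigma> (F (sgn y)))" for k
    by (rule Ck_on_compose[OF V1 open_UNIV _ FV1 Ck_on_linear[OF open_UNIV \<sigma>]]) simp
  have V: "open V"
  proof -
    have "continuous_on V1 (\<lambda>y. snd (\<sigma> (F (sgn y))))"
      using \<sigma>V1[of 0] by (auto intro!: continuous_intros)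
    then have "open (V1 \<inter> (\<lambda>y. snd (\<sigma> (F (sgn y)))) -` (- {1}))"
      using V1 by (intro continuous_open_preimage) auto
    moreover have "V1 \<inter> (\<lambda>y. snd (\<sigma> (F (sgn y)))) -` (- {1}) = V" by (auto simp: V_def)
    ultimately show ?thesis by simp
  qed
  have eq: "F (sgn y) = \<pi> (sgn y)" if "y \<in> V1" for y
    using that F(4)[of "sgn y"] by (simp add: V1_def norm_sgn)
  have "open {q::complex \<times> real. snd q \<noteq> 1}"
    using open_Collect_neq[of "snd :: complex \<times> real \<Rightarrow> real" "\<lambda>_. 1"] by (simp add: continuous_on_snd)
  then have "Ck_on k V (\<lambda>y. stereo (\<sigma> (F (sgn y))))"
    by (intro Ck_on_compose[OF V _ _ Ck_on_subset[OF \<sigma>V1] stereo_Ck, of "{q. snd q \<noteq> 1}"])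
      (auto simp: V_def)
  then have "Ck_on k V (chart \<sigma> \<pi>)"
    by (rule Ck_on_cong[OF V, rotated]) (simp add: chart_def eq V_def)
  moreover have "x \<in> V1" using x0 F(2) by (simp add: V1_def)
  then have "x \<in> V" using x0(2) eq by (simp add: V_def)
  moreover have "V \<subseteq> chart_dom \<sigma> \<pi>" using eq by (auto simp: V_def V1_def chart_dom_def)
  ultimately show ?thesis using V by blast
qed

lemma smooth_on_differentiable:
  assumes "smooth_on (sphere 0 1) f" "p \<in> sphere 0 1"
  shows "(f has_derivative sphere_differential f p) (at p within sphere 0 1)"
proof -
  obtain B F where F: "open B" "p \<in> B" "\<And>k. Ck_on k B F" "\<And>x. x \<in> sphere 0 1 \<inter> B \<Longrightarrow> F x = f x"
    using assms unfolding smooth_on_def by metis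
  have "(F has_derivative frechet_derivative F (at p)) (at p within sphere 0 1)"
    using Ck_on_SucE(1)[OF F(3)] F(2) has_derivative_at_withinI by blast
  then have "(f has_derivative frechet_derivative F (at p)) (at p within sphere 0 1)"
  proof (rule has_derivative_transform_eventually)
    show "\<forall>\<^sub>F x in at p within sphere 0 1. F x = f x"
      using F(1,2,4) by (auto simp: eventually_at_topological)
  qed (use F assms in auto)
  then show ?thesis
    unfolding sphere_differential_def frechet_derivative_works[symmetric] by (rule differentiableI)
qed

text \<open>Conformality on the range of the adjoint makes \<open>L\<close> after its adjoint equal
  to \<open>c\<close> times the identity. The entries of this matrix are the sums of products of
  real and imaginary parts of the \<open>L b\<close>: equal diagonal entries and a zero off the
  diagonal say that the squares sum to 0.\<close>

lemma conformal_gradient_null: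
  fixes L :: "'a::euclidean_space \<Rightarrow> complex"
  assumes L: "linear L" "surj L" and H: "\<And>\<zeta>. adjoint L \<zeta> \<in> H"
    and conf: "\<And>u v. u \<in> H \<Longrightarrow> v \<in> H \<Longrightarrow> L u \<bullet> L v = c * (u \<bullet> v)"
  shows "(\<Sum>b\<in>Basis. (L b)\<^sup>2) = 0"
proof -
  let ?A = "adjoint L"
  define M where "M = (\<lambda>\<zeta>. L (?A \<zeta>))"
  have A: "linear ?A" by (rule adjoint_linear[OF L(1)])
  have adj: "?A \<zeta> \<bullet> v = \<zeta> \<bullet> L v" for \<zeta> v
    using adjoint_works[OF L(1), of v \<zeta>] by (simp add: inner_commute)
  have M: "linear M" unfolding M_def using linear_compose[OF A L(1)] by (simp add: o_def)
  have MM: "M \<zeta> \<bullet> M \<xi> = c * (\<zeta> \<bullet> M \<xi>)" for \<zeta> \<xi>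
    using conf[OF H H, of \<zeta> \<xi>] by (simp add: M_def adj)
  have "\<zeta> = 0" if "M \<zeta> = 0" for \<zeta>
  proof -
    have "?A \<zeta> \<bullet> ?A \<zeta> = 0" using that by (simp add: adj M_def)
    then have "\<zeta> \<bullet> L v = 0" for v using adj[of \<zeta> v] by simp
    moreover obtain v where "L v = \<zeta>" using L(2) by (metis surjD)
    ultimately have "\<zeta> \<bullet> \<zeta> = 0" by metis
    then show ?thesis by simp
  qed
  then have "inj M" using M linear_injective_0 by blast
  then have "surj M" using M linear_injective_imp_surjective by blast
  \<comment> \<open>Every vector is some \<open>M \<xi>\<close>, so \<open>MM\<close> says that
    \<open>M\<close> is multiplication by \<open>c\<close>.\<close>
  have Mc: "M \<zeta> \<bullet> w = c * (\<zeta> \<bullet> w)" for \<zeta> w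
    using MM[of \<zeta> "inv M w"] surj_f_inv_f[OF \<open>surj M\<close>] by simp
  have S: "(\<Sum>b\<in>Basis. (\<zeta> \<bullet> L b) * (\<xi> \<bullet> L b)) = c * (\<zeta> \<bullet> \<xi>)" for \<zeta> \<xi>
  proof -
    have "(\<Sum>b\<in>Basis. (\<zeta> \<bullet> L b) * (\<xi> \<bullet> L b)) = (\<Sum>b\<in>Basis. (?A \<zeta> \<bullet> b) * (?A \<xi> \<bullet> b))"
      by (simp only: adj)
    also have "\<dots> = ?A \<zeta> \<bullet> ?A \<xi>" by (rule euclidean_inner[symmetric])
    also have "\<dots> = M \<xi> \<bullet> \<zeta>" unfolding adj M_def by (rule inner_commute)
    finally show ?thesis unfolding Mc inner_commute[of \<xi>] .
  qed
  have "(\<Sum>b\<in>Basis. Re (L b) * Re (L b)) = c" "(\<Sum>b\<in>Basis. Im (L b) * Im (L b)) = c"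
    "(\<Sum>b\<in>Basis. Re (L b) * Im (L b)) = 0"
    using S[of 1 1] S[of \<i> \<i>] S[of 1 \<i>] by (simp_all add: inner_complex_def)
  then show ?thesis
    by (simp add: complex_eq_iff Re_sum Im_sum power2_eq_square sum_subtractf mult.commute
        flip: mult_2 sum_distrib_left)
qed

text \<open>Stereographic projection and the isometry \<open>\<sigma>\<close> are conformal, so the
  chart inherits conformality on horizontal vectors; injectivity of stereographic projection keeps
  the fibres.\<close>

lemma chart_circle_map:
  fixes \<pi> :: "complex \<times> complex \<Rightarrow> complex \<times> real"
  assumes \<pi>: "conformal_submersion \<pi>"
    and circ: "\<And>q. q \<in> S2 \<Longrightarrow> is_circle {p \<in> S3. \<pi> p = q}"
    and \<sigma>: "bounded_linear \<sigma>" "\<And>x. \<sigma> (\<sigma> x) = x" "\<And>x y. \<sigma> x \<bullet> \<sigma> y = x \<bullet> y"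
  shows "circle_map (chart \<sigma> \<pi>) (chart_dom \<sigma> \<pi>)"
proof -
  let ?W = "chart \<sigma> \<pi>" and ?U = "chart_dom \<sigma> \<pi>"
  have sm: "smooth_on S3 \<pi>" and im: "\<And>p. p \<in> S3 \<Longrightarrow> \<pi> p \<in> S2"
    and sub: "\<And>p. p \<in> S3 \<Longrightarrow> sphere_differential \<pi> p ` sphere_tangent p = sphere_tangent (\<pi> p)"
    and con: "\<And>p. p \<in> S3 \<Longrightarrow> conformal_linear_on (horizontal_space \<pi> p) (sphere_differential \<pi> p)"
    using \<pi> unfolding conformal_submersion_def submersion_def by blast+
  have n\<sigma>: "norm (\<sigma> q) = norm q" for q by (simp add: norm_eq_sqrt_inner \<sigma>(3))
  have loc: "\<exists>V. open V \<and> x \<in> V \<and> V \<subseteq> ?U \<and> Ck_on k V ?W" if "x \<in> ?U" for x k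
    by (rule chart_local[OF sm \<sigma>(1) that])
  have op: "open ?U" using loc[of _ 0] by (subst open_subopen) blast
  have Ck: "Ck_on k ?U ?W" for k using loc by (intro Ck_on_local) blast
  have scale: "t *\<^sub>R x \<in> ?U \<and> ?W (t *\<^sub>R x) = ?W x" if "x \<in> ?U" "t > 0" for x t
    using that by (simp add: chart_dom_def chart_def sgn_scaleR)
  define DW where "DW = (\<lambda>x. frechet_derivative ?W (at x))"
  have DW: "(?W has_derivative DW x) (at x)" if "x \<in> ?U" for x
    unfolding DW_def by (rule Ck_on_SucE(1)[OF Ck that])
  have unit: "norm (\<sigma> (\<pi> x)) = 1" "snd (\<sigma> (\<pi> x)) \<noteq> 1" if "x \<in> ?U" "norm x = 1" for x
    using that im[of x] by (simp_all add: n\<sigma> chart_dom_def sgn_unit)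
  have tan: "DW x u = dstereo (\<sigma> (\<pi> x)) (\<sigma> (sphere_differential \<pi> x u))"
    if x: "x \<in> ?U" "norm x = 1" and u: "u \<in> sphere_tangent x" for x u
  proof -
    let ?D = "\<lambda>u. dstereo (\<sigma> (\<pi> x)) (\<sigma> (sphere_differential \<pi> x u))"
    have xS: "x \<in> S3" using x by simp
    have "((\<lambda>p. stereo (\<sigma> (\<pi> p))) has_derivative ?D) (at x within S3)"
      by (rule has_derivative_compose[OF bounded_linear.has_derivative[OF \<sigma>(1) smooth_on_differentiable[OF sm xS]]
            stereo_deriv[OF unit(2)[OF x]]])
    then have "(?W has_derivative ?D) (at x within S3)"
      by (rule has_derivative_transform[OF xS, rotated]) (simp add: chart_def sgn_unit)
    from sphere_derivative_unique[OF has_derivative_at_withinI[OF DW[OF x(1)]] this xS u]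
    show ?thesis .
  qed
  have surj: "surj (DW x)" if x: "x \<in> ?U" "norm x = 1" for x
    unfolding surj_def
  proof
    fix w
    obtain v where v: "v \<bullet> \<sigma> (\<pi> x) = 0" "dstereo (\<sigma> (\<pi> x)) v = w"
      by (rule dstereo_surj[OF unit[OF x]])
    have "\<sigma> v \<bullet> \<pi> x = 0" using \<sigma>(3)[of v "\<sigma> (\<pi> x)"] v(1) by (simp add: \<sigma>(2))
    then have "\<sigma> v \<in> sphere_differential \<pi> x ` sphere_tangent x"
      using sub[of x] x(2) by (simp add: sphere_tangent_def)
    then obtain u where u: "u \<in> sphere_tangent x" "sphere_differential \<pi> x u = \<sigma> v" by (metis imageE)
    have "w = DW x u" using tan[OF x u(1)] u(2) v(2) \<sigma>(2) by simp
    then show "\<exists>u. w = DW x u" ..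
  qed
  have radial: "DW x x = 0" if x: "x \<in> ?U" for x
    using radial_derivative_zero[OF DW[OF x]] scale[OF x] by blast
  have null: "(\<Sum>b\<in>Basis. (DW x b)\<^sup>2) = 0" if x: "x \<in> ?U" "norm x = 1" for x
  proof -
    have xS: "x \<in> S3" using x by simp
    have L: "linear (DW x)" using DW[OF x(1)] has_derivative_linear by blast
    have adj: "adjoint (DW x) \<zeta> \<bullet> v = \<zeta> \<bullet> DW x v" for \<zeta> v
      using adjoint_works[OF L, of v \<zeta>] by (simp add: inner_commute)
    \<comment> \<open>The gradients of the chart are horizontal because \<open>DW x\<close> kills
      both \<open>x\<close> and the vertical space.\<close>
    have H: "adjoint (DW x) \<zeta> \<in> horizontal_space \<pi> x" for \<zeta>
      unfolding horizontal_space_def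
    proof (intro CollectI conjI ballI)
      show "adjoint (DW x) \<zeta> \<in> sphere_tangent x"
        unfolding sphere_tangent_def by (simp add: adj radial[OF x(1)])
      fix w assume "w \<in> vertical_space \<pi> x"
      then have "w \<in> sphere_tangent x" "sphere_differential \<pi> x w = 0" by (auto simp: vertical_space_def)
      then have "DW x w = 0"
        using tan[OF x] linear_0[OF bounded_linear.linear[OF \<sigma>(1)]] by (simp add: dstereo_def)
      then show "adjoint (DW x) \<zeta> \<bullet> w = 0" by (simp add: adj)
    qed
    obtain c where c: "\<And>u v. u \<in> horizontal_space \<pi> x \<Longrightarrow> v \<in> horizontal_space \<pi> x \<Longrightarrow>
        sphere_differential \<pi> x u \<bullet> sphere_differential \<pi> x v = c * (u \<bullet> v)"
      using con[OF xS] unfolding conformal_linear_on_def by blast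
    show ?thesis
    proof (rule conformal_gradient_null[OF L surj[OF x] H])
      fix u v assume u: "u \<in> horizontal_space \<pi> x" and v: "v \<in> horizontal_space \<pi> x"
      have ut: "u \<in> sphere_tangent x" "v \<in> sphere_tangent x"
        using u v by (auto simp: horizontal_space_def)
      have "sphere_differential \<pi> x u \<bullet> \<pi> x = 0" "sphere_differential \<pi> x v \<bullet> \<pi> x = 0"
        using sub[OF xS] ut unfolding sphere_tangent_def by blast+
      then show "DW x u \<bullet> DW x v = (inverse ((1 - snd (\<sigma> (\<pi> x)))\<^sup>2) * c) * (u \<bullet> v)"
        unfolding tan[OF x ut(1)] tan[OF x ut(2)]
        by (subst dstereo_conformal[OF unit[OF x]]) (simp_all add: \<sigma>(3) c[OF u v])
    qed
  qed
  have circle: "is_circle {p \<in> S3. p \<in> ?U \<and> ?W p = ?W x}" if x: "x \<in> ?U" "norm x = 1" for x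
  proof -
    have "\<pi> p = \<pi> x" if p: "p \<in> ?U" "norm p = 1" "?W p = ?W x" for p
    proof -
      have "stereo (\<sigma> (\<pi> p)) = stereo (\<sigma> (\<pi> x))" using p x by (simp add: chart_def sgn_unit)
      then have "\<sigma> (\<pi> p) = \<sigma> (\<pi> x)" using hopf_stereo[OF unit[OF x]] hopf_stereo[OF unit[OF p(1,2)]] by simp
      then show ?thesis by (metis \<sigma>(2))
    qed
    moreover have "p \<in> ?U \<and> ?W p = ?W x" if "norm p = 1" "\<pi> p = \<pi> x" for p
      using that x by (auto simp: chart_dom_def chart_def sgn_unit)
    ultimately have "{p \<in> S3. p \<in> ?U \<and> ?W p = ?W x} = {p \<in> S3. \<pi> p = \<pi> x}" by auto
    then show ?thesis using circ[OF im] x(2) by simp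
  qed
  show ?thesis
    by (unfold_locales; (fold DW_def)?)
      (use op scale Ck surj null circle in \<open>auto simp: DW_def\<close>)
qed

section \<open>The global argument\<close>

lemma entire_linear_growth:
  fixes f :: "complex \<Rightarrow> complex"
  assumes hol: "f holomorphic_on UNIV" and lim: "((\<lambda>z. f z / z) \<longlongrightarrow> l) at_infinity"
  shows "f z = f 0 + l * z"
proof -
  have "\<forall>\<^sub>F z in at_infinity. norm (f z / z) < norm l + 1"
    using tendsto_norm[OF lim] by (rule order_tendstoD) simp
  then obtain A where A: "\<And>z. A \<le> norm z \<Longrightarrow> norm (f z / z) < norm l + 1"
    by (auto simp: eventually_at_infinity)
  have bd: "norm (f z) \<le> (norm l + 1) * norm z ^ 1" if "max A 1 \<le> norm z" for z
  proof -
    have "norm z > 0" "A \<le> norm z" using that by linarith+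
    then show ?thesis using A[of z] by (simp add: norm_divide divide_less_eq)
  qed
  have f: "f z = f 0 + deriv f 0 * z" for z
  proof -
    have "f z = (\<Sum>k\<le>1. (deriv ^^ k) f 0 / fact k * z ^ k)"
      by (rule Liouville_polynomial[OF hol]) (rule bd)
    then show ?thesis by simp
  qed
  have "((\<lambda>z. f 0 * inverse z + deriv f 0) \<longlongrightarrow> f 0 * 0 + deriv f 0) at_infinity"
    by (intro tendsto_intros tendsto_inverse_0)
  moreover have "\<forall>\<^sub>F z in at_infinity. f 0 * inverse z + deriv f 0 = f z / z"
  proof -
    have "\<forall>\<^sub>F z::complex in at_infinity. z \<noteq> 0" by (rule eventually_not_equal_at_infinity)
    then show ?thesis
    proof eventually_elim
      case (elim z)
      then show ?case unfolding f[of z] by (simp add: field_simps)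
    qed
  qed
  ultimately have "((\<lambda>z. f z / z) \<longlongrightarrow> deriv f 0) at_infinity"
    by (simp add: tendsto_cong)
  then have "l = deriv f 0" by (rule tendsto_unique[OF trivial_limit_at_infinity lim])
  then show ?thesis using f[of z] by simp
qed

text \<open>The square is a quadratic polynomial in \<open>z\<close> that vanishes identically. Thus
  a line of null vectors spans a totally null plane.\<close>

lemma minkowski_linear_family:
  assumes "\<And>z. minkowski (\<lambda>p. f p + z * g p) (\<lambda>p. f p + z * g p) = 0"
  shows "minkowski f f = 0" "minkowski g g = 0" "minkowski f g = 0"
proof -
  have *: "minkowski f f + 2 * z * minkowski f g + z * z * minkowski g g = 0" for z
    using assms[of z] by (simp add: minkowski_add_left minkowski_add_right minkowski_scale_left minkowski_scale_right
        minkowski_commute[of g f] algebra_simps)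
  show "minkowski f f = 0" using *[of 0] by simp
  with *[of 1] *[of "-1"] show "minkowski g g = 0" "minkowski f g = 0" by (auto simp: algebra_simps eq_neg_iff_add_eq_0)
qed

theorem theorem4p7:
  fixes \<pi> :: "complex \<times> complex \<Rightarrow> complex \<times> real"
  assumes "conformal_submersion \<pi>"
    and "\<And>q. q \<in> S2 \<Longrightarrow> is_circle {p \<in> S3. \<pi> p = q}"
  shows "\<exists>(f :: complex \<times> complex \<Rightarrow> complex \<times> complex) (g :: complex \<times> real \<Rightarrow> complex \<times> real).
           conformal_transformation f \<and> conformal_transformation g \<and>
           (\<forall>p\<in>S3. (g \<circ> \<pi> \<circ> f) p = hopf p)"
proof -
  \<comment> \<open>\<open>?R\<close> acts as \<open>z \<mapsto> 1 / z\<close> on the Riemann sphere.\<close>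
  let ?R = "\<lambda>x::complex \<times> real. (cnj (fst x), - snd x)"
  let ?W = "chart (\<lambda>x. x) \<pi>" and ?U = "chart_dom (\<lambda>x. x) \<pi>"
  let ?W' = "chart ?R \<pi>" and ?U' = "chart_dom ?R \<pi>"
  interpret A: circle_map ?W ?U
    by (rule chart_circle_map[OF assms]) (simp_all add: bounded_linear_ident)
  interpret B: circle_map ?W' ?U'
  proof (rule chart_circle_map[OF assms])
    show "bounded_linear ?R"
      by (intro bounded_linear_Pair bounded_linear_minus bounded_linear_snd
          bounded_linear_compose[OF bounded_linear_cnj bounded_linear_fst])
  qed (auto simp: inner_prod_def inner_complex_def)
  have im: "norm (\<pi> p) = 1" if "norm p = 1" for p
  proof -
    have "\<pi> ` S3 \<subseteq> S2" using assms(1) by (simp add: conformal_submersion_def submersion_def)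
    moreover have "p \<in> S3" using that by simp
    ultimately have "\<pi> p \<in> S2" by blast
    then show ?thesis by simp
  qed
  have U: "p \<in> ?U \<longleftrightarrow> snd (\<pi> p) \<noteq> 1" "p \<in> ?U' \<longleftrightarrow> snd (\<pi> p) \<noteq> - 1" if "norm p = 1" for p
    using that by (auto simp: chart_dom_def sgn_unit)
  have W: "?W p = stereo (\<pi> p)" "?W' p = inverse (1 + snd (\<pi> p)) *\<^sub>R cnj (fst (\<pi> p))" if "norm p = 1" for p
    using that by (simp_all add: chart_def sgn_unit stereo_def)
  have pole: "\<pi> p = (0, 1)" if "norm p = 1" "p \<notin> ?U" for p
    using im[OF that(1)] U(1)[OF that(1)] that(2)
    by (cases "\<pi> p") (simp add: norm_Pair real_sqrt_eq_1_iff)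
  have onto: "\<exists>p. norm p = 1 \<and> \<pi> p = q" if "norm q = 1" for q
    using assms(2)[of q] that unfolding is_circle_def by auto

  \<comment> \<open>Normalization at a point over the pole and the entire family
    \<open>P\<close>\<close>
  obtain x0 where x0: "norm x0 = 1" "\<pi> x0 = (0, 1)" using onto[of "(0, 1)"] by auto
  have x0U: "x0 \<notin> ?U" and x0U': "x0 \<in> ?U'" and W'x0: "?W' x0 = 0"
    using U[OF x0(1)] W(2)[OF x0(1)] x0(2) by simp_all
  \<comment> \<open>\<open>x0\<close> lies over infinity, hence on no fibre over a finite value of
    the chart.\<close>
  have psi_x0: "A.psi p x0 \<noteq> 0" if "p \<in> ?U" "norm p = 1" for p
    using A.psi_zero_iff[OF that x0(1)] x0U by (auto simp: A.fib_def)

  have "\<exists>p. p \<in> ?U \<and> norm p = 1 \<and> ?W p = z" for z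
  proof -
    define q where "q = hopf (z, 1)"
    have q: "q = (2 * z / of_real ((norm z)\<^sup>2 + 1), ((norm z)\<^sup>2 - 1) / ((norm z)\<^sup>2 + 1))"
      unfolding q_def using hopf_eq[of z 1] by (simp add: zero_prod_def)
    define m where "m = (norm z)\<^sup>2 + 1"
    have m: "m > 0" unfolding m_def by (simp add: add_nonneg_pos)
    have q': "q = (2 * z / of_real m, 1 - 2 / m)"
      using m unfolding q by (auto simp: m_def field_simps)
    have "(norm (fst q))\<^sup>2 + (snd q)\<^sup>2 = 1"
    proof -
      have "(norm (fst q))\<^sup>2 = 4 * (m - 1) / m\<^sup>2"
      proof -
        have "(norm z)\<^sup>2 = m - 1" by (simp add: m_def)
        then show ?thesis using m by (simp add: q' norm_divide norm_mult power_divide power_mult_distrib)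
      qed
      moreover have "(snd q)\<^sup>2 = (m - 2)\<^sup>2 / m\<^sup>2"
        using m by (simp add: q' diff_divide_distrib power_divide[symmetric])
      moreover have "4 * (m - 1) / m\<^sup>2 + (m - 2)\<^sup>2 / m\<^sup>2 = 1"
        using m by (simp add: add_divide_distrib[symmetric] power2_eq_square algebra_simps)
      ultimately show ?thesis by simp
    qed
    then have "norm q = 1" by (simp add: norm_prod_def)
    then obtain p where p: "norm p = 1" "\<pi> p = q" using onto by blast
    have s1: "1 - snd q = 2 / m" by (simp add: q')
    have "snd (\<pi> p) \<noteq> 1" using m s1 by (auto simp: p(2))
    moreover have "stereo q = z"
      unfolding stereo_def s1 using m by (simp add: q' scaleR_conv_of_real)
    ultimately show ?thesis
      using p U(1)[OF p(1)] W(1)[OF p(1)] by (intro exI[of _ p]) simp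
  qed
  then obtain sel where sel: "\<And>z. sel z \<in> ?U" "\<And>z. norm (sel z) = 1" "\<And>z. ?W (sel z) = z" by metis
  define P where "P = (\<lambda>z p. A.psi (sel z) p / A.psi (sel z) x0)"
  \<comment> \<open>By \<open>A.psi_fibre\<close> the quotient depends on the fibre alone, so the
    arbitrary choice \<open>sel\<close> leaves no trace in \<open>P\<close>.\<close>
  have P: "P (?W y) p = A.psi y p / A.psi y x0" if y: "y \<in> ?U" "norm y = 1" for y p
  proof -
    have "y \<in> A.fib (sel (?W y))" using y sel by (simp add: A.fib_def)
    then obtain k where "k \<noteq> 0" "\<And>p. A.psi y p = k * A.psi (sel (?W y)) p"
      using A.psi_fibre[OF sel(1,2)] by metis
    then show ?thesis by (simp add: P_def)
  qed
  have hol: "(\<lambda>z. P z p) holomorphic_on UNIV" for p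
  proof (rule holomorphic_onI)
    fix z :: complex
    have "(\<lambda>z. P z p) field_differentiable (at (?W (sel z)))"
    proof (rule A.normalized_holomorphic[OF sel(1,2) psi_x0[OF sel(1,2)]])
      show "\<forall>\<^sub>F w in nhds (?W (sel z)). \<forall>y\<in>?U. norm y = 1 \<longrightarrow> ?W y = w \<longrightarrow> (\<forall>p. P w p = A.psi y p / A.psi y x0)"
        using P by (intro always_eventually) blast
    qed
    then show "(\<lambda>z. P z p) field_differentiable (at z within UNIV)" by (simp add: sel(3))
  qed

  \<comment> \<open>Comparison of the two charts\<close>
  have trans: "y \<in> ?U \<and> ?W y = inverse w \<and> (\<exists>k. k \<noteq> 0 \<and> (\<forall>p. B.psi y p = k * A.psi y p))"
    if y: "y \<in> ?U'" "norm y = 1" "?W' y = w" "w \<noteq> 0" for y w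
  proof -
    have yU: "y \<in> ?U"
    proof (rule ccontr)
      assume "y \<notin> ?U"
      then have "\<pi> y = (0, 1)" using pole y(2) by blast
      then show False using W(2)[OF y(2)] y(3,4) by simp
    qed
    have prod: "?W v * ?W' v = 1" if v: "v \<in> ?U \<inter> ?U'" for v
    proof -
      obtain \<zeta> t where q: "\<pi> (sgn v) = (\<zeta>, t)" by (cases "\<pi> (sgn v)")
      have v0: "v \<noteq> 0" "t \<noteq> 1" "t \<noteq> - 1" using v q by (auto simp: chart_dom_def)
      have "norm (\<zeta>, t) = 1" using im[of "sgn v"] v0 q by (simp add: norm_sgn)
      then have "(norm \<zeta>)\<^sup>2 = (1 - t) * (1 + t)"
        by (simp add: norm_Pair real_sqrt_eq_1_iff power2_eq_square algebra_simps)
      then have e1: "\<zeta> * cnj \<zeta> = of_real ((1 - t) * (1 + t))" by (simp only: complex_norm_square[symmetric])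
      have e2: "?W v * ?W' v = of_real (inverse ((1 - t) * (1 + t))) * (\<zeta> * cnj \<zeta>)"
        by (simp add: chart_def stereo_def q scaleR_conv_of_real)
      have "(1 - t) * (1 + t) \<noteq> 0" using v0 by auto
      then show ?thesis
        unfolding e2 e1 of_real_mult[symmetric] by (metis left_inverse of_real_1)
    qed
    have Wy: "?W y = inverse w" using prod[of y] yU y by (simp add: inverse_unique mult.commute)
    have W0: "?W y \<noteq> 0" using Wy y(4) by simp
    \<comment> \<open>The charts are reciprocal, so their differentials differ by the factor
      \<open>\<kappa>\<close>. The fibres agree, a common frame computes both values of
      \<open>mu\<close>, and therefore \<open>psi\<close> scales by \<open>\<kappa>\<close> as
      well.\<close>
    define \<kappa> where "\<kappa> = - (inverse (?W y) * inverse (?W y))"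
    have \<kappa>: "\<kappa> \<noteq> 0" using W0 by (simp add: \<kappa>_def)
    have DWB: "B.DW y v = \<kappa> * A.DW y v" for v
    proof -
      have d: "((\<lambda>v. inverse (?W v)) has_derivative (\<lambda>v. - (inverse (?W y) * A.DW y v * inverse (?W y)))) (at y)"
        by (rule Deriv.has_derivative_inverse[OF W0 A.DW_deriv[OF yU]])
      have "(?W' has_derivative (\<lambda>v. - (inverse (?W y) * A.DW y v * inverse (?W y)))) (at y)"
        by (rule has_derivative_transform_within_open[OF d, of "?U \<inter> ?U'"])
          (use A.open_U B.open_U yU y(1) prod in \<open>auto intro!: inverse_unique\<close>)
      from fun_cong[OF has_derivative_unique[OF this B.DW_deriv[OF y(1)]], of v]
      have "B.DW y v = - (inverse (?W y) * A.DW y v * inverse (?W y))" by simp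
      then show ?thesis by (simp add: \<kappa>_def)
    qed
    have fib: "B.fib y = A.fib y"
    proof -
      have "p \<in> B.fib y \<longleftrightarrow> p \<in> A.fib y" for p
      proof
        assume p: "p \<in> B.fib y"
        have p': "p \<in> ?U'" "norm p = 1" "?W' p = w" using p y(3) by (auto simp: B.fib_def)
        have pU: "p \<in> ?U"
        proof (rule ccontr)
          assume "p \<notin> ?U"
          then have "\<pi> p = (0, 1)" by (rule pole[OF p'(2)])
          then show False using W(2)[OF p'(2)] p'(3) y(4) by simp
        qed
        have "?W' p * ?W p = 1" using prod[of p] pU p'(1) by (simp add: mult.commute)
        then have "?W p = inverse w" using p'(3) inverse_unique by metis
        then show "p \<in> A.fib y" using pU p'(2) Wy by (simp add: A.fib_def)
      next
        assume p: "p \<in> A.fib y"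
        have p': "p \<in> ?U" "norm p = 1" "?W p = ?W y" using p by (auto simp: A.fib_def)
        have "\<pi> p = \<pi> y"
          using hopf_stereo[of "\<pi> p"] hopf_stereo[of "\<pi> y"] im U(1) W(1) p' y(2) yU by metis
        then show "p \<in> B.fib y"
          using p' y by (simp add: B.fib_def U W)
      qed
      then show ?thesis by blast
    qed
    obtain T N r where fr: "A.frame y T N r" by (rule A.frame_exists[OF yU y(2)])
    then have fr': "B.frame y T N r" unfolding A.frame_def B.frame_def fib .
    have "B.mu y = \<kappa> * A.mu y"
      unfolding A.mu_frame[OF yU y(2) fr] B.mu_frame[OF y(1,2) fr'] DWB by simp
    then have "B.psi y p = \<kappa> * A.psi y p" for p
      unfolding A.psi_def B.psi_def DWB by (simp add: algebra_simps)
    then show ?thesis using yU Wy \<kappa> by blast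
  qed

  \<comment> \<open>Growth of the family at infinity\<close>
  obtain \<Psi> \<Psi>' where \<Psi>: "\<forall>\<^sub>F w in nhds (?W' x0). \<exists>y\<in>?U'. norm y = 1 \<and> ?W' y = w \<and> \<Psi> w = B.psi y"
    "\<Psi> (?W' x0) = B.psi x0"
    "\<And>p. ((\<lambda>w. \<Psi> w p) has_derivative (\<lambda>\<zeta>. \<Psi>' \<zeta> p)) (at (?W' x0))"
    "\<And>y. y \<in> B.fib x0 \<Longrightarrow> \<exists>k. k \<noteq> 0 \<and> (\<forall>\<zeta>. \<Psi>' \<zeta> y = k * \<zeta>)"
    by (rule B.local_family[OF x0U' x0(1)]) (rule that)
  obtain k where k: "k \<noteq> 0" "\<And>\<zeta>. \<Psi>' \<zeta> x0 = k * \<zeta>"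
    using \<Psi>(4)[OF B.fib_self[OF x0U' x0(1)]] by blast
  define \<psi>1 where "\<psi>1 = (\<lambda>p. inverse k * B.psi x0 p)"
  \<comment> \<open>With \<open>w = 1 / z\<close> the quotient \<open>P z p / z\<close> is
    \<open>\<Psi> w p / (\<Psi> w x0 / w)\<close>. The numerator tends to \<open>B.psi x0 p\<close>,
    and the denominator tends to \<open>k\<close>, which is nonzero because
    \<open>\<Psi> w x0\<close> has a simple zero at 0.\<close>
  have lim: "((\<lambda>z. P z p / z) \<longlongrightarrow> \<psi>1 p) at_infinity" for p
  proof -
    have D: "((\<lambda>w. \<Psi> w x0) has_field_derivative k) (at 0)"
      using \<Psi>(3)[of x0] W'x0 by (simp add: has_field_derivative_def k(2) mult_commute_abs)
    have \<Psi>0: "\<Psi> 0 x0 = 0" using \<Psi>(2) B.psi_self[OF x0U' x0(1)] W'x0 by simp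
    have "((\<lambda>w. \<Psi> w x0 / w) \<longlongrightarrow> k) (at 0)"
      using D \<Psi>0 by (simp add: has_field_derivative_iff)
    moreover have "((\<lambda>w. \<Psi> w p) \<longlongrightarrow> B.psi x0 p) (at 0)"
      using has_derivative_continuous[OF \<Psi>(3)[of p]] \<Psi>(2) W'x0 by (simp add: continuous_at)
    ultimately have "((\<lambda>w. \<Psi> w p / (\<Psi> w x0 / w)) \<longlongrightarrow> B.psi x0 p / k) (at 0)"
      using k(1) by (intro tendsto_divide)
    moreover have "\<forall>\<^sub>F w in at 0. \<Psi> w p / (\<Psi> w x0 / w) = P (inverse w) p / inverse w"
    proof -
      have "\<forall>\<^sub>F w in at 0. \<exists>y\<in>?U'. norm y = 1 \<and> ?W' y = w \<and> \<Psi> w = B.psi y"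
        using \<Psi>(1) W'x0 by (auto simp: eventually_at_filter elim: eventually_mono)
      moreover have "\<forall>\<^sub>F w::complex in at 0. w \<noteq> 0" by (simp add: eventually_at_filter)
      ultimately show ?thesis
      proof eventually_elim
        case (elim w)
        then obtain y where y: "y \<in> ?U'" "norm y = 1" "?W' y = w" "\<Psi> w = B.psi y" by blast
        from trans[OF y(1-3) elim(2)] obtain l where
          l: "y \<in> ?U" "?W y = inverse w" "l \<noteq> 0" "\<And>p. B.psi y p = l * A.psi y p" by blast
        have "P (inverse w) p = \<Psi> w p / \<Psi> w x0"
          using P[OF l(1) y(2), of p] l by (simp add: y(4))
        then show ?case by (simp add: divide_inverse)
      qed
    qed
    ultimately have "((\<lambda>w. P (inverse w) p / inverse w) \<longlongrightarrow> B.psi x0 p / k) (at 0)"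
      by (simp add: tendsto_cong)
    then show ?thesis
      unfolding lim_at_infinity_0 by (simp add: o_def \<psi>1_def divide_inverse mult.commute)
  qed

  \<comment> \<open>The null plane and an orthogonal basis of it\<close>
  define \<psi>0 where "\<psi>0 = P 0"
  have Plin: "P z = (\<lambda>p. \<psi>0 p + z * \<psi>1 p)" for z
    by (rule ext) (simp add: \<psi>0_def entire_linear_growth[OF hol lim, of z] mult.commute)
  have Pz: "P z = (\<lambda>p. inverse (A.psi (sel z) x0) * A.psi (sel z) p)" for z
    by (rule ext) (simp add: P_def divide_inverse mult.commute)
  have "minkowski (P z) (P z) = 0" for z
    unfolding Pz minkowski_scale_left minkowski_scale_right A.minkowski_psi(1)[OF sel(1,2)] by simp
  then have iso: "minkowski \<psi>0 \<psi>0 = 0" "minkowski \<psi>1 \<psi>1 = 0" "minkowski \<psi>0 \<psi>1 = 0"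
    unfolding Plin by (blast intro: minkowski_linear_family)+
  have herm: "\<exists>r>0. minkowski (\<lambda>p. c * f p) (\<lambda>p. cnj (c * f p)) = of_real r"
    if "c \<noteq> 0" "minkowski f (\<lambda>p. cnj (f p)) = of_real s" "s > 0" for c s and f :: "complex \<times> complex \<Rightarrow> complex"
  proof -
    have "minkowski (\<lambda>p. c * f p) (\<lambda>p. cnj (c * f p)) = (c * cnj c) * of_real s"
      unfolding complex_cnj_mult minkowski_scale_left minkowski_scale_right that(2) by simp
    also have "\<dots> = of_real ((norm c)\<^sup>2 * s)" by (simp only: complex_norm_square of_real_mult)
    finally show ?thesis using that by (intro exI[of _ "(norm c)\<^sup>2 * s"]) simp
  qed
  obtain r1 where r1: "r1 > 0" "minkowski \<psi>1 (\<lambda>p. cnj (\<psi>1 p)) = of_real r1"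
    using herm[OF _ B.minkowski_psi(2,3)[OF x0U' x0(1)], of "inverse k"] k(1) unfolding \<psi>1_def by auto
  \<comment> \<open>Gram-Schmidt: removing \<open>t\<close> times \<open>\<psi>1\<close> from
    \<open>\<psi>0\<close> gives \<open>P (- t)\<close>, orthogonal to \<open>\<psi>1\<close>. As a
    multiple of the vector of the fibre over \<open>- t\<close> it has positive Hermitian
    square.\<close>
  define t where "t = minkowski \<psi>0 (\<lambda>p. cnj (\<psi>1 p)) / of_real r1"
  have PsiT: "P (- t) = (\<lambda>p. \<psi>0 p + (- t) * \<psi>1 p)" by (rule Plin)
  obtain r0 where r0: "r0 > 0" "minkowski (P (- t)) (\<lambda>p. cnj (P (- t) p)) = of_real r0"
    using herm[OF _ A.minkowski_psi(2,3)[OF sel(1,2)], of "inverse (A.psi (sel (- t)) x0)" "- t"]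
      psi_x0[OF sel(1,2)] unfolding Pz by auto
  define c0 where "c0 = sqrt (2 / r0)"
  define c1 where "c1 = sqrt (2 / r1)"
  have c: "c0 > 0" "c1 > 0" "c0 * c0 * r0 = 2" "c1 * c1 * r1 = 2"
    using r0(1) r1(1) by (simp_all add: c0_def c1_def)
  define \<phi>0 where "\<phi>0 = (\<lambda>p. of_real c0 * P (- t) p)"
  define \<phi>1 where "\<phi>1 = (\<lambda>p. of_real c1 * \<psi>1 p)"
  have cnj\<phi>: "(\<lambda>p. cnj (\<phi>0 p)) = (\<lambda>p. of_real c0 * cnj (P (- t) p))"
    "(\<lambda>p. cnj (\<phi>1 p)) = (\<lambda>p. of_real c1 * cnj (\<psi>1 p))" by (simp_all add: \<phi>0_def \<phi>1_def)
  have aff1: "affine_fn \<phi>1"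
    unfolding \<phi>1_def \<psi>1_def by (intro affine_fn_cmult B.psi_affine x0U')
  have aff0: "affine_fn \<phi>0"
    unfolding \<phi>0_def Pz by (intro affine_fn_cmult A.psi_affine sel)
  have mkP1: "minkowski (P (- t)) (\<lambda>p. cnj (\<psi>1 p)) = 0"
    unfolding PsiT minkowski_add_left minkowski_scale_left r1(2) using r1(1) by (simp add: t_def)
  obtain f where f: "conformal_transformation f"
    "\<And>X. norm X = 1 \<Longrightarrow> norm (f X) = 1 \<and> (\<exists>t>0. \<phi>0 (f X) = of_real t * fst X \<and> \<phi>1 (f X) = of_real t * snd X)"
  proof (rule orthonormal_frame_mobius[OF aff0 aff1])
    show "minkowski \<phi>0 \<phi>0 = 0" "minkowski \<phi>1 \<phi>1 = 0" "minkowski \<phi>0 \<phi>1 = 0"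
      unfolding \<phi>0_def \<phi>1_def PsiT minkowski_add_left minkowski_add_right minkowski_scale_left minkowski_scale_right
        iso iso(3)[unfolded minkowski_commute[of \<psi>0 \<psi>1]] by simp_all
    show "minkowski \<phi>0 (\<lambda>p. cnj (\<phi>0 p)) = 2"
      unfolding cnj\<phi> unfolding \<phi>0_def minkowski_scale_left minkowski_scale_right r0(2)
      using c(3) by (metis mult.assoc of_real_mult of_real_numeral)
    show "minkowski \<phi>1 (\<lambda>p. cnj (\<phi>1 p)) = 2"
      unfolding cnj\<phi> unfolding \<phi>1_def minkowski_scale_left minkowski_scale_right r1(2)
      using c(4) by (metis mult.assoc of_real_mult of_real_numeral)
    show "minkowski \<phi>0 (\<lambda>p. cnj (\<phi>1 p)) = 0"
      unfolding cnj\<phi> unfolding \<phi>0_def minkowski_scale_left minkowski_scale_right mkP1 by simp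
  qed (rule that)
  \<comment> \<open>On the fibre over \<open>z\<close>, \<open>P z p = 0\<close> reads
    \<open>P (- t) p = - (z + t) * \<psi>1 p\<close>. The quotient of \<open>\<phi>0\<close> by
    \<open>\<phi>1\<close> there is \<open>- (c0 / c1) * (z + t)\<close>, that is
    \<open>a * z + a * t\<close>, which explains both parameters of \<open>?g\<close>.\<close>
  define a where "a = complex_of_real (- (c0 / c1))"
  have a: "a \<noteq> 0" using c by (simp add: a_def)
  let ?g = "affine_S2 a (a * t)"
  have "?g (\<pi> (f X)) = hopf X" if X: "norm X = 1" for X
  proof -
    obtain X1 X2 where XX: "X = (X1, X2)" by (cases X)
    define p where "p = f X"
    obtain \<tau> where \<tau>: "\<tau> > 0" "\<phi>0 p = of_real \<tau> * X1" "\<phi>1 p = of_real \<tau> * X2" and p: "norm p = 1"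
      using f(2)[OF X] by (auto simp: p_def XX)
    have X0: "X1 \<noteq> 0 \<or> X2 \<noteq> 0" using X XX by auto
    show ?thesis
    proof (cases "p \<in> ?U")
      case True
      define z where "z = ?W p"
      have "P z p = 0" unfolding z_def P[OF True p] using A.psi_self[OF True p] by simp
      then have "\<psi>0 p = - z * \<psi>1 p" unfolding Plin by (simp add: add_eq_0_iff2)
      then have Pt: "P (- t) p = - (z + t) * \<psi>1 p" unfolding PsiT by (simp add: algebra_simps)
      have "\<phi>0 p = (a * z + a * t) * \<phi>1 p"
        using c(2) unfolding \<phi>0_def \<phi>1_def a_def Pt by (simp add: field_simps)
      then have "of_real \<tau> * X1 = of_real \<tau> * ((a * z + a * t) * X2)"
        unfolding \<tau>(2,3) by (simp add: mult.left_commute)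
      then have X1: "X1 = (a * z + a * t) * X2" using \<tau>(1) by simp
      then have X2: "X2 \<noteq> 0" using X0 by auto
      have "\<pi> p = hopf (z, 1)"
        using hopf_stereo[OF im[OF p]] True U(1)[OF p] W(1)[OF p] by (simp add: z_def)
      then have "?g (\<pi> p) = hopf (a * z + a * t, 1)"
        using affine_S2_hopf[of z 1 a "a * t"] a by (simp add: zero_prod_def)
      also have "\<dots> = hopf (X2 * (a * z + a * t), X2 * 1)"
        by (rule hopf_scale[OF _ X2, symmetric]) (simp add: zero_prod_def)
      also have "\<dots> = hopf X" by (simp add: XX X1 mult.commute)
      finally show ?thesis by (simp add: p_def)
    next
      case False
      \<comment> \<open>On the fibre over infinity \<open>\<phi>1\<close> vanishes, and both sides
        are the north pole.\<close>
      have pq: "\<pi> p = (0, 1)" by (rule pole[OF p False])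
      then have "p \<in> B.fib x0" using U(2)[OF p] W(2)[OF p] p W'x0 by (simp add: B.fib_def)
      then have "B.psi x0 p = 0" using B.psi_zero_iff[OF x0U' x0(1) p] by blast
      then have "X2 = 0" using \<tau>(1,3) by (simp add: \<phi>1_def \<psi>1_def)
      then have X1: "X1 \<noteq> 0" using X0 by simp
      have h10: "hopf (c, 0) = (0, 1)" if "c \<noteq> 0" for c
        using hopf_eq[of c 0] that by (simp add: zero_prod_def)
      have "?g (\<pi> p) = ?g (hopf (1, 0))" using pq h10[of 1] by simp
      also have "\<dots> = hopf (a, 0)" using affine_S2_hopf[of 1 0 a "a * t"] a by (simp add: zero_prod_def)
      also have "\<dots> = hopf X" using h10[OF a] h10[OF X1] \<open>X2 = 0\<close> XX by simp
      finally show ?thesis by (simp add: p_def)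
    qed
  qed
  then show ?thesis
    using f(1) affine_S2_conformal[OF a, of "a * t"] by (intro exI[of _ f] exI[of _ ?g]) simp
qed

end
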